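(* Let $E\to M$ be a vector bundle with a Lie algebroid structure, $\Phi\in A^1(E^* )$ a $1$-cocycle, $a\in\mathbb R$, and let $P\in A^2(E)$ be a Jacobi element, i.e. $[\![P,P]\!]^\Phi=0$. Then the operator $$\pounds^{\Phi,a}_P\mu=\mathcal L_P\mu+(|\mu|+a)\,i_{P_\Phi}\mu+\Phi\wedge i_P\mu$$ is a homology operator on $A(E^* )$, i.e. $|\pounds^{\Phi,a}_P\mu|=|\mu|-1$ and $(\pounds^{\Phi,a}_P)^2=0$. Moreover, $\pounds^{\Phi,a}_P$ is a generating operator of the following Schouten-Nijenhuis bracket on $A(E^* )$: the bracket $$[\![\mu,\nu]\!]_P=(-1)^{|\mu|}\big(\pounds^{\Phi,a}_P(\mu\wedge\nu)-\pounds^{\Phi,a}_P(\mu)\wedge\nu-(-1)^{|\mu|}\mu\wedge\pounds^{\Phi,a}_P(\nu)\big)$$ does not depend on $a$ and is the Schouten-Nijenhuis bracket of the Lie algebroid bracket on $E^*$ defined for $\mu,\nu\in A^1(E^* )$ by $$[\![\mu,\nu]\!]_P=i_{P_\mu}\mathrm d^\Phi\nu-i_{P_\nu}\mathrm d^\Phi\mu+\mathrm d^\Phi\langle P,\mu\wedge\nu\rangle=\mathcal L^\Phi_{P_\mu}\nu-\mathcal L^\Phi_{P_\nu}\mu-\mathrm d^\Phi\langle P,\mu\wedge\nu\rangle .$$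
   Context: All objects are smooth. $A(E)=\bigoplus_k\mathrm{Sec}(\bigwedge^kE)$, $A^0(E)=C^\infty(M)$, $A(E^* )$ is the algebra of forms on $E$; $|X|$ is the Grassmann degree and $x=|X|-1$ (similarly $y$ for $Y$). For a Lie algebroid structure on $E$ with anchor $\rho$, $\mathrm d$ is the Lie algebroid exterior derivative on $A(E^* )$ and $[\![\cdot,\cdot]\!]$ the Schouten bracket on $A(E)$: the unique degree $-1$ bracket extending the Lie algebroid bracket, with $[\![X,f]\!]=\rho(X)(f)$ for sections $X$ and functions $f$, $[\![X,Y]\!]=-(-1)^{xy}[\![Y,X]\!]$, $[\![X,Y\wedge Z]\!]=[\![X,Y]\!]\wedge Z+(-1)^{x(y+1)}Y\wedge[\![X,Z]\!]$. The same conventions define the Schouten-Nijenhuis bracket on $A(E^* )$ of a Lie algebroid bracket on $E^*$. For $\mu\in A^1(E^* )$, $i_\mu$ is the graded derivation of degree $-1$ of $A(E)$ with $i_\mu X=\langle\mu,X\rangle$ for sections $X$ and $i_\mu f=0$; write $X_\mu=i_\mu X$. The Schouten-Jacobi bracket of the $1$-cocycle $\Phi$ ($\mathrm d\Phi=0$) is $[\![X,Y]\!]^\Phi=[\![X,Y]\!]+x\,X\wedge i_\Phi Y-(-1)^xy\,i_\Phi X\wedge Y$. On forms, $i_f$ is multiplication by $f$, $i_X$ for a section $X$ is the usual contraction, and $i_{X\wedge Y}=i_Y\circ i_X$. $\mathcal L_X\mu=i_X\mathrm d\mu+(-1)^x\mathrm d\,i_X\mu$; $\mathrm d^\Phi\mu=\mathrm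 d\mu+\Phi\wedge\mu$; $\mathcal L^\Phi_X\mu=i_X\mathrm d^\Phi\mu+(-1)^x\mathrm d^\Phi i_X\mu$. For $1$-forms, $\langle P,\mu\wedge\nu\rangle=i_P(\mu\wedge\nu)=\langle P_\mu,\nu\rangle$. *)

theory Defs
  imports "HOL-Analysis.Analysis" "HOL-Library.Function_Algebras"
begin

section \<open>Smooth manifolds\<close>

text \<open>On an open subset of a finite-dimensional space, being differentiable with all
  directional derivatives of class \<open>C^k\<close> is the same as being of class \<open>C^(k+1)\<close>.\<close>

primrec Ck_on :: "nat \<Rightarrow> 'a::real_normed_vector set \<Rightarrow> ('a \<Rightarrow> 'c::real_normed_vector) \<Rightarrow> bool" where
  "Ck_on 0 V f \<longleftrightarrow> continuous_on V f"
| "Ck_on (Suc k) V f \<longleftrightarrow>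
     (\<exists>D. (\<forall>x\<in>V. (f has_derivative D x) (at x)) \<and> (\<forall>v. Ck_on k V (\<lambda>x. D x v)))"

definition smooth_on :: "'a::real_normed_vector set \<Rightarrow> ('a \<Rightarrow> 'c::real_normed_vector) \<Rightarrow> bool" where
  "smooth_on V f \<longleftrightarrow> (\<forall>k. Ck_on k V f)"

text \<open>The manifold is the whole type \<open>'p\<close>, with the (Hausdorff, second countable) topology given
  by its class. The model space \<open>'b\<close> is a finite-dimensional inner product space;
  \<^class>\<open>euclidean_space\<close> is avoided because it would exclude manifolds of dimension 0.\<close>

definition smooth_atlas ::
    "('p::{t2_space,second_countable_topology} set \<times> ('p \<Rightarrow> 'b::real_inner)) set \<Rightarrow> bool" where
  "smooth_atlas C \<longleftrightarrow>
     (\<exists>B. finite B \<and> span B = (UNIV :: 'b set)) \<and>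
     \<Union>(fst ` C) = UNIV \<and>
     (\<forall>(U,\<phi>)\<in>C. open U \<and> open (\<phi> ` U) \<and> homeomorphism U (\<phi> ` U) \<phi> (inv_into U \<phi>)) \<and>
     (\<forall>(U,\<phi>)\<in>C. \<forall>(U',\<phi>')\<in>C. smooth_on (\<phi> ` (U \<inter> U')) (\<phi>' \<circ> inv_into U \<phi>))"

definition smooth_fun_on ::
    "('p set \<times> ('p \<Rightarrow> 'b::real_inner)) set \<Rightarrow> 'p set \<Rightarrow> ('p \<Rightarrow> real) \<Rightarrow> bool" where
  "smooth_fun_on C W f \<longleftrightarrow> (\<forall>(U,\<phi>)\<in>C. smooth_on (\<phi> ` (U \<inter> W)) (f \<circ> inv_into U \<phi>))"

definition smooth_funs :: "('p set \<times> ('p \<Rightarrow> 'b::real_inner)) set \<Rightarrow> ('p \<Rightarrow> real) set" where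
  "smooth_funs C = {f. smooth_fun_on C UNIV f}"

text \<open>Tangent vectors at \<open>x\<close> are the derivations at \<open>x\<close> of the algebra of smooth functions.\<close>

definition tangent_space ::
    "('p set \<times> ('p \<Rightarrow> 'b::real_inner)) set \<Rightarrow> 'p \<Rightarrow> (('p \<Rightarrow> real) \<Rightarrow> real) set" where
  "tangent_space C x = {D. \<forall>f\<in>smooth_funs C. \<forall>g\<in>smooth_funs C. \<forall>c.
      D (\<lambda>y. f y + g y) = D f + D g \<and>
      D (\<lambda>y. c * f y) = c * D f \<and>
      D (\<lambda>y. f y * g y) = f x * D g + g x * D f}"


section \<open>The exterior algebra of \<open>\<real>\<^sup>r\<close>\<close>

text \<open>A multivector \<open>a\<close> is the family of its components: \<open>a\<close> stands for the sum of
  \<open>a I * e_I\<close> over \<open>I \<subseteq> {..<r}\<close>, where \<open>e_I\<close> is the wedge product of the basis vectors \<open>e_i\<close>,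
  \<open>i \<in> I\<close>, in increasing order. For disjoint \<open>I\<close> and \<open>J\<close>,
  \<open>e_I \<and> e_J = shuffle_sign I J * e_(I \<union> J)\<close>.\<close>

type_synonym multivector = "nat set \<Rightarrow> real"

definition shuffle_sign :: "nat set \<Rightarrow> nat set \<Rightarrow> real" where
  "shuffle_sign I J = (-1) ^ card {(i, j). i \<in> I \<and> j \<in> J \<and> j < i}"

definition wedge :: "multivector \<Rightarrow> multivector \<Rightarrow> multivector" where
  "wedge a b = (\<lambda>K. \<Sum>I\<in>Pow K. shuffle_sign I (K - I) * a I * b (K - I))"

definition scalar_mv :: "real \<Rightarrow> multivector" where
  "scalar_mv c = (\<lambda>I. if I = {} then c else 0)"

definition vector_mv :: "nat \<Rightarrow> (nat \<Rightarrow> real) \<Rightarrow> multivector" where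
  "vector_mv r v = (\<lambda>I. if \<exists>i<r. I = {i} then v (the_elem I) else 0)"

text \<open>Contraction of \<open>m\<close> in the exterior algebra of one space with \<open>X\<close> in the exterior algebra of
  its dual, in dual bases: \<open>e_I\<close> takes the dual \<open>e_I \<and> e_K\<close> to \<open>e_K\<close>. It serves both for
  contracting forms with multivectors and multivectors with forms. The convention
  \<open>i (X \<and> Y) = i Y \<circ> i X\<close> is verified below.\<close>

definition contract :: "nat \<Rightarrow> multivector \<Rightarrow> multivector \<Rightarrow> multivector" where
  "contract r X m = (\<lambda>K. \<Sum>I\<in>Pow ({..<r} - K). shuffle_sign I K * X I * m (I \<union> K))"


section \<open>Vector bundles and their multivector fields\<close>

text \<open>A vector bundle of rank \<open>r\<close> over the manifold: the fibre over every point is identified, by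
  choosing a basis of it, with \<open>\<real>\<^sup>r\<close>. These bases need not depend continuously on the point; the
  smooth structure comes only from the local frames. A local frame \<open>(U, e)\<close> consists of the
  vectors \<open>e x j\<close> (\<open>j < r\<close>) in the fibre over \<open>x \<in> U\<close>, with components \<open>e x j i\<close> (\<open>i < r\<close>).\<close>

record ('p, 'b) vbundle =
  charts :: "('p set \<times> ('p \<Rightarrow> 'b)) set"
  fibre_dim :: nat
  frames :: "('p set \<times> ('p \<Rightarrow> nat \<Rightarrow> nat \<Rightarrow> real)) set"

definition dual_frame ::
    "nat \<Rightarrow> 'p set \<Rightarrow> ('p \<Rightarrow> nat \<Rightarrow> nat \<Rightarrow> real) \<Rightarrow> ('p \<Rightarrow> nat \<Rightarrow> nat \<Rightarrow> real) \<Rightarrow> bool" where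
  "dual_frame r U e \<epsilon> \<longleftrightarrow>
     (\<forall>x\<in>U. \<forall>i<r. \<forall>j<r. (\<Sum>k<r. \<epsilon> x i k * e x j k) = (if i = j then 1 else 0))"

text \<open>Existence of a dual frame says that the \<open>e x j\<close> form a basis of the fibre.\<close>

definition vector_bundle ::
    "('p::{t2_space,second_countable_topology}, 'b::real_inner) vbundle \<Rightarrow> bool" where
  "vector_bundle E \<longleftrightarrow>
     smooth_atlas (charts E) \<and>
     \<Union>(fst ` frames E) = UNIV \<and>
     (\<forall>(U,e)\<in>frames E. open U \<and> (\<exists>\<epsilon>. dual_frame (fibre_dim E) U e \<epsilon>)) \<and>
     (\<forall>(U,e)\<in>frames E. \<forall>(U',e')\<in>frames E. \<exists>T.
        (\<forall>j<fibre_dim E. \<forall>k<fibre_dim E. smooth_fun_on (charts E) (U \<inter> U') (T j k)) \<and>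
        (\<forall>x\<in>U \<inter> U'. \<forall>k<fibre_dim E. \<forall>i<fibre_dim E.
           e' x k i = (\<Sum>j<fibre_dim E. T j k x * e x j i)))"

definition dual_bundle :: "('p, 'b) vbundle \<Rightarrow> ('p, 'b) vbundle" where
  "dual_bundle E =
     E\<lparr>frames := {(U, \<epsilon>). \<exists>e. (U, e) \<in> frames E \<and> dual_frame (fibre_dim E) U e \<epsilon>}\<rparr>"

type_synonym 'p mvfield = "'p \<Rightarrow> multivector"

definition frame_wedge :: "nat \<Rightarrow> (nat \<Rightarrow> nat \<Rightarrow> real) \<Rightarrow> nat set \<Rightarrow> multivector" where
  "frame_wedge r e I = foldr (\<lambda>i. wedge (vector_mv r (e i))) (sorted_list_of_set I) (scalar_mv 1)"

text \<open>\<open>sections E\<close> is the algebra \<open>A(E)\<close>, the sum of all \<open>sections_deg E k = A\<^sup>k(E)\<close>; the degree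
  is an integer, and \<open>sections_deg E k\<close> is the zero space for negative \<open>k\<close>.\<close>

definition sections :: "('p, 'b::real_inner) vbundle \<Rightarrow> 'p mvfield set" where
  "sections E = {s. \<forall>(U,e)\<in>frames E. \<exists>c.
      (\<forall>I\<subseteq>{..<fibre_dim E}. smooth_fun_on (charts E) U (c I)) \<and>
      (\<forall>x\<in>U. \<forall>K. s x K =
         (\<Sum>I\<in>Pow {..<fibre_dim E}. c I x * frame_wedge (fibre_dim E) (e x) I K))}"

definition sections_deg :: "('p, 'b::real_inner) vbundle \<Rightarrow> int \<Rightarrow> 'p mvfield set" where
  "sections_deg E k = {s \<in> sections E. \<forall>x I. s x I \<noteq> 0 \<longrightarrow> int (card I) = k}"

definition fwedge :: "'p mvfield \<Rightarrow> 'p mvfield \<Rightarrow> 'p mvfield"  (infixr \<open>\<^bold>\<and>\<close> 70) where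
  "X \<^bold>\<and> Y = (\<lambda>x. wedge (X x) (Y x))"

definition fun_field :: "('p \<Rightarrow> real) \<Rightarrow> 'p mvfield" where
  "fun_field f = (\<lambda>x. scalar_mv (f x))"

definition fscale :: "('p \<Rightarrow> real) \<Rightarrow> 'p mvfield \<Rightarrow> 'p mvfield" where
  "fscale f X = (\<lambda>x I. f x * X x I)"

definition cscale :: "real \<Rightarrow> 'p mvfield \<Rightarrow> 'p mvfield" where
  "cscale c X = (\<lambda>x I. c * X x I)"

definition ins :: "('p, 'b) vbundle \<Rightarrow> 'p mvfield \<Rightarrow> 'p mvfield \<Rightarrow> 'p mvfield" where
  "ins E X m = (\<lambda>x. contract (fibre_dim E) (X x) (m x))"

definition deg_part :: "nat \<Rightarrow> 'p mvfield \<Rightarrow> 'p mvfield" where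
  "deg_part k s = (\<lambda>x I. if card I = k then s x I else 0)"


section \<open>Lie algebroids\<close>

text \<open>\<open>\<rho> x v\<close> is the image of \<open>v\<close> in the tangent space at \<open>x\<close>.\<close>

type_synonym 'p anchor = "'p \<Rightarrow> multivector \<Rightarrow> ('p \<Rightarrow> real) \<Rightarrow> real"

definition anchor_map :: "('p, 'b::real_inner) vbundle \<Rightarrow> 'p anchor \<Rightarrow> bool" where
  "anchor_map E \<rho> \<longleftrightarrow>
     (\<forall>x. \<forall>u\<in>range (vector_mv (fibre_dim E)). \<forall>v\<in>range (vector_mv (fibre_dim E)). \<forall>c.
        \<rho> x u \<in> tangent_space (charts E) x \<and>
        (\<forall>f\<in>smooth_funs (charts E).
           \<rho> x (\<lambda>I. u I + v I) f = \<rho> x u f + \<rho> x v f \<and>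
           \<rho> x (\<lambda>I. c * u I) f = c * \<rho> x u f)) \<and>
     (\<forall>X\<in>sections_deg E 1. \<forall>f\<in>smooth_funs (charts E).
        (\<lambda>x. \<rho> x (X x) f) \<in> smooth_funs (charts E))"

text \<open>That the anchor is a homomorphism into the Lie algebra of vector fields follows from the
  Jacobi identity and the Leibniz rule.\<close>

definition lie_algebroid ::
    "('p, 'b::real_inner) vbundle \<Rightarrow> ('p mvfield \<Rightarrow> 'p mvfield \<Rightarrow> 'p mvfield) \<Rightarrow> 'p anchor \<Rightarrow> bool" where
  "lie_algebroid E br \<rho> \<longleftrightarrow>
     anchor_map E \<rho> \<and>
     (\<forall>X\<in>sections_deg E 1. \<forall>Y\<in>sections_deg E 1.
        br X Y \<in> sections_deg E 1 \<and>
        br X Y = - br Y X \<and>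
        (\<forall>c. br X (cscale c Y) = cscale c (br X Y)) \<and>
        (\<forall>f\<in>smooth_funs (charts E).
           br X (fscale f Y) = fscale f (br X Y) + fscale (\<lambda>x. \<rho> x (X x) f) Y) \<and>
        (\<forall>Z\<in>sections_deg E 1.
           br X (Y + Z) = br X Y + br X Z \<and>
           br X (br Y Z) = br (br X Y) Z + br Y (br X Z)))"

text \<open>\<open>S\<close> is the Schouten bracket of the Lie algebroid: the unique bracket of degree \<open>-1\<close>
  with the following properties.\<close>

definition schouten_bracket ::
    "('p, 'b::real_inner) vbundle \<Rightarrow> ('p mvfield \<Rightarrow> 'p mvfield \<Rightarrow> 'p mvfield) \<Rightarrow> 'p anchor \<Rightarrow>
     ('p mvfield \<Rightarrow> 'p mvfield \<Rightarrow> 'p mvfield) \<Rightarrow> bool" where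
  "schouten_bracket E br \<rho> S \<longleftrightarrow>
     (\<forall>X\<in>sections E. \<forall>Y\<in>sections E. \<forall>Z\<in>sections E. \<forall>c.
        S (X + Y) Z = S X Z + S Y Z \<and> S X (Y + Z) = S X Y + S X Z \<and>
        S (cscale c X) Y = cscale c (S X Y) \<and> S X (cscale c Y) = cscale c (S X Y)) \<and>
     (\<forall>k l. \<forall>X\<in>sections_deg E k. \<forall>Y\<in>sections_deg E l.
        S X Y \<in> sections_deg E (k + l - 1) \<and>
        S X Y = - cscale ((-1) powi ((k - 1) * (l - 1))) (S Y X) \<and>
        (\<forall>Z\<in>sections E.
           S X (Y \<^bold>\<and> Z) = S X Y \<^bold>\<and> Z + cscale ((-1) powi ((k - 1) * l)) (Y \<^bold>\<and> S X Z))) \<and>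
     (\<forall>X\<in>sections_deg E 1. \<forall>Y\<in>sections_deg E 1. S X Y = br X Y) \<and>
     (\<forall>X\<in>sections_deg E 1. \<forall>f\<in>smooth_funs (charts E).
        S X (fun_field f) = fun_field (\<lambda>x. \<rho> x (X x) f))"

text \<open>The value \<open>\<omega>(X\<^sub>1, \<dots>, X\<^sub>k)\<close> of the component of degree \<open>k\<close> of a form on \<open>k\<close> sections is
  the component of degree 0 of the iterated contraction, first with \<open>X\<^sub>1\<close>, last with \<open>X\<^sub>k\<close>.\<close>

definition form_eval :: "('p, 'b) vbundle \<Rightarrow> 'p mvfield \<Rightarrow> 'p mvfield list \<Rightarrow> 'p \<Rightarrow> real" where
  "form_eval E \<omega> Xs = (\<lambda>x. fold (ins E) Xs \<omega> x {})"

definition omit :: "nat \<Rightarrow> 'a list \<Rightarrow> 'a list" where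
  "omit i xs = take i xs @ drop (Suc i) xs"

text \<open>The exterior derivative, given by the usual formula of Koszul. As \<open>form_eval E \<omega> Xs\<close> only
  sees the component of \<open>\<omega>\<close> of degree \<open>length Xs\<close>, the formula applies to inhomogeneous forms;
  for \<open>Xs = []\<close> it says that the component of degree 0 vanishes.\<close>

definition koszul ::
    "('p, 'b) vbundle \<Rightarrow> ('p mvfield \<Rightarrow> 'p mvfield \<Rightarrow> 'p mvfield) \<Rightarrow> 'p anchor \<Rightarrow>
     'p mvfield \<Rightarrow> 'p mvfield list \<Rightarrow> 'p \<Rightarrow> real" where
  "koszul E br \<rho> \<omega> Xs = (\<lambda>x.
     (\<Sum>i<length Xs. (-1) ^ i * \<rho> x ((Xs ! i) x) (form_eval E \<omega> (omit i Xs))) +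
     (\<Sum>j<length Xs. \<Sum>i<j. (-1) ^ (i + j) *
        form_eval E \<omega> (br (Xs ! i) (Xs ! j) # omit i (omit j Xs)) x))"

definition ext_deriv ::
    "('p, 'b::real_inner) vbundle \<Rightarrow> ('p mvfield \<Rightarrow> 'p mvfield \<Rightarrow> 'p mvfield) \<Rightarrow> 'p anchor \<Rightarrow>
     'p mvfield \<Rightarrow> 'p mvfield" where
  "ext_deriv E br \<rho> \<omega> = (THE \<eta>. \<eta> \<in> sections (dual_bundle E) \<and>
     (\<forall>Xs. set Xs \<subseteq> sections_deg E 1 \<longrightarrow> form_eval E \<eta> Xs = koszul E br \<rho> \<omega> Xs))"


section \<open>Operators twisted by a cocycle\<close>

text \<open>Here \<open>k\<close> and \<open>l\<close> are the degrees of \<open>X\<close> and \<open>Y\<close>.\<close>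

definition schouten_jacobi ::
    "('p, 'b) vbundle \<Rightarrow> ('p mvfield \<Rightarrow> 'p mvfield \<Rightarrow> 'p mvfield) \<Rightarrow> 'p mvfield \<Rightarrow>
     int \<Rightarrow> int \<Rightarrow> 'p mvfield \<Rightarrow> 'p mvfield \<Rightarrow> 'p mvfield" where
  "schouten_jacobi E S \<Phi> k l X Y =
     S X Y + cscale (of_int (k - 1)) (X \<^bold>\<and> ins E \<Phi> Y)
       - cscale ((-1) powi (k - 1) * of_int (l - 1)) (ins E \<Phi> X \<^bold>\<and> Y)"

definition ext_deriv_tw ::
    "('p, 'b::real_inner) vbundle \<Rightarrow> ('p mvfield \<Rightarrow> 'p mvfield \<Rightarrow> 'p mvfield) \<Rightarrow> 'p anchor \<Rightarrow>
     'p mvfield \<Rightarrow> 'p mvfield \<Rightarrow> 'p mvfield" where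
  "ext_deriv_tw E br \<rho> \<Phi> \<mu> = ext_deriv E br \<rho> \<mu> + \<Phi> \<^bold>\<and> \<mu>"

definition lie_deriv ::
    "('p, 'b::real_inner) vbundle \<Rightarrow> ('p mvfield \<Rightarrow> 'p mvfield \<Rightarrow> 'p mvfield) \<Rightarrow> 'p anchor \<Rightarrow>
     int \<Rightarrow> 'p mvfield \<Rightarrow> 'p mvfield \<Rightarrow> 'p mvfield" where
  "lie_deriv E br \<rho> k X \<mu> =
     ins E X (ext_deriv E br \<rho> \<mu>) + cscale ((-1) powi (k - 1)) (ext_deriv E br \<rho> (ins E X \<mu>))"

definition lie_deriv_tw ::
    "('p, 'b::real_inner) vbundle \<Rightarrow> ('p mvfield \<Rightarrow> 'p mvfield \<Rightarrow> 'p mvfield) \<Rightarrow> 'p anchor \<Rightarrow>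
     'p mvfield \<Rightarrow> int \<Rightarrow> 'p mvfield \<Rightarrow> 'p mvfield \<Rightarrow> 'p mvfield" where
  "lie_deriv_tw E br \<rho> \<Phi> k X \<mu> =
     ins E X (ext_deriv_tw E br \<rho> \<Phi> \<mu>) +
     cscale ((-1) powi (k - 1)) (ext_deriv_tw E br \<rho> \<Phi> (ins E X \<mu>))"

text \<open>The operator on forms of degree \<open>k\<close>, and its additive extension to all forms.\<close>

definition hom_op_deg ::
    "('p, 'b::real_inner) vbundle \<Rightarrow> ('p mvfield \<Rightarrow> 'p mvfield \<Rightarrow> 'p mvfield) \<Rightarrow> 'p anchor \<Rightarrow>
     'p mvfield \<Rightarrow> real \<Rightarrow> 'p mvfield \<Rightarrow> nat \<Rightarrow> 'p mvfield \<Rightarrow> 'p mvfield" where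
  "hom_op_deg E br \<rho> \<Phi> a P k \<mu> =
     lie_deriv E br \<rho> 2 P \<mu> + cscale (real k + a) (ins E (ins E \<Phi> P) \<mu>) + \<Phi> \<^bold>\<and> ins E P \<mu>"

definition hom_op ::
    "('p, 'b::real_inner) vbundle \<Rightarrow> ('p mvfield \<Rightarrow> 'p mvfield \<Rightarrow> 'p mvfield) \<Rightarrow> 'p anchor \<Rightarrow>
     'p mvfield \<Rightarrow> real \<Rightarrow> 'p mvfield \<Rightarrow> 'p mvfield \<Rightarrow> 'p mvfield" where
  "hom_op E br \<rho> \<Phi> a P \<mu> = (\<Sum>k\<le>fibre_dim E. hom_op_deg E br \<rho> \<Phi> a P k (deg_part k \<mu>))"

text \<open>The bracket generated by an operator \<open>D\<close>, likewise for \<open>\<mu>\<close> of degree \<open>k\<close> first.\<close>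

definition generated_bracket_deg ::
    "('p mvfield \<Rightarrow> 'p mvfield) \<Rightarrow> nat \<Rightarrow> 'p mvfield \<Rightarrow> 'p mvfield \<Rightarrow> 'p mvfield" where
  "generated_bracket_deg D k \<mu> \<nu> =
     cscale ((-1) ^ k) (D (\<mu> \<^bold>\<and> \<nu>) - D \<mu> \<^bold>\<and> \<nu> - cscale ((-1) ^ k) (\<mu> \<^bold>\<and> D \<nu>))"

definition generated_bracket ::
    "('p, 'b) vbundle \<Rightarrow> ('p mvfield \<Rightarrow> 'p mvfield) \<Rightarrow> 'p mvfield \<Rightarrow> 'p mvfield \<Rightarrow> 'p mvfield" where
  "generated_bracket E D \<mu> \<nu> =
     (\<Sum>k\<le>fibre_dim E. generated_bracket_deg D k (deg_part k \<mu>) \<nu>)"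

definition form_bracket ::
    "('p, 'b::real_inner) vbundle \<Rightarrow> ('p mvfield \<Rightarrow> 'p mvfield \<Rightarrow> 'p mvfield) \<Rightarrow> 'p anchor \<Rightarrow>
     'p mvfield \<Rightarrow> 'p mvfield \<Rightarrow> 'p mvfield \<Rightarrow> 'p mvfield \<Rightarrow> 'p mvfield" where
  "form_bracket E br \<rho> \<Phi> P \<mu> \<nu> =
     ins E (ins E \<mu> P) (ext_deriv_tw E br \<rho> \<Phi> \<nu>) - ins E (ins E \<nu> P) (ext_deriv_tw E br \<rho> \<Phi> \<mu>)
       + ext_deriv_tw E br \<rho> \<Phi> (ins E P (\<mu> \<^bold>\<and> \<nu>))"


section \<open>The convention for contractions\<close>

lemma shuffle_sign_Un_left:
  assumes "finite I" "finite J" "finite K" "I \<inter> J = {}"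
  shows "shuffle_sign (I \<union> J) K = shuffle_sign I K * shuffle_sign J K"
proof -
  have fin: "finite {(i, j). i \<in> A \<and> j \<in> K \<and> j < i}" if "finite A" for A
    by (rule finite_subset[of _ "A \<times> K"]) (use that assms in auto)
  have "{(i, j). i \<in> I \<union> J \<and> j \<in> K \<and> j < i} =
      {(i, j). i \<in> I \<and> j \<in> K \<and> j < i} \<union> {(i, j). i \<in> J \<and> j \<in> K \<and> j < i}"
    by auto
  moreover have "{(i, j). i \<in> I \<and> j \<in> K \<and> j < i} \<inter> {(i, j). i \<in> J \<and> j \<in> K \<and> j < i} = {}"
    using assms(4) by auto
  ultimately show ?thesis
    using fin assms by (simp add: shuffle_sign_def card_Un_disjoint power_add)
qed

lemma shuffle_sign_Un_right:
  assumes "finite I" "finite J" "finite K" "J \<inter> K = {}"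
  shows "shuffle_sign I (J \<union> K) = shuffle_sign I J * shuffle_sign I K"
proof -
  have fin: "finite {(i, j). i \<in> I \<and> j \<in> A \<and> j < i}" if "finite A" for A
    by (rule finite_subset[of _ "I \<times> A"]) (use that assms in auto)
  have "{(i, j). i \<in> I \<and> j \<in> J \<union> K \<and> j < i} =
      {(i, j). i \<in> I \<and> j \<in> J \<and> j < i} \<union> {(i, j). i \<in> I \<and> j \<in> K \<and> j < i}"
    by auto
  moreover have "{(i, j). i \<in> I \<and> j \<in> J \<and> j < i} \<inter> {(i, j). i \<in> I \<and> j \<in> K \<and> j < i} = {}"
    using assms(4) by auto
  ultimately show ?thesis
    using fin assms by (simp add: shuffle_sign_def card_Un_disjoint power_add)
qed

lemma contract_wedge:
  assumes "finite K"
  shows "contract r (wedge X Y) m K = contract r Y (contract r X m) K"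
proof -
  let ?N = "{..<r} - K"
  let ?g = "\<lambda>J I. shuffle_sign J K * Y J * (shuffle_sign I (J \<union> K) * X I * m (I \<union> (J \<union> K)))"
  have "contract r (wedge X Y) m K =
      (\<Sum>L\<in>Pow ?N. \<Sum>I\<in>Pow L. ?g (L - I) I)"
    unfolding contract_def wedge_def
  proof (rule sum.cong[OF refl])
    fix L assume L: "L \<in> Pow ?N"
    have "shuffle_sign L K * (\<Sum>I\<in>Pow L. shuffle_sign I (L - I) * X I * Y (L - I)) * m (L \<union> K)
        = (\<Sum>I\<in>Pow L. shuffle_sign L K * (shuffle_sign I (L - I) * X I * Y (L - I)) * m (L \<union> K))"
      by (simp add: sum_distrib_left sum_distrib_right)
    also have "\<dots> = (\<Sum>I\<in>Pow L. ?g (L - I) I)"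
    proof (rule sum.cong[OF refl])
      fix I assume I: "I \<in> Pow L"
      have fin: "finite L" "finite I" using L I by (auto intro: finite_subset)
      have 1: "shuffle_sign L K = shuffle_sign I K * shuffle_sign (L - I) K"
        using shuffle_sign_Un_left[of I "L - I" K] fin assms I by (auto simp: Un_absorb1)
      have 2: "shuffle_sign I (L - I \<union> K) = shuffle_sign I (L - I) * shuffle_sign I K"
        using shuffle_sign_Un_right[of I "L - I" K] fin assms L by auto
      have 3: "I \<union> (L - I \<union> K) = L \<union> K" using I by auto
      show "shuffle_sign L K * (shuffle_sign I (L - I) * X I * Y (L - I)) * m (L \<union> K) = ?g (L - I) I"
        unfolding 1 2 3 by (simp add: mult_ac)
    qed
    finally show "shuffle_sign L K * (\<Sum>I\<in>Pow L. shuffle_sign I (L - I) * X I * Y (L - I)) * m (L \<union> K)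
        = (\<Sum>I\<in>Pow L. ?g (L - I) I)" .
  qed
  also have "\<dots> = (\<Sum>(L, I)\<in>(SIGMA L:Pow ?N. Pow L). ?g (L - I) I)"
    by (subst sum.Sigma) (auto intro: finite_subset)
  also have "\<dots> = (\<Sum>(J, I)\<in>(SIGMA J:Pow ?N. Pow ({..<r} - (J \<union> K))). ?g J I)"
    by (rule sum.reindex_bij_witness[where i = "\<lambda>(J, I). (J \<union> I, I)" and j = "\<lambda>(L, I). (L - I, I)"])
      auto
  also have "\<dots> = (\<Sum>J\<in>Pow ?N. \<Sum>I\<in>Pow ({..<r} - (J \<union> K)). ?g J I)"
    by (subst sum.Sigma) auto
  also have "\<dots> = contract r Y (contract r X m) K"
    by (simp add: contract_def sum_distrib_left)
  finally show ?thesis .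
qed

end

theory Submission
  imports Defs
begin

text \<open>
  A form that vanishes in degree 0 and is killed by all contractions with sections is zero, so an
  identity between operators on forms can be proved, by induction on the degree, from the
  commutators of both sides with contractions. Global sections come from bump functions \<open>h\<close>, which
  turn a local frame into sections \<open>G_i\<close> and dual forms \<open>\<gamma>_i\<close> with the Euler identity
  \<open>\<Sum>i. \<gamma>_i \<and> i_(G_i) \<omega> = h^2 |\<omega>| \<omega>\<close>; this recovers a form from its contractions, and so the
  exterior derivative from Cartan's formula.

  Let \<open>V = P_\<Phi>\<close>. As the Schouten bracket is a derived bracket, the Jacobi condition becomes
  \<open>[L_P, i_P] = 2 i_P i_V\<close>. From this and \<open>d \<Phi> = 0\<close> it follows that \<open>L_P\<close> anticommutes with \<open>i_V\<close>, and
  then the square of \<open>L_P + (|.| + a) i_V + \<Phi> \<and> i_P\<close> vanishes by operator algebra. This operator is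
  of second order, so the bracket that it generates is a biderivation; \<open>a i_V\<close> is a derivation and
  does not contribute. The Jacobi identity comes from expanding the square on a product of three
  1-forms.
\<close>

section \<open>Smooth functions and bump functions\<close>

text \<open>Three obstacles shape the proof. The Schouten bracket \<open>S\<close> is known only
  through axioms on global sections, so a local argument has to replace a field by its product with
  a function \<open>h\<close> that is 1 near the point, and to show that neither \<open>S\<close>
  nor the Lie derivative at that point sees the difference. For \<open>S\<close> no formula for the
  bracket with a function is needed: as a map of the function this bracket is a derivation, hence
  local. Next, \<open>ext_deriv\<close> is a definite description, so nothing is known about it
  until a smooth form with the values of Koszul's formula has been built; writing that formula
  recursively makes tensoriality an induction on the arguments. Finally, signs and the factor |mu|
  depend on the degree while forms may be inhomogeneous. The grade involution \<open>fsg\<close> and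
  the operator \<open>fweight real\<close> turn graded rules into identities between additive
  operators. In this language |mu| stands to the right of i_V, and moving L_P past it yields the
  term - i_V L_P, without which L_P^2 - L_V i_P would not cancel.\<close>

lemma Ck_on_mono: "Ck_on k V f \<Longrightarrow> W \<subseteq> V \<Longrightarrow> Ck_on k W f"
proof (induction k arbitrary: f)
  case 0
  then show ?case by (auto intro: continuous_on_subset)
next
  case (Suc k)
  then show ?case by (auto) blast
qed

text \<open>The derivative in \<open>Ck_on\<close> is taken in the whole space, not within
  \<open>V\<close>; agreement on \<open>V\<close> carries over to it because \<open>V\<close> is
  open.\<close>

lemma Ck_on_cong:
  assumes "open V" "\<And>x. x \<in> V \<Longrightarrow> f x = g x" "Ck_on k V f"
  shows "Ck_on k V g"
proof (cases k)
  case 0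
  then show ?thesis using assms by (simp cong: continuous_on_cong)
next
  case (Suc n)
  then obtain D where D: "\<forall>x\<in>V. (f has_derivative D x) (at x)" "\<forall>v. Ck_on n V (\<lambda>x. D x v)"
    using assms by auto
  have "(g has_derivative D x) (at x)" if "x \<in> V" for x
    using D(1) that assms(1,2) by (meson has_derivative_transform_within_open)
  then show ?thesis using D(2) Suc by auto
qed

lemma Ck_on_lower: "Ck_on (Suc k) V f \<Longrightarrow> Ck_on k V f"
proof (induction k arbitrary: f)
  case 0
  then show ?case
    by (auto intro!: continuous_at_imp_continuous_on dest: has_derivative_continuous)
next
  case (Suc k)
  then obtain D where D: "\<forall>x\<in>V. (f has_derivative D x) (at x)" "\<forall>v. Ck_on (Suc k) V (\<lambda>x. D x v)"
    by auto
  show ?case using D Suc.IH by auto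
qed

lemma Ck_on_const: "Ck_on k V (\<lambda>x. c)"
proof (induction k arbitrary: c)
  case (Suc k)
  show ?case by (auto intro!: exI[of _ "\<lambda>x v. 0"] Suc)
qed simp

lemma Ck_on_bounded_linear: "bounded_linear h \<Longrightarrow> Ck_on k V h"
proof (cases k)
  case 0
  moreover assume "bounded_linear h"
  ultimately show ?thesis by (auto intro: linear_continuous_on)
next
  case (Suc n)
  moreover assume "bounded_linear h"
  ultimately show ?thesis
    by (auto intro!: exI[of _ "\<lambda>x. h"] Ck_on_const bounded_linear_imp_has_derivative)
qed

lemma Ck_on_add: "Ck_on k V f \<Longrightarrow> Ck_on k V g \<Longrightarrow> Ck_on k V (\<lambda>x. f x + g x)"
proof (induction k arbitrary: f g)
  case 0
  then show ?case by (auto intro: continuous_on_add)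
next
  case (Suc k)
  obtain D where D: "\<forall>x\<in>V. (f has_derivative D x) (at x)" "\<forall>v. Ck_on k V (\<lambda>x. D x v)"
    using Suc.prems by auto
  obtain D' where D': "\<forall>x\<in>V. (g has_derivative D' x) (at x)" "\<forall>v. Ck_on k V (\<lambda>x. D' x v)"
    using Suc.prems by auto
  show ?case
    using D D' by (auto intro!: exI[of _ "\<lambda>x v. D x v + D' x v"] has_derivative_add Suc.IH)
qed

lemma Ck_on_mult:
  fixes f g :: "'a::real_normed_vector \<Rightarrow> real"
  shows "Ck_on k V f \<Longrightarrow> Ck_on k V g \<Longrightarrow> Ck_on k V (\<lambda>x. f x * g x)"
proof (induction k arbitrary: f g)
  case 0
  then show ?case by (auto intro: continuous_on_mult)
next
  case (Suc k)
  obtain D where D: "\<forall>x\<in>V. (f has_derivative D x) (at x)" "\<forall>v. Ck_on k V (\<lambda>x. D x v)"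
    using Suc.prems by auto
  obtain D' where D': "\<forall>x\<in>V. (g has_derivative D' x) (at x)" "\<forall>v. Ck_on k V (\<lambda>x. D' x v)"
    using Suc.prems by auto
  show ?case
    unfolding Ck_on.simps
  proof (intro exI[of _ "\<lambda>x v. f x * D' x v + D x v * g x"] conjI ballI allI)
    show "Ck_on k V (\<lambda>x. f x * D' x v + D x v * g x)" for v
      using D D' Suc.prems[THEN Ck_on_lower] by (intro Ck_on_add Suc.IH) simp_all
  qed (use D D' in \<open>auto intro: has_derivative_mult\<close>)
qed

lemma Ck_on_sum:
  assumes "\<And>i. i \<in> A \<Longrightarrow> Ck_on k V (f i)"
  shows "Ck_on k V (\<lambda>x. \<Sum>i\<in>A. f i x)"
  using assms by (induction A rule: infinite_finite_induct) (auto intro: Ck_on_const Ck_on_add)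

lemma Ck_on_linear_comp:
  assumes "bounded_linear h"
  shows "Ck_on k V f \<Longrightarrow> Ck_on k V (\<lambda>x. h (f x))"
proof (induction k arbitrary: f)
  case 0
  then show ?case using assms by (auto intro: bounded_linear.continuous_on)
next
  case (Suc k)
  obtain D where D: "\<forall>x\<in>V. (f has_derivative D x) (at x)" "\<forall>v. Ck_on k V (\<lambda>x. D x v)"
    using Suc.prems by auto
  show ?case
    unfolding Ck_on.simps
  proof (intro exI[of _ "\<lambda>x v. h (D x v)"] conjI ballI allI)
    show "Ck_on k V (\<lambda>x. h (D x v))" for v
      using D by (intro Suc.IH) simp
  qed (use D assms in \<open>auto intro: bounded_linear.has_derivative\<close>)
qed

text \<open>The chain rule gives D' (f x) (D x v), whose direction D x v varies with x, while the
  induction hypothesis concerns D' in fixed directions. Expanding D x v in a finite orthogonal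
  spanning set yields a finite sum of products to which the hypotheses apply. This is where finite
  dimension enters.\<close>

lemma Ck_on_comp:
  fixes f :: "'a::real_normed_vector \<Rightarrow> 'b::real_inner" and g :: "'b \<Rightarrow> real"
  assumes B: "finite (B::'b set)" "span B = UNIV" "pairwise orthogonal B"
  shows "Ck_on k V f \<Longrightarrow> Ck_on k W g \<Longrightarrow> f ` V \<subseteq> W \<Longrightarrow> Ck_on k V (\<lambda>x. g (f x))"
proof (induction k arbitrary: f g)
  case 0
  then show ?case by (auto intro: continuous_on_compose2)
next
  case (Suc k)
  obtain D where D: "\<forall>x\<in>V. (f has_derivative D x) (at x)" "\<forall>v. Ck_on k V (\<lambda>x. D x v)"
    using Suc.prems by auto
  obtain D' where D': "\<forall>x\<in>W. (g has_derivative D' x) (at x)" "\<forall>v. Ck_on k W (\<lambda>x. D' x v)"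
    using Suc.prems by auto
  let ?F = "\<lambda>x v. \<Sum>b\<in>B. (b \<bullet> D x v / (b \<bullet> b)) * D' (f x) b"
  \<comment> \<open>\<open>B\<close> may contain 0, whose summand is 0 whatever its coefficient;
    orthogonality determines the coefficients of the other elements.\<close>
  have expand: "w = (\<Sum>b\<in>B. (b \<bullet> w / (b \<bullet> b)) *\<^sub>R b)" for w
  proof -
    have "w \<in> span B" using B by simp
    then obtain c where w: "w = (\<Sum>b\<in>B. c b *\<^sub>R b)"
      using span_finite[OF B(1)] by auto
    have "(b \<bullet> w / (b \<bullet> b)) *\<^sub>R b = c b *\<^sub>R b" if "b \<in> B" for b
    proof -
      have "b \<bullet> w = (\<Sum>b'\<in>B. c b' * (b \<bullet> b'))" by (simp add: w inner_sum_right)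
      also have "\<dots> = (\<Sum>b'\<in>B. if b' = b then c b * (b \<bullet> b) else 0)"
        using B(3) that by (intro sum.cong) (auto simp: pairwise_def orthogonal_def)
      also have "\<dots> = c b * (b \<bullet> b)" using B(1) that by simp
      finally show ?thesis by (cases "b = 0") auto
    qed
    then have "(\<Sum>b\<in>B. (b \<bullet> w / (b \<bullet> b)) *\<^sub>R b) = (\<Sum>b\<in>B. c b *\<^sub>R b)"
      by (rule sum.cong[OF refl])
    then show ?thesis using w by simp
  qed
  have der: "((\<lambda>x. g (f x)) has_derivative ?F x) (at x)" if "x \<in> V" for x
  proof -
    have 1: "((\<lambda>x. g (f x)) has_derivative (\<lambda>v. D' (f x) (D x v))) (at x)"
      using has_derivative_compose[of f "D x" x UNIV g "D' (f x)"] D D' that Suc.prems by auto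
    have lin: "bounded_linear (D' (f x))"
      using D'(1) that Suc.prems(3) by (blast intro: has_derivative_bounded_linear)
    have "D' (f x) w = (\<Sum>b\<in>B. (b \<bullet> w / (b \<bullet> b)) * D' (f x) b)" for w
    proof -
      have "D' (f x) w = D' (f x) (\<Sum>b\<in>B. (b \<bullet> w / (b \<bullet> b)) *\<^sub>R b)"
        by (rule arg_cong[OF expand])
      also have "\<dots> = (\<Sum>b\<in>B. (b \<bullet> w / (b \<bullet> b)) * D' (f x) b)"
        by (simp only: linear_sum[OF bounded_linear.linear[OF lin]]
          linear_cmul[OF bounded_linear.linear[OF lin]] real_scaleR_def)
      finally show ?thesis .
    qed
    then have "(\<lambda>v. D' (f x) (D x v)) = ?F x" by (intro ext)
    then show ?thesis using 1 by simp
  qed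
  have "Ck_on k V (\<lambda>x. ?F x v)" for v
  proof (intro Ck_on_sum Ck_on_mult)
    fix b assume "b \<in> B"
    have bl: "bounded_linear (\<lambda>w. b \<bullet> w / (b \<bullet> b))"
      using bounded_linear_mult_left[THEN bounded_linear_compose, OF bounded_linear_inner_right]
      by (simp add: divide_inverse)
    show "Ck_on k V (\<lambda>x. b \<bullet> D x v / (b \<bullet> b))"
      by (rule Ck_on_linear_comp[OF bl]) (use D in auto)
    show "Ck_on k V (\<lambda>x. D' (f x) b)"
      by (rule Suc.IH) (use Suc.prems D' Ck_on_lower in blast)+
  qed
  then show ?case unfolding Ck_on.simps using der by (intro exI[of _ ?F]) blast
qed

lemma Ck_on_local:
  assumes "\<And>x. x \<in> V \<Longrightarrow> \<exists>W. open W \<and> x \<in> W \<and> Ck_on k W f"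
  shows "Ck_on k V f"
  using assms
proof (induction k arbitrary: f)
  case 0
  then show ?case
    by (auto intro!: continuous_at_imp_continuous_on) (metis continuous_on_eq_continuous_at)
next
  case (Suc k)
  \<comment> \<open>\<open>Ck_on\<close> asks for one derivative on all of \<open>V\<close>.
    Derivatives at a point are unique, so a pointwise choice agrees with each of the local
    ones.\<close>
  define D where "D x = (SOME d. (f has_derivative d) (at x))" for x
  have D: "(f has_derivative D' x) (at x) \<Longrightarrow> D x = D' x" for D' x
    unfolding D_def by (rule some_equality) (auto intro: has_derivative_unique)
  have "(f has_derivative D x) (at x)" if "x \<in> V" for x
    using Suc.prems[OF that] D by fastforce
  moreover have "Ck_on k V (\<lambda>x. D x v)" for v
  proof (rule Suc.IH)
    fix x assume "x \<in> V"
    then obtain W D' where W: "open W" "x \<in> W" "\<forall>x\<in>W. (f has_derivative D' x) (at x)"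
      "\<forall>v. Ck_on k W (\<lambda>x. D' x v)" using Suc.prems[OF \<open>x \<in> V\<close>] by auto
    have "Ck_on k W (\<lambda>x. D x v)"
      by (rule Ck_on_cong[of _ "\<lambda>x. D' x v"]) (use W D in auto)
    then show "\<exists>W. open W \<and> x \<in> W \<and> Ck_on k W (\<lambda>x. D x v)" using W by blast
  qed
  ultimately show ?case by auto
qed

lemma Ck_on_inverse: "Ck_on k {x. x \<noteq> 0} (inverse :: real \<Rightarrow> real)"
proof (induction k)
  case 0
  then show ?case by (auto intro!: continuous_on_inverse continuous_on_id)
next
  case (Suc k)
  have "Ck_on k {x. x \<noteq> 0} (\<lambda>x::real. (-v) * (inverse x * inverse x))" for v
    by (intro Ck_on_mult Ck_on_const Suc)
  then show ?case
    by (auto intro!: exI[of _ "\<lambda>x v. -v * (inverse x * inverse x)"] derivative_eq_intros)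
qed

section \<open>Flat functions and a smooth step function\<close>

definition flat_fun :: "nat \<Rightarrow> real \<Rightarrow> real" where
  "flat_fun n t = (if t \<le> 0 then 0 else exp (- inverse t) * inverse t ^ n)"

text \<open>The functions exp(-1/t) / t^n, extended by 0, are closed under differentiation up to
  linear combinations, so smoothness follows by an induction over all n at once. At 0 the difference
  quotient from the right is y^(n+1) / exp y with y = 1/h, which tends to 0.\<close>

lemma flat_fun_derivative:
  "(flat_fun n has_real_derivative flat_fun (n + 2) t - n * flat_fun (n + 1) t) (at t)"
proof -
  consider "t < 0" | "t = 0" | "t > 0" by linarith
  then show ?thesis
  proof cases
    case 1
    have "((\<lambda>_. 0) has_real_derivative 0) (at t)" by simp
    then have "(flat_fun n has_real_derivative 0) (at t)"
      by (rule has_field_derivative_transform_within_open[where S = "{..<0}"])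
        (use 1 in \<open>auto simp: flat_fun_def\<close>)
    then show ?thesis using 1 by (simp add: flat_fun_def)
  next
    case 3
    have "((\<lambda>t. exp (- inverse t) * inverse t ^ n) has_real_derivative
        flat_fun (n + 2) t - n * flat_fun (n + 1) t) (at t)"
    proof (cases n)
      case 0
      then show ?thesis using 3
        by (auto intro!: derivative_eq_intros simp: flat_fun_def power2_eq_square)
    next
      case (Suc m)
      show ?thesis unfolding Suc using 3
        by (auto intro!: derivative_eq_intros
            simp: flat_fun_def power2_eq_square field_simps)
        (cases m; simp)
    qed
    then show ?thesis
      by (rule has_field_derivative_transform_within_open[where S = "{0<..}"])
        (use 3 in \<open>auto simp: flat_fun_def\<close>)
  next
    case 2
    have lim: "((\<lambda>h. exp (- inverse h) * inverse h ^ (n + 1)) \<longlongrightarrow> 0) (at_right (0::real))"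
    proof -
      have "((\<lambda>y. y ^ (n + 1) / exp y) \<longlongrightarrow> 0) (at_top :: real filter)"
        by (rule tendsto_power_div_exp_0)
      then have "((\<lambda>h. inverse h ^ (n + 1) / exp (inverse h)) \<longlongrightarrow> 0) (at_right (0::real))"
        by (rule filterlim_compose) (rule filterlim_inverse_at_top_right)
      then show ?thesis by (simp add: exp_minus field_simps)
    qed
    have "((\<lambda>h. flat_fun n h / h) \<longlongrightarrow> 0) (at (0::real))"
    proof (rule filterlim_split_at_real)
      show "((\<lambda>h. flat_fun n h / h) \<longlongrightarrow> 0) (at_left (0::real))"
        by (rule tendsto_eventually) (auto simp: flat_fun_def eventually_at_left_field intro: exI[of _ "-1"])
      show "((\<lambda>h. flat_fun n h / h) \<longlongrightarrow> 0) (at_right (0::real))"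
        by (rule Lim_transform_eventually[OF lim])
          (auto simp: flat_fun_def eventually_at_right_field field_simps intro: exI[of _ 1])
    qed
    then have "(flat_fun n has_real_derivative 0) (at 0)"
      by (simp add: DERIV_def flat_fun_def)
    then show ?thesis using 2 by (simp add: flat_fun_def)
  qed
qed

lemma Ck_on_flat_fun: "Ck_on k UNIV (flat_fun n)"
proof (induction k arbitrary: n)
  case 0
  then show ?case
    by (auto intro!: continuous_at_imp_continuous_on DERIV_isCont[OF flat_fun_derivative])
next
  case (Suc k)
  have "Ck_on k UNIV (\<lambda>x. v * (flat_fun (n + 2) x + (- real n) * flat_fun (n + 1) x))" for v
    by (intro Ck_on_add Ck_on_mult Ck_on_const Suc)
  then show ?case using flat_fun_derivative[of n]
    by (auto simp: has_field_derivative_def mult.commute[of _ "_ - _"]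
        intro!: exI[of _ "\<lambda>x v. v * (flat_fun (n + 2) x + (- real n) * flat_fun (n + 1) x)"])
qed

text \<open>The denominator is positive everywhere, as t and 1 - t cannot both be
  nonpositive.\<close>

definition step_fun :: "real \<Rightarrow> real" where
  "step_fun t = flat_fun 0 t * inverse (flat_fun 0 t + flat_fun 0 (1 - t))"

lemma step_fun_eq: "t \<le> 0 \<Longrightarrow> step_fun t = 0" "t \<ge> 1 \<Longrightarrow> step_fun t = 1"
  by (auto simp: step_fun_def flat_fun_def)

lemma real_basis: "finite {1::real}" "span {1::real} = UNIV" "pairwise orthogonal {1::real}"
  by (auto simp: span_singleton pairwise_def) 

lemma Ck_on_step_fun: "Ck_on k UNIV step_fun"
  unfolding step_fun_def
proof (intro Ck_on_mult Ck_on_flat_fun)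
  have pos: "flat_fun 0 t + flat_fun 0 (1 - t) > 0" for t
    by (auto simp: flat_fun_def add_pos_pos)
  have "Ck_on k UNIV (\<lambda>t::real. - t)"
    by (intro Ck_on_bounded_linear bounded_linear_minus bounded_linear_ident)
  then have "Ck_on k UNIV (\<lambda>t::real. 1 + - t)"
    by (intro Ck_on_add Ck_on_const)
  then have "Ck_on k UNIV (\<lambda>t. flat_fun 0 (1 - t))"
    using Ck_on_comp[OF real_basis _ Ck_on_flat_fun, of k UNIV "\<lambda>t. 1 - t"] by simp
  then have "Ck_on k UNIV (\<lambda>t. flat_fun 0 t + flat_fun 0 (1 - t))"
    by (intro Ck_on_add Ck_on_flat_fun)
  then show "Ck_on k UNIV (\<lambda>t. inverse (flat_fun 0 t + flat_fun 0 (1 - t)))"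
    by (rule Ck_on_comp[OF real_basis _ Ck_on_inverse]) (use pos in \<open>auto simp: less_imp_neq\<close>, metis less_irrefl pos)
qed

lemma Ck_on_norm_square: "Ck_on k UNIV (\<lambda>z::'b::real_inner. (z - z0) \<bullet> (z - z0))"
proof (cases k)
  case 0
  then show ?thesis by (auto intro!: continuous_intros)
next
  case (Suc n)
  have "Ck_on n UNIV (\<lambda>z. 2 * (z \<bullet> v) + (- 2 * (z0 \<bullet> v)))" for v
    by (intro Ck_on_add Ck_on_const Ck_on_bounded_linear bounded_linear_intros)
  moreover have "((\<lambda>z. (z - z0) \<bullet> (z - z0)) has_derivative
      (\<lambda>v. 2 * (z \<bullet> v) + (- 2 * (z0 \<bullet> v)))) (at z)" for z
    by (auto intro!: derivative_eq_intros simp: inner_commute algebra_simps)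
  ultimately show ?thesis unfolding Suc Ck_on.simps
    by (intro exI[of _ "\<lambda>z v. 2 * (z \<bullet> v) + (- 2 * (z0 \<bullet> v))"]) blast
qed

section \<open>Compactness of closed balls in the model space\<close>

lemma compact_coordinate_box:
  fixes B :: "'b::real_normed_vector set"
  assumes "finite B"
  shows "compact {\<Sum>b\<in>B. c b *\<^sub>R b | c. \<forall>b\<in>B. \<bar>c b\<bar> \<le> (R::real)}"
  using assms
proof induction
  case empty
  then show ?case by simp
next
  case (insert b B)
  let ?S = "{\<Sum>b\<in>B. c b *\<^sub>R b | c. \<forall>b\<in>B. \<bar>c b\<bar> \<le> R}"
  have "continuous_on ({-R..R} \<times> ?S) (\<lambda>(t, y). t *\<^sub>R b + y)"
    unfolding split_def by (intro continuous_on_add continuous_on_scaleR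
        continuous_on_fst continuous_on_snd continuous_on_id continuous_on_const)
  then have "compact ((\<lambda>(t, y). t *\<^sub>R b + y) ` ({-R..R} \<times> ?S))"
    by (intro compact_continuous_image compact_Times insert.IH compact_Icc)
  moreover have "(\<lambda>(t, y). t *\<^sub>R b + y) ` ({-R..R} \<times> ?S) =
      {\<Sum>b\<in>insert b B. c b *\<^sub>R b | c. \<forall>b\<in>insert b B. \<bar>c b\<bar> \<le> R}" (is "?L = ?R")
  proof
    show "?L \<subseteq> ?R"
    proof clarsimp
      fix t c assume t: "-R \<le> t" "t \<le> R" "\<forall>b\<in>B. \<bar>c b\<bar> \<le> R"
      have "(\<Sum>x\<in>B. c x *\<^sub>R x) = (\<Sum>x\<in>B. (c(b := t)) x *\<^sub>R x)"
        using insert.hyps by (intro sum.cong) auto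
      then show "\<exists>c'. t *\<^sub>R b + (\<Sum>x\<in>B. c x *\<^sub>R x) = (\<Sum>x\<in>insert b B. c' x *\<^sub>R x) \<and>
          \<bar>c' b\<bar> \<le> R \<and> (\<forall>b\<in>B. \<bar>c' b\<bar> \<le> R)"
        using t insert.hyps by (intro exI[of _ "c(b := t)"]) auto
    qed
    show "?R \<subseteq> ?L"
    proof clarsimp
      fix c assume "\<bar>c b\<bar> \<le> R" "\<forall>b\<in>B. \<bar>c b\<bar> \<le> R"
      then show "(\<Sum>x\<in>insert b B. c x *\<^sub>R x) \<in> ?L"
        using insert.hyps by (intro image_eqI[of _ _ "(c b, \<Sum>x\<in>B. c x *\<^sub>R x)"]) auto
    qed
  qed
  ultimately show ?case by simp
qed

text \<open>The class \<open>real_inner\<close> admits infinite dimension, so compactness has to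
  come from \<open>B\<close>: by Cauchy-Schwarz the coordinates of a vector of norm at most R are
  bounded, and the ball is a closed subset of a compact coordinate box.\<close>

lemma compact_cball_of_basis:
  fixes B :: "'b::real_inner set"
  assumes B: "finite B" "span B = UNIV" "pairwise orthogonal B"
  shows "compact (cball (z0::'b) R)"
proof -
  define B' where "B' = B - {0}"
  have B': "finite B'" "span B' = UNIV" using B by (auto simp: B'_def)
  let ?S = "\<lambda>Q. {\<Sum>b\<in>B'. c b *\<^sub>R b | c. \<forall>b\<in>B'. \<bar>c b\<bar> \<le> (Q::real)}"
  \<comment> \<open>A single bound for all coordinates: each |R| / norm b is one of these
    nonnegative summands.\<close>
  define Q where "Q = (\<Sum>b\<in>B'. \<bar>R\<bar> / norm b)"
  have "cball 0 R \<subseteq> ?S Q"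
  proof
    fix w :: 'b assume w: "w \<in> cball 0 R"
    obtain c where c: "w = (\<Sum>b\<in>B'. c b *\<^sub>R b)"
      using span_finite[OF B'(1)] B'(2) by blast
    have "\<bar>c b\<bar> \<le> Q" if "b \<in> B'" for b
    proof -
      have "b \<bullet> w = (\<Sum>b'\<in>B'. c b' * (b \<bullet> b'))" by (simp add: c inner_sum_right)
      also have "\<dots> = (\<Sum>b'\<in>B'. if b' = b then c b * (b \<bullet> b) else 0)"
        using B(3) that by (intro sum.cong) (auto simp: pairwise_def orthogonal_def B'_def)
      also have "\<dots> = c b * (b \<bullet> b)" using B' that by simp
      finally have "\<bar>c b\<bar> * (norm b * norm b) = \<bar>b \<bullet> w\<bar>"
        by (metis abs_mult abs_of_nonneg inner_ge_zero power2_eq_square power2_norm_eq_inner)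
      also have "\<dots> \<le> norm b * norm w" by (rule Cauchy_Schwarz_ineq2)
      also have "\<dots> \<le> norm b * \<bar>R\<bar>" using w by (intro mult_left_mono) auto
      finally have "\<bar>c b\<bar> \<le> \<bar>R\<bar> / norm b"
        using that by (simp add: B'_def field_simps)
      also have "\<dots> \<le> Q" unfolding Q_def
        using that B' by (intro member_le_sum) auto
      finally show ?thesis .
    qed
    then show "w \<in> ?S Q" using c by blast
  qed
  then have "?S Q \<inter> cball 0 R = cball (0::'b) R" by blast
  then have "compact (cball (0::'b) R)"
    using compact_Int_closed[OF compact_coordinate_box[OF B'(1), of Q] closed_cball, of 0 R] by simp
  then have "compact ((+) z0 ` cball 0 R)" by (rule compact_translation)
  then show ?thesis by (simp add: cball_translation image_add_cball) 
qed


section \<open>Charts and smooth functions on the manifold\<close>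

lemma smooth_on_local:
  assumes "\<And>x. x \<in> V \<Longrightarrow> \<exists>W. open W \<and> x \<in> W \<and> smooth_on W f"
  shows "smooth_on V f"
  unfolding smooth_on_def
proof (intro allI Ck_on_local)
  show "\<exists>W. open W \<and> x \<in> W \<and> Ck_on k W f" if "x \<in> V" for k x
    using assms[OF that] by (auto simp: smooth_on_def)
qed

lemma open_chart_image:
  assumes "smooth_atlas C" "(U, \<phi>) \<in> C" "open W"
  shows "open (\<phi> ` (U \<inter> W))"
proof -
  have h: "homeomorphism U (\<phi> ` U) \<phi> (inv_into U \<phi>)" "open (\<phi> ` U)"
    using assms unfolding smooth_atlas_def by auto
  have "openin (top_of_set (\<phi> ` U)) (\<phi> ` (U \<inter> W))"
    by (rule homeomorphism_imp_open_map[OF h(1)]) (simp add: assms(3) openin_open_Int)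
  then show ?thesis using h(2) openin_open_eq by blast
qed

lemma chart_inv:
  assumes "smooth_atlas C" "(U, \<phi>) \<in> C"
  shows "x \<in> U \<Longrightarrow> inv_into U \<phi> (\<phi> x) = x" "inj_on \<phi> U" "open U"
proof -
  have h: "homeomorphism U (\<phi> ` U) \<phi> (inv_into U \<phi>)" and "open U"
    using assms unfolding smooth_atlas_def by auto
  show "open U" by fact
  show "x \<in> U \<Longrightarrow> inv_into U \<phi> (\<phi> x) = x" for x using h by (simp add: homeomorphism_apply1)
  then show "inj_on \<phi> U" by (rule inj_on_inverseI)
qed

lemma smooth_fun_on_local:
  assumes "smooth_atlas C" "\<And>x. x \<in> V \<Longrightarrow> \<exists>W. open W \<and> x \<in> W \<and> smooth_fun_on C W f"
  shows "smooth_fun_on C V f"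
  unfolding smooth_fun_on_def
proof clarify
  fix U \<phi> assume U: "(U, \<phi>) \<in> C"
  show "smooth_on (\<phi> ` (U \<inter> V)) (f \<circ> inv_into U \<phi>)"
  proof (rule smooth_on_local)
    fix z assume "z \<in> \<phi> ` (U \<inter> V)"
    then obtain x where x: "x \<in> U" "x \<in> V" "z = \<phi> x" by auto
    then obtain W where W: "open W" "x \<in> W" "smooth_fun_on C W f" using assms(2) by blast
    show "\<exists>W. open W \<and> z \<in> W \<and> smooth_on W (f \<circ> inv_into U \<phi>)"
      using W U x open_chart_image[OF assms(1) U W(1)]
      by (intro exI[of _ "\<phi> ` (U \<inter> W)"]) (auto simp: smooth_fun_on_def)
  qed
qed

lemma smooth_fun_on_mono:
  assumes "smooth_fun_on C V f" "W \<subseteq> V"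
  shows "smooth_fun_on C W f"
  unfolding smooth_fun_on_def
proof clarify
  fix U \<phi> assume "(U, \<phi>) \<in> C"
  then have "smooth_on (\<phi> ` (U \<inter> V)) (f \<circ> inv_into U \<phi>)"
    using assms by (auto simp: smooth_fun_on_def)
  moreover have "\<phi> ` (U \<inter> W) \<subseteq> \<phi> ` (U \<inter> V)" using assms by auto
  ultimately show "smooth_on (\<phi> ` (U \<inter> W)) (f \<circ> inv_into U \<phi>)"
    unfolding smooth_on_def by (blast intro: Ck_on_mono)
qed

lemma smooth_fun_on_cong:
  assumes C: "smooth_atlas C" and "open V" "\<And>x. x \<in> V \<Longrightarrow> f x = g x" "smooth_fun_on C V f"
  shows "smooth_fun_on C V g"
  unfolding smooth_fun_on_def
proof clarify
  fix U \<phi> assume U: "(U, \<phi>) \<in> C"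
  have "smooth_on (\<phi> ` (U \<inter> V)) (f \<circ> inv_into U \<phi>)"
    using assms U by (auto simp: smooth_fun_on_def)
  moreover have "(f \<circ> inv_into U \<phi>) z = (g \<circ> inv_into U \<phi>) z" if "z \<in> \<phi> ` (U \<inter> V)" for z
    using that assms(3) chart_inv[OF C U] by auto
  ultimately show "smooth_on (\<phi> ` (U \<inter> V)) (g \<circ> inv_into U \<phi>)"
    unfolding smooth_on_def using Ck_on_cong[OF open_chart_image[OF C U assms(2)]] by blast
qed

lemma smooth_fun_on_const: "smooth_fun_on C V (\<lambda>x. c)"
  by (auto simp: smooth_fun_on_def smooth_on_def o_def intro: Ck_on_const)

lemma smooth_fun_on_add:
  "smooth_fun_on C V f \<Longrightarrow> smooth_fun_on C V g \<Longrightarrow> smooth_fun_on C V (\<lambda>x. f x + g x)"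
  by (fastforce simp: smooth_fun_on_def smooth_on_def o_def intro: Ck_on_add)

lemma smooth_fun_on_mult:
  "smooth_fun_on C V f \<Longrightarrow> smooth_fun_on C V g \<Longrightarrow> smooth_fun_on C V (\<lambda>x. f x * g x)"
  by (fastforce simp: smooth_fun_on_def smooth_on_def o_def intro: Ck_on_mult)

lemma smooth_fun_on_sum:
  "(\<And>i. i \<in> A \<Longrightarrow> smooth_fun_on C V (f i)) \<Longrightarrow> smooth_fun_on C V (\<lambda>x. \<Sum>i\<in>A. f i x)"
  by (induction A rule: infinite_finite_induct) (auto intro: smooth_fun_on_const smooth_fun_on_add)

text \<open>Besides the neighbourhood \<open>W\<close> where \<open>h\<close> is 1, a closed set
  \<open>K\<close> inside \<open>U\<close> is delivered. A field defined on \<open>U\<close> only,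
  multiplied by \<open>h\<close>, can be extended by 0: the complement of \<open>K\<close> is open
  and covers the manifold together with \<open>U\<close>.\<close>

lemma bump_function:
  fixes C :: "('p::{t2_space,second_countable_topology} set \<times> ('p \<Rightarrow> 'b::real_inner)) set"
  assumes C: "smooth_atlas C" and U: "open U" "x0 \<in> U"
  obtains h W K where "h \<in> smooth_funs C" "open W" "x0 \<in> W" "W \<subseteq> U" "\<And>y. y \<in> W \<Longrightarrow> h y = 1"
    "closed K" "K \<subseteq> U" "\<And>y. y \<notin> K \<Longrightarrow> h y = 0"
proof -
  obtain B0 where "finite B0" "span B0 = (UNIV :: 'b set)" using C by (auto simp: smooth_atlas_def)
  then obtain B where B: "finite B" "span B = (UNIV :: 'b set)" "pairwise orthogonal B"
    using basis_orthogonal[of B0] by auto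
  have "x0 \<in> \<Union>(fst ` C)" using C unfolding smooth_atlas_def by simp
  then obtain U0 \<phi> where ch: "(U0, \<phi>) \<in> C" "x0 \<in> U0" by auto
  have hom: "homeomorphism U0 (\<phi> ` U0) \<phi> (inv_into U0 \<phi>)"
    using C ch unfolding smooth_atlas_def by auto
  have opn: "open (\<phi> ` (U0 \<inter> U))" by (rule open_chart_image[OF C ch(1) U(1)])
  define z0 where "z0 = \<phi> x0"
  have "z0 \<in> \<phi> ` (U0 \<inter> U)" using U ch by (auto simp: z0_def)
  then obtain R where R: "R > 0" "cball z0 R \<subseteq> \<phi> ` (U0 \<inter> U)"
    using opn open_contains_cball by blast
  \<comment> \<open>The argument of \<open>step_fun\<close> is negative if |z - z0| > R and at least
    1 if |z - z0| is at most R / 2. The squared norm keeps \<open>b\<close> smooth at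
    \<open>z0\<close>.\<close>
  define b where "b z = step_fun (2 + (- 2 / R^2) * ((z - z0) \<bullet> (z - z0)))" for z
  define h where "h y = (if y \<in> U0 then b (\<phi> y) else 0)" for y
  define K where "K = inv_into U0 \<phi> ` cball z0 R"
  define W where "W = U0 \<inter> U \<inter> \<phi> -` ball z0 (R / 2)"
  have b_smooth: "Ck_on k UNIV b" for k
    unfolding b_def
    by (rule Ck_on_comp[OF real_basis _ Ck_on_step_fun])
      (intro Ck_on_add Ck_on_mult Ck_on_const Ck_on_norm_square subset_UNIV)+
  have K_chart: "y \<in> K \<longleftrightarrow> y \<in> U0 \<and> \<phi> y \<in> cball z0 R" for y
  proof -
    have "inv_into U0 \<phi> z \<in> U0" "\<phi> (inv_into U0 \<phi> z) = z" if "z \<in> cball z0 R" for z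
    proof -
      from that R(2) have "z \<in> \<phi> ` U0" by blast
      then show "inv_into U0 \<phi> z \<in> U0" "\<phi> (inv_into U0 \<phi> z) = z"
        by (auto intro: inv_into_into f_inv_into_f)
    qed
    then show ?thesis unfolding K_def using chart_inv(1)[OF C ch(1)] by (force simp: image_iff)
  qed
  have zero: "h y = 0" if "y \<notin> K" for y
  proof (cases "y \<in> U0")
    case True
    then have "R < norm (\<phi> y - z0)" using that K_chart by (auto simp: dist_norm norm_minus_commute)
    then have "R^2 < (\<phi> y - z0) \<bullet> (\<phi> y - z0)"
      using R(1) by (simp add: dot_square_norm power_strict_mono)
    then have "2 + (- 2 / R^2) * ((\<phi> y - z0) \<bullet> (\<phi> y - z0)) \<le> 0"
      using R(1) by (simp add: field_simps)
    then show ?thesis by (simp add: h_def b_def step_fun_eq)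
  qed (simp add: h_def)
  have one: "h y = 1" if "y \<in> W" for y
  proof -
    have "norm (\<phi> y - z0) \<le> R / 2" using that by (auto simp: W_def dist_norm norm_minus_commute)
    then have "(norm (\<phi> y - z0))^2 \<le> (R / 2)^2" by (intro power_mono) auto
    then have "(\<phi> y - z0) \<bullet> (\<phi> y - z0) \<le> R^2 / 4"
      by (simp add: dot_square_norm power_divide)
    then have "2 * ((\<phi> y - z0) \<bullet> (\<phi> y - z0)) \<le> R^2"
      using inner_ge_zero[of "\<phi> y - z0"] by linarith
    then have "1 \<le> 2 + (- 2 / R^2) * ((\<phi> y - z0) \<bullet> (\<phi> y - z0))"
      using R(1) by (simp add: field_simps)
    then show ?thesis using that by (auto simp: h_def W_def b_def step_fun_eq)
  qed
  \<comment> \<open>The image of a compact ball is compact, hence closed, because the manifold is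
    Hausdorff.\<close>
  have "compact K" unfolding K_def
    using hom R(2) by (intro compact_continuous_image compact_cball_of_basis[OF B])
      (auto simp: homeomorphism_def intro: continuous_on_subset)
  then have K: "closed K" by (rule compact_imp_closed)
  have KU: "K \<subseteq> U"
  proof
    fix y assume "y \<in> K"
    then have "y \<in> U0" "\<phi> y \<in> \<phi> ` (U0 \<inter> U)" using K_chart R(2) by auto
    then show "y \<in> U" using chart_inv(2)[OF C ch(1)] by (auto dest: inj_onD)
  qed
  have W: "open W"
  proof -
    have "continuous_on (U0 \<inter> U) \<phi>"
      using hom by (auto simp: homeomorphism_def intro: continuous_on_subset)
    then show ?thesis unfolding W_def
      using chart_inv(3)[OF C ch(1)] U(1) by (intro continuous_open_preimage) auto
  qed
  have "smooth_fun_on C UNIV h"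
  proof (rule smooth_fun_on_local[OF C])
    fix x
    show "\<exists>W. open W \<and> x \<in> W \<and> smooth_fun_on C W h"
    proof (cases "x \<in> U0")
      case True
      have "smooth_fun_on C U0 h" unfolding smooth_fun_on_def
      proof clarify
        fix U' \<phi>' assume ch': "(U', \<phi>') \<in> C"
        have sm: "smooth_on (\<phi>' ` (U' \<inter> U0)) (\<phi> \<circ> inv_into U' \<phi>')"
          using C ch ch' unfolding smooth_atlas_def by blast
        have "Ck_on k (\<phi>' ` (U' \<inter> U0)) (\<lambda>z. b ((\<phi> \<circ> inv_into U' \<phi>') z))" for k
          by (rule Ck_on_comp[OF B _ b_smooth]) (use sm in \<open>auto simp: smooth_on_def o_def\<close>)
        then have "Ck_on k (\<phi>' ` (U' \<inter> U0)) (h \<circ> inv_into U' \<phi>')" for k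
          by (rule Ck_on_cong[OF open_chart_image[OF C ch' chart_inv(3)[OF C ch(1)]], rotated])
            (auto simp: h_def chart_inv(1)[OF C ch'])
        then show "smooth_on (\<phi>' ` (U' \<inter> U0)) (h \<circ> inv_into U' \<phi>')"
          by (simp add: smooth_on_def)
      qed
      then show ?thesis using True chart_inv(3)[OF C ch(1)] by blast
    next
      case False
      then have "x \<in> - K" using K_chart by auto
      moreover have "smooth_fun_on C (- K) h"
        by (rule smooth_fun_on_cong[OF C _ _ smooth_fun_on_const[of _ _ 0]]) (use K zero in auto)
      ultimately show ?thesis using K by blast
    qed
  qed
  then show ?thesis
    using that[of h W K] W K KU zero one U ch R(1) by (auto simp: smooth_funs_def W_def z0_def)
qed

section \<open>Exterior algebra\<close>

lemma sum_fun_apply: "(\<Sum>i\<in>A. f i) x = (\<Sum>i\<in>A. f i x)"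
  by (induction A rule: infinite_finite_induct) auto

lemma zero_fun_fold [simp]: "(\<lambda>_. 0) = (0 :: 'a \<Rightarrow> 'b::zero)"
  by (simp add: zero_fun_def)

definition smv :: "real \<Rightarrow> multivector \<Rightarrow> multivector" (infixr \<open>*m\<close> 75) where
  "c *m a = (\<lambda>I. c * a I)"

definition mv_space :: "nat \<Rightarrow> multivector set" where
  "mv_space r = {a. \<forall>K. a K \<noteq> 0 \<longrightarrow> K \<subseteq> {..<r}}"

definition mv_deg :: "nat \<Rightarrow> multivector \<Rightarrow> bool" where
  "mv_deg k a \<longleftrightarrow> (\<forall>K. a K \<noteq> 0 \<longrightarrow> card K = k)"

text \<open>The grade involution. As an operator, the sign (-1)^|a| lets derivation rules be stated
  for inhomogeneous elements.\<close>

definition sg :: "multivector \<Rightarrow> multivector" where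
  "sg a = (\<lambda>I. (-1) ^ card I * a I)"

lemma smv_simps [simp]:
  "c *m d *m a = (c * d) *m a" "1 *m a = a" "0 *m a = 0" "c *m (0 :: multivector) = 0"
  "(-1) *m a = - a" "c *m (- a) = (- c) *m a" "- (c *m a) = (- c) *m a"
  by (auto simp: smv_def)

lemma smv_apply: "(c *m a) I = c * a I"
  by (simp add: smv_def)

lemma smv_distribs:
  "c *m (a + b) = c *m a + c *m b" "c *m (a - b) = c *m a - c *m b"
  "(c + d) *m a = c *m a + d *m a" "c *m sum f A = (\<Sum>i\<in>A. c *m f i)"
  by (auto simp: smv_def algebra_simps sum_fun_apply sum_distrib_left)

lemma sum_smv: "sum f A *m a = (\<Sum>i\<in>A. f i *m a)"
  by (auto simp: smv_def sum_fun_apply sum_distrib_right)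

lemma shuffle_sign_simps [simp]:
  "shuffle_sign {} J = 1" "shuffle_sign I {} = 1" "shuffle_sign I J * shuffle_sign I J = 1"
  by (auto simp: shuffle_sign_def simp flip: power_mult_distrib)

lemma shuffle_sign_less: "(\<And>j. j \<in> J \<Longrightarrow> i < j) \<Longrightarrow> shuffle_sign {i} J = 1"
proof -
  assume "\<And>j. j \<in> J \<Longrightarrow> i < j"
  then have "{(i', j). i' \<in> {i} \<and> j \<in> J \<and> j < i'} = {}" by fastforce
  then show ?thesis by (simp only: shuffle_sign_def) simp
qed

lemma shuffle_sign_greater: "j < i \<Longrightarrow> shuffle_sign {i} {j} = -1"
proof -
  assume "j < i"
  then have "{(i', j'). i' \<in> {i} \<and> j' \<in> {j} \<and> j' < i'} = {(i, j)}" by auto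
  then show ?thesis by (simp only: shuffle_sign_def) simp
qed

text \<open>Each pair in I x J is an inversion for exactly one of the two orders, so the two counts
  add up to \<open>card I * card J\<close>.\<close>

lemma shuffle_sign_swap:
  assumes "finite I" "finite J" "I \<inter> J = {}"
  shows "shuffle_sign J I = (-1) ^ (card I * card J) * shuffle_sign I J"
proof -
  let ?A = "{(i, j). i \<in> I \<and> j \<in> J \<and> j < i}" and ?B = "{(j, i). j \<in> J \<and> i \<in> I \<and> i < j}"
  have fin: "finite ?A" "finite ?B"
    by (rule finite_subset[of _ "I \<times> J"], use assms in auto)
      (rule finite_subset[of _ "J \<times> I"], use assms in auto)
  have "I \<times> J = ?A \<union> prod.swap ` ?B" using assms(3) by (auto simp: image_iff neq_iff) 
  moreover have "?A \<inter> prod.swap ` ?B = {}" by auto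
  ultimately have "card (I \<times> J) = card ?A + card (prod.swap ` ?B)"
    using fin by (simp add: card_Un_disjoint)
  moreover have "card (prod.swap ` ?B) = card ?B" by (rule card_image) simp
  ultimately have "card I * card J = card ?A + card ?B" by (simp add: card_cartesian_product)
  then have "(-1::real) ^ (card I * card J) * shuffle_sign I J = ((-1) ^ card ?A * (-1) ^ card ?A) * (-1) ^ card ?B"
    by (simp add: shuffle_sign_def power_add)
  also have "\<dots> = shuffle_sign J I"
    by (simp add: shuffle_sign_def flip: power_mult_distrib)
  finally show ?thesis by simp
qed

subsection \<open>The wedge product\<close>

text \<open>The sum over the infinite set \<open>Pow K\<close> is 0 by convention. As
  \<open>wedge\<close> loses components at infinite index sets, its unit law below is restricted to
  \<open>mv_space\<close>.\<close>

lemma wedge_infinite: "infinite K \<Longrightarrow> wedge a b K = 0"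
  by (simp add: wedge_def)

lemma wedge_linear [simp]:
  "wedge (a + b) c = wedge a c + wedge b c" "wedge a (b + c) = wedge a b + wedge a c"
  "wedge (a - b) c = wedge a c - wedge b c" "wedge a (b - c) = wedge a b - wedge a c"
  "wedge (- a) b = - wedge a b" "wedge a (- b) = - wedge a b"
  "wedge (k *m a) b = k *m wedge a b" "wedge a (k *m b) = k *m wedge a b"
  "wedge 0 b = 0" "wedge a 0 = 0"
  by (auto simp: wedge_def smv_def algebra_simps sum.distrib sum_subtractf sum_negf sum_distrib_left)

lemma wedge_sum:
  "wedge (sum f A) b = (\<Sum>i\<in>A. wedge (f i) b)" "wedge a (sum g A) = (\<Sum>i\<in>A. wedge a (g i))"
  by (induction A rule: infinite_finite_induct) auto

text \<open>Both sides sum over the ordered partitions of \<open>K\<close> into three sets; the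
  signs agree because \<open>shuffle_sign\<close> is multiplicative in each argument.\<close>

lemma wedge_assoc: "wedge (wedge a b) c = wedge a (wedge b c)"
proof
  fix K :: "nat set"
  let ?g = "\<lambda>I J. shuffle_sign I (K - I) * a I * (shuffle_sign J (K - I - J) * b J * c (K - I - J))"
  show "wedge (wedge a b) c K = wedge a (wedge b c) K"
  proof (cases "finite K")
    case True
    have "wedge (wedge a b) c K = (\<Sum>L\<in>Pow K. \<Sum>I\<in>Pow L. ?g I (L - I))"
      unfolding wedge_def
    proof (rule sum.cong[OF refl])
      fix L assume L: "L \<in> Pow K"
      have "shuffle_sign L (K - L) * (\<Sum>I\<in>Pow L. shuffle_sign I (L - I) * a I * b (L - I)) * c (K - L)
        = (\<Sum>I\<in>Pow L. shuffle_sign L (K - L) * (shuffle_sign I (L - I) * a I * b (L - I)) * c (K - L))"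
        by (simp add: sum_distrib_left sum_distrib_right)
      also have "\<dots> = (\<Sum>I\<in>Pow L. ?g I (L - I))"
      proof (rule sum.cong[OF refl])
        fix I assume I: "I \<in> Pow L"
        have fin: "finite L" "finite I" using L I True by (auto intro: finite_subset)
        have 1: "shuffle_sign L (K - L) = shuffle_sign I (K - L) * shuffle_sign (L - I) (K - L)"
          using shuffle_sign_Un_left[of I "L - I" "K - L"] fin True I by (auto simp: Un_absorb1)
        have "K - I = (L - I) \<union> (K - L)" using I L by auto
        then have 2: "shuffle_sign I (K - I) = shuffle_sign I (L - I) * shuffle_sign I (K - L)"
          using shuffle_sign_Un_right[of I "L - I" "K - L"] fin True L by auto
        have 3: "K - I - (L - I) = K - L" using I L by auto
        show "shuffle_sign L (K - L) * (shuffle_sign I (L - I) * a I * b (L - I)) * c (K - L) = ?g I (L - I)"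
          unfolding 1 2 3 by (simp add: mult_ac)
      qed
      finally show "shuffle_sign L (K - L) * (\<Sum>I\<in>Pow L. shuffle_sign I (L - I) * a I * b (L - I)) * c (K - L)
        = (\<Sum>I\<in>Pow L. ?g I (L - I))" .
    qed
    also have "\<dots> = (\<Sum>(L, I)\<in>(SIGMA L:Pow K. Pow L). ?g I (L - I))"
      by (subst sum.Sigma) (use True in \<open>auto intro: finite_subset\<close>)
    also have "\<dots> = (\<Sum>(I, J)\<in>(SIGMA I:Pow K. Pow (K - I)). ?g I J)"
      by (rule sum.reindex_bij_witness[where i = "\<lambda>(I, J). (I \<union> J, I)" and j = "\<lambda>(L, I). (I, L - I)"])
        auto
    also have "\<dots> = (\<Sum>I\<in>Pow K. \<Sum>J\<in>Pow (K - I). ?g I J)"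
      by (subst sum.Sigma) (use True in auto)
    also have "\<dots> = wedge a (wedge b c) K"
      by (simp add: wedge_def sum_distrib_left)
    finally show ?thesis .
  qed (simp add: wedge_infinite)
qed

lemma wedge_sign_swap:
  assumes "mv_deg k a" "mv_deg l b"
  shows "wedge a b = ((-1) ^ (k * l)) *m wedge b a"
proof
  fix K :: "nat set"
  show "wedge a b K = (((-1) ^ (k * l)) *m wedge b a) K"
  proof (cases "finite K")
    case True
    have "wedge a b K = (\<Sum>I\<in>Pow K. shuffle_sign (K - I) (K - (K - I)) * a (K - I) * b (K - (K - I)))"
      unfolding wedge_def
      by (rule sum.reindex_bij_witness[where i = "\<lambda>I. K - I" and j = "\<lambda>I. K - I"])
        (auto simp: double_diff)
    also have "\<dots> = (\<Sum>I\<in>Pow K. (-1) ^ (k * l) * (shuffle_sign I (K - I) * b I * a (K - I)))"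
    proof (rule sum.cong[OF refl])
      fix I assume I: "I \<in> Pow K"
      then have fin: "finite I" using True by (auto intro: finite_subset)
      have d: "K - (K - I) = I" using I by auto
      show "shuffle_sign (K - I) (K - (K - I)) * a (K - I) * b (K - (K - I)) =
        (-1) ^ (k * l) * (shuffle_sign I (K - I) * b I * a (K - I))"
      proof (cases "a (K - I) = 0 \<or> b I = 0")
        case False
        then have "card (K - I) = k" "card I = l" using assms by (auto simp: mv_deg_def)
        then show ?thesis unfolding d
          using shuffle_sign_swap[of I "K - I"] fin True by (auto simp: mult_ac)
      qed (auto simp: d)
    qed
    finally show ?thesis by (simp add: wedge_def smv_def sum_distrib_left)
  qed (simp add: wedge_infinite smv_def)
qed

lemma wedge_scalar_left: "a \<in> mv_space r \<Longrightarrow> wedge (scalar_mv c) a = c *m a"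
proof
  fix K assume a: "a \<in> mv_space r"
  show "wedge (scalar_mv c) a K = (c *m a) K"
  proof (cases "finite K")
    case True
    have "wedge (scalar_mv c) a K = (\<Sum>I\<in>Pow K. if I = {} then c * a K else 0)"
      unfolding wedge_def by (rule sum.cong) (auto simp: scalar_mv_def)
    then show ?thesis using True by (simp add: smv_def)
  next
    case False
    then have "a K = 0" using a finite_subset[of K "{..<r}"] by (auto simp: mv_space_def)
    then show ?thesis using False by (simp add: smv_def wedge_infinite)
  qed
qed

lemma wedge_nonzero:
  assumes "wedge a b K \<noteq> 0"
  obtains I where "finite K" "I \<subseteq> K" "a I \<noteq> 0" "b (K - I) \<noteq> 0"
proof -
  have "finite K" using assms wedge_infinite by blast
  moreover obtain I where "I \<in> Pow K" "shuffle_sign I (K - I) * a I * b (K - I) \<noteq> 0"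
    using assms unfolding wedge_def by (meson sum.not_neutral_contains_not_neutral)
  ultimately show ?thesis using that by auto
qed

lemma wedge_mv_space: "a \<in> mv_space r \<Longrightarrow> b \<in> mv_space r \<Longrightarrow> wedge a b \<in> mv_space r"
  unfolding mv_space_def by (fastforce elim!: wedge_nonzero)

lemma card_split: "finite K \<Longrightarrow> I \<subseteq> K \<Longrightarrow> card K = card I + card (K - I)"
  by (metis card_Diff_subset card_mono finite_subset le_add_diff_inverse)

lemma wedge_mv_deg: "mv_deg k a \<Longrightarrow> mv_deg l b \<Longrightarrow> mv_deg (k + l) (wedge a b)"
  unfolding mv_deg_def by (auto elim!: wedge_nonzero simp: card_split)

lemma sg_linear [simp]:
  "sg (a + b) = sg a + sg b" "sg (a - b) = sg a - sg b" "sg (- a) = - sg a"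
  "sg (c *m a) = c *m sg a" "sg (sg a) = a" "sg 0 = 0"
  by (auto simp: sg_def smv_def algebra_simps simp flip: power_mult_distrib)

lemma sg_wedge: "sg (wedge a b) = wedge (sg a) (sg b)"
proof
  fix K :: "nat set"
  show "sg (wedge a b) K = wedge (sg a) (sg b) K"
  proof (cases "finite K")
    case True
    show ?thesis unfolding sg_def wedge_def sum_distrib_left
      by (rule sum.cong) (use True in \<open>auto simp: card_split[of K] power_add\<close>)
  qed (simp add: sg_def wedge_infinite)
qed

lemma sg_mv_deg: "mv_deg k a \<Longrightarrow> sg a = ((-1) ^ k) *m a"
proof
  show "sg a I = (((-1) ^ k) *m a) I" if "mv_deg k a" for I
    using that by (cases "a I = 0") (auto simp: sg_def smv_def mv_deg_def)
qed

lemma mv_space_alt: "a \<in> mv_space r \<longleftrightarrow> (\<forall>K. \<not> K \<subseteq> {..<r} \<longrightarrow> a K = 0)"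
  by (auto simp: mv_space_def)

lemma mv_space_linear:
  "a \<in> mv_space r \<Longrightarrow> b \<in> mv_space r \<Longrightarrow> a + b \<in> mv_space r"
  "a \<in> mv_space r \<Longrightarrow> b \<in> mv_space r \<Longrightarrow> a - b \<in> mv_space r"
  "a \<in> mv_space r \<Longrightarrow> - a \<in> mv_space r" "a \<in> mv_space r \<Longrightarrow> c *m a \<in> mv_space r"
  "0 \<in> mv_space r" "scalar_mv c \<in> mv_space r" "vector_mv r v \<in> mv_space r"
  by (auto simp: mv_space_alt smv_def scalar_mv_def vector_mv_def)

lemma mv_space_sum: "(\<And>i. i \<in> A \<Longrightarrow> f i \<in> mv_space r) \<Longrightarrow> sum f A \<in> mv_space r"
  by (induction A rule: infinite_finite_induct) (auto intro: mv_space_linear)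

lemma vector_mv_deg: "mv_deg 1 (vector_mv r v)"
  by (auto simp: mv_deg_def vector_mv_def)

lemma scalar_mv_deg: "mv_deg 0 (scalar_mv c)"
  by (auto simp: mv_deg_def scalar_mv_def)

lemma vector_mv_at [simp]: "i < r \<Longrightarrow> vector_mv r v {i} = v i"
  by (auto simp: vector_mv_def)

lemma vector_mv_surj: "a \<in> mv_space r \<Longrightarrow> mv_deg 1 a \<Longrightarrow> a = vector_mv r (\<lambda>i. a {i})"
proof
  fix K assume a: "a \<in> mv_space r" "mv_deg 1 a"
  show "a K = vector_mv r (\<lambda>i. a {i}) K"
  proof (cases "a K = 0")
    case True
    then show ?thesis by (auto simp: vector_mv_def)
  next
    case False
    then have "card K = 1" "K \<subseteq> {..<r}" using a by (auto simp: mv_space_def mv_deg_def)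
    then obtain i where "K = {i}" "i < r" by (metis card_1_singletonE insert_subset lessThan_iff)
    then show ?thesis by simp
  qed
qed

lemma vector_wedge_vector:
  "wedge (vector_mv r v) (vector_mv r w) = - wedge (vector_mv r w) (vector_mv r v)"
  using wedge_sign_swap[OF vector_mv_deg vector_mv_deg, of r v r w] by simp

lemma vector_wedge_self [simp]: "wedge (vector_mv r v) (vector_mv r v) = 0"
proof
  fix K
  have "wedge (vector_mv r v) (vector_mv r v) K = - wedge (vector_mv r v) (vector_mv r v) K"
    using vector_wedge_vector[of r v v] by (metis uminus_apply)
  then show "wedge (vector_mv r v) (vector_mv r v) K = 0 K" by simp
qed

subsection \<open>Contraction\<close>

lemma contract_linear [simp]:
  "contract r (a + b) m = contract r a m + contract r b m"
  "contract r a (m + n) = contract r a m + contract r a n"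
  "contract r (a - b) m = contract r a m - contract r b m"
  "contract r a (m - n) = contract r a m - contract r a n"
  "contract r (- a) m = - contract r a m" "contract r a (- m) = - contract r a m"
  "contract r (k *m a) m = k *m contract r a m" "contract r a (k *m m) = k *m contract r a m"
  "contract r 0 m = 0" "contract r a 0 = 0"
  by (auto simp: contract_def smv_def algebra_simps sum.distrib sum_subtractf sum_negf sum_distrib_left)

lemma contract_sum:
  "contract r (sum f A) m = (\<Sum>i\<in>A. contract r (f i) m)"
  "contract r a (sum g A) = (\<Sum>i\<in>A. contract r a (g i))"
  by (induction A rule: infinite_finite_induct) auto

lemma contract_nonzero:
  assumes "contract r a m K \<noteq> 0"
  obtains I where "I \<subseteq> {..<r} - K" "a I \<noteq> 0" "m (I \<union> K) \<noteq> 0"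
proof -
  obtain I where "I \<in> Pow ({..<r} - K)" "shuffle_sign I K * a I * m (I \<union> K) \<noteq> 0"
    using assms unfolding contract_def by (meson sum.not_neutral_contains_not_neutral)
  then show ?thesis using that by auto
qed

lemma contract_mv_space: "m \<in> mv_space r \<Longrightarrow> contract r a m \<in> mv_space r"
  unfolding mv_space_def by (fastforce elim!: contract_nonzero)

lemma contract_mv_deg:
  assumes "m \<in> mv_space r" "mv_deg k a" "mv_deg l m" "contract r a m K \<noteq> 0"
  shows "k + card K = l"
proof -
  obtain I where I: "I \<subseteq> {..<r} - K" "a I \<noteq> 0" "m (I \<union> K) \<noteq> 0"
    using assms(4) by (rule contract_nonzero)
  then have "I \<union> K \<subseteq> {..<r}" using assms(1) by (auto simp: mv_space_def)
  then have "finite I" "finite K" by (auto intro: finite_subset)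
  then have "card (I \<union> K) = card I + card K" using I by (intro card_Un_disjoint) auto
  then show ?thesis using I assms(2,3) by (auto simp: mv_deg_def)
qed

lemma contract_wedge_mv:
  assumes "m \<in> mv_space r"
  shows "contract r (wedge X Y) m = contract r Y (contract r X m)"
proof
  fix K
  show "contract r (wedge X Y) m K = contract r Y (contract r X m) K"
  proof (cases "finite K")
    case False
    have "n K = 0" if "n \<in> mv_space r" for n
      using that False finite_subset[of K "{..<r}"] by (auto simp: mv_space_def)
    from this[of "contract r (wedge X Y) m"] this[of "contract r Y (contract r X m)"]
    show ?thesis using assms by (simp add: contract_mv_space)
  qed (rule contract_wedge)
qed

lemma contract_scalar: "contract r (scalar_mv c) m = c *m m"
proof
  fix K
  have "contract r (scalar_mv c) m K = (\<Sum>I\<in>Pow ({..<r} - K). if I = {} then c * m K else 0)"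
    unfolding contract_def by (rule sum.cong) (auto simp: scalar_mv_def)
  then show "contract r (scalar_mv c) m K = (c *m m) K" by (simp add: smv_def)
qed

text \<open>Contraction with the i-th basis vector. Contraction with any vector is a linear
  combination of these, so the derivation rule has to be checked for them only.\<close>

definition contract_at :: "nat \<Rightarrow> multivector \<Rightarrow> multivector" where
  "contract_at i m = (\<lambda>K. if i \<in> K then 0 else shuffle_sign {i} K * m (insert i K))"

lemma contract_vector: "contract r (vector_mv r v) m = (\<Sum>i<r. v i *m contract_at i m)"
proof
  fix K
  have "contract r (vector_mv r v) m K =
      (\<Sum>I\<in>(\<lambda>i. {i}) ` ({..<r} - K). shuffle_sign I K * vector_mv r v I * m (I \<union> K))"
    unfolding contract_def by (rule sum.mono_neutral_right) (auto simp: vector_mv_def)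
  also have "\<dots> = (\<Sum>i\<in>{..<r} - K. v i * (shuffle_sign {i} K * m (insert i K)))"
    by (subst sum.reindex) (auto simp: mult_ac intro!: sum.cong)
  also have "\<dots> = (\<Sum>i<r. v i * contract_at i m K)"
    by (rule sum.mono_neutral_cong_left) (auto simp: contract_at_def)
  finally show "contract r (vector_mv r v) m K = (\<Sum>i<r. v i *m contract_at i m) K"
    by (simp add: sum_fun_apply smv_def)
qed

lemma contract_at_wedge:
  "contract_at i (wedge a b) = wedge (contract_at i a) b + wedge (sg a) (contract_at i b)"
proof
  fix K :: "nat set"
  show "contract_at i (wedge a b) K = (wedge (contract_at i a) b + wedge (sg a) (contract_at i b)) K"
  proof (cases "finite K")
    case False
    then show ?thesis by (simp add: contract_at_def wedge_infinite)
  next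
    case K: True
    show ?thesis
    proof (cases "i \<in> K")
      case True
      \<comment> \<open>Here the left-hand side is 0, and the term of \<open>I\<close> in the first
        sum cancels that of \<open>insert i I\<close> in the second.\<close>
      let ?M = "K - {i}"
      let ?s = "\<lambda>I. shuffle_sign I (K - I) * contract_at i a I * b (K - I)"
      let ?t = "\<lambda>I. shuffle_sign I (K - I) * sg a I * contract_at i b (K - I)"
      have split: "Pow K = insert i ` Pow ?M \<union> Pow ?M"
        using True by (metis Pow_insert Un_commute insert_Diff)
      have disj: "insert i ` Pow ?M \<inter> Pow ?M = {}" by auto
      have fin: "finite (insert i ` Pow ?M)" "finite (Pow ?M)" using K by auto
      have "wedge (contract_at i a) b K = (\<Sum>I\<in>Pow ?M. ?s I)"
        unfolding wedge_def split sum.union_disjoint[OF fin disj]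
        by (subst (1) sum.neutral) (auto simp: contract_at_def)
      moreover have "wedge (sg a) (contract_at i b) K = (\<Sum>I\<in>insert i ` Pow ?M. ?t I)"
        unfolding wedge_def split sum.union_disjoint[OF fin disj]
        using True by (subst (2) sum.neutral) (auto simp: contract_at_def)
      moreover have "(\<Sum>I\<in>insert i ` Pow ?M. ?t I) = (\<Sum>I\<in>Pow ?M. ?t (insert i I))"
        by (subst sum.reindex) (auto simp: inj_on_def)
      moreover have "?s I + ?t (insert i I) = 0" if I: "I \<in> Pow ?M" for I
      proof -
        have fi: "finite I" "i \<notin> I" using K that by (auto intro: finite_subset)
        have 1: "K - I = insert i (?M - I)" using True fi by auto
        have 2: "K - insert i I = ?M - I" by auto
        have 3: "shuffle_sign I (insert i (?M - I)) = shuffle_sign I {i} * shuffle_sign I (?M - I)"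
          using shuffle_sign_Un_right[of I "{i}" "?M - I"] fi K by auto
        have 4: "shuffle_sign (insert i I) (?M - I) = shuffle_sign {i} (?M - I) * shuffle_sign I (?M - I)"
          using shuffle_sign_Un_left[of "{i}" I "?M - I"] fi K by auto
        have 5: "shuffle_sign {i} I = (-1) ^ card I * shuffle_sign I {i}"
          using shuffle_sign_swap[of I "{i}"] fi by simp
        have 6: "shuffle_sign I {i} * (shuffle_sign I {i} * c) = c" for c
          by (simp flip: mult.assoc)
        have 7: "shuffle_sign {i} (?M - I) * (shuffle_sign {i} (?M - I) * c) = c" for c
          by (simp flip: mult.assoc)
        show ?thesis unfolding 2 unfolding 1 3 4
          using fi by (simp add: contract_at_def sg_def 5 6 7 mult_ac)
      qed
      ultimately show ?thesis using True
        by (simp add: contract_at_def flip: sum.distrib)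
    next
      case False
      \<comment> \<open>The subsets of \<open>?L\<close> that contain \<open>i\<close> give the
        first summand, the others the second.\<close>
      let ?L = "insert i K"
      let ?t = "\<lambda>I. shuffle_sign {i} K * (shuffle_sign I (?L - I) * a I * b (?L - I))"
      have split: "Pow ?L = insert i ` Pow K \<union> Pow K" by (simp add: Pow_insert Un_commute)
      have "contract_at i (wedge a b) K = (\<Sum>I\<in>Pow ?L. ?t I)"
        using False by (simp add: contract_at_def wedge_def sum_distrib_left)
      also have "\<dots> = (\<Sum>I\<in>insert i ` Pow K. ?t I) + (\<Sum>I\<in>Pow K. ?t I)"
        unfolding split by (rule sum.union_disjoint) (use K False in auto)
      also have "(\<Sum>I\<in>insert i ` Pow K. ?t I) = (\<Sum>I\<in>Pow K. ?t (insert i I))"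
        by (rule sum.reindex_cong[of "insert i"])
          (use False in \<open>auto simp: inj_on_def dest!: insert_ident[THEN iffD1, rotated 2]\<close>)
      also have "\<dots> = wedge (contract_at i a) b K"
        unfolding wedge_def
      proof (rule sum.cong[OF refl])
        fix I assume I: "I \<in> Pow K"
        then have fin: "finite I" "i \<notin> I" using K False by (auto intro: finite_subset)
        have 1: "?L - insert i I = K - I" using False by auto
        have 2: "shuffle_sign (insert i I) (K - I) = shuffle_sign {i} (K - I) * shuffle_sign I (K - I)"
          using shuffle_sign_Un_left[of "{i}" I "K - I"] fin K by auto
        have 3: "shuffle_sign {i} K = shuffle_sign {i} I * shuffle_sign {i} (K - I)"
          using shuffle_sign_Un_right[of "{i}" I "K - I"] fin K I by (auto simp: Un_absorb1)
        have 4: "shuffle_sign {i} (K - I) * shuffle_sign {i} (K - I) = 1" by simp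
        show "?t (insert i I) = shuffle_sign I (K - I) * contract_at i a I * b (K - I)"
          unfolding 1 2 3 using fin 4 by (simp add: contract_at_def mult_ac)
      qed
      also have "(\<Sum>I\<in>Pow K. ?t I) = wedge (sg a) (contract_at i b) K"
        unfolding wedge_def
      proof (rule sum.cong[OF refl])
        fix I assume I: "I \<in> Pow K"
        then have fin: "finite I" "i \<notin> I" using K False by (auto intro: finite_subset)
        have 1: "?L - I = insert i (K - I)" using fin by auto
        have 2: "shuffle_sign I (insert i (K - I)) = shuffle_sign I {i} * shuffle_sign I (K - I)"
          using shuffle_sign_Un_right[of I "{i}" "K - I"] fin K False by auto
        have 3: "shuffle_sign {i} K = shuffle_sign {i} I * shuffle_sign {i} (K - I)"
          using shuffle_sign_Un_right[of "{i}" I "K - I"] fin K I by (auto simp: Un_absorb1)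
        have "shuffle_sign {i} I = (-1) ^ card I * shuffle_sign I {i}"
          using shuffle_sign_swap[of I "{i}"] fin by simp
        then have 4: "shuffle_sign {i} I * shuffle_sign I {i} = (-1) ^ card I" by simp
        show "?t I = shuffle_sign I (K - I) * sg a I * contract_at i b (K - I)"
          unfolding 1 2 3 sg_def 4[symmetric] using False by (simp add: contract_at_def mult_ac)
      qed
      finally show ?thesis by simp
    qed
  qed
qed


lemma contract_vector_wedge:
  "contract r (vector_mv r v) (wedge a b) =
    wedge (contract r (vector_mv r v) a) b + wedge (sg a) (contract r (vector_mv r v) b)"
  by (simp add: contract_vector contract_at_wedge wedge_sum smv_distribs sum.distrib)

lemma contract_vector_vector:
  "contract r (vector_mv r v) (vector_mv r w) = scalar_mv (\<Sum>i<r. v i * w i)"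
proof -
  have "contract_at i (vector_mv r w) = scalar_mv (w i)" if "i < r" for i
  proof
    fix K
    show "contract_at i (vector_mv r w) K = scalar_mv (w i) K"
    proof (cases "K = {}")
      case False
      then have "insert i K = {j} \<Longrightarrow> i \<in> K" for j by auto
      then show ?thesis using False by (auto simp: contract_at_def vector_mv_def scalar_mv_def)
    qed (use that in \<open>simp add: contract_at_def scalar_mv_def\<close>)
  qed
  then have "contract r (vector_mv r v) (vector_mv r w) = (\<Sum>i<r. v i *m scalar_mv (w i))"
    by (simp add: contract_vector)
  also have "\<dots> = scalar_mv (\<Sum>i<r. v i * w i)"
    by (auto simp: sum_fun_apply smv_def scalar_mv_def)
  finally show ?thesis .
qed

lemma contract_vector_scalar [simp]: "contract r (vector_mv r v) (scalar_mv c) = 0"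
proof -
  have "contract_at i (scalar_mv c) = 0" for i by (auto simp: contract_at_def scalar_mv_def)
  then show ?thesis by (simp add: contract_vector)
qed

lemma contract_vector_vector_wedge:
  assumes "m \<in> mv_space r"
  shows "contract r (vector_mv r v) (wedge (vector_mv r w) m) =
    (\<Sum>i<r. v i * w i) *m m - wedge (vector_mv r w) (contract r (vector_mv r v) m)"
  using assms by (simp add: contract_vector_wedge contract_vector_vector wedge_scalar_left
      sg_mv_deg[OF vector_mv_deg])

subsection \<open>Frames of the exterior algebra\<close>

lemma frame_wedge_empty [simp]: "frame_wedge r e {} = scalar_mv 1"
  by (simp add: frame_wedge_def)

text \<open>\<open>frame_wedge\<close> multiplies in increasing order, so a new minimum is split off
  without a sign; this dictates the rule \<open>finite_linorder_min_induct\<close> in the inductions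
  below.\<close>

lemma frame_wedge_insert_less:
  assumes "finite J" "\<And>j. j \<in> J \<Longrightarrow> i < j"
  shows "frame_wedge r e (insert i J) = wedge (vector_mv r (e i)) (frame_wedge r e J)"
proof -
  have "Min (insert i J) = i" using assms by (intro Min_eqI) (auto intro: less_imp_le)
  moreover have "insert i J - {i} = J" using assms by auto
  ultimately have "sorted_list_of_set (insert i J) = i # sorted_list_of_set J"
    using assms(1) by (subst sorted_list_of_set_nonempty) auto
  then show ?thesis by (simp add: frame_wedge_def)
qed

lemma frame_wedge_mv_space: "finite J \<Longrightarrow> frame_wedge r e J \<in> mv_space r"
  by (induction rule: finite_linorder_min_induct)
    (auto simp: frame_wedge_insert_less mv_space_linear wedge_mv_space)

lemma frame_wedge_mv_deg: "finite J \<Longrightarrow> mv_deg (card J) (frame_wedge r e J)"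
proof (induction rule: finite_linorder_min_induct)
  case (insert b A)
  then have "b \<notin> A" by auto
  then show ?case using insert wedge_mv_deg[OF vector_mv_deg insert.IH]
    by (simp add: frame_wedge_insert_less)
qed (simp add: scalar_mv_deg)

lemma vector_wedge_frame_wedge:
  assumes "finite J"
  shows "wedge (vector_mv r (e i)) (frame_wedge r e J) =
    (if i \<in> J then 0 else shuffle_sign {i} J *m frame_wedge r e (insert i J))"
  using assms
proof (induction arbitrary: i rule: finite_linorder_min_induct)
  case empty
  then show ?case using frame_wedge_insert_less[of "{}" i r e] by simp
next
  case (insert m J)
  have J: "frame_wedge r e (insert m J) = wedge (vector_mv r (e m)) (frame_wedge r e J)"
    using insert.hyps by (intro frame_wedge_insert_less) auto
  consider "i < m" | "i = m" | "m < i" by linarith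
  then show ?case
  proof cases
    case 1
    then have "i < j" if "j \<in> insert m J" for j using that insert.hyps by auto
    moreover from this have "i \<notin> insert m J" by blast
    ultimately show ?thesis
      using insert.hyps frame_wedge_insert_less[of "insert m J" i r e] shuffle_sign_less[of "insert m J" i]
      by auto
  next
    case 2
    then show ?thesis by (simp add: J flip: wedge_assoc)
  next
    case 3
    have m: "m \<notin> J" using insert.hyps by auto
    \<comment> \<open>The vector e_i passes the lowest factor e_m with a minus sign; this is the
      inversion that m adds to \<open>shuffle_sign {i} (insert m J)\<close>.\<close>
    have "wedge (vector_mv r (e i)) (frame_wedge r e (insert m J)) =
        - wedge (vector_mv r (e m)) (wedge (vector_mv r (e i)) (frame_wedge r e J))"
      unfolding J by (simp add: vector_wedge_vector[of r "e i"] flip: wedge_assoc)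
    also have "\<dots> = (if i \<in> J then 0 else (- shuffle_sign {i} J) *m
        wedge (vector_mv r (e m)) (frame_wedge r e (insert i J)))"
      by (simp add: insert.IH)
    also have "wedge (vector_mv r (e m)) (frame_wedge r e (insert i J)) =
        frame_wedge r e (insert i (insert m J))"
    proof -
      have "m < j" if "j \<in> insert i J" for j using that insert.hyps 3 by auto
      then show ?thesis
        using insert.hyps frame_wedge_insert_less[of "insert i J" m r e] by (simp add: insert_commute)
    qed
    also have "- shuffle_sign {i} J = shuffle_sign {i} (insert m J)"
      using shuffle_sign_Un_right[of "{i}" "{m}" J] insert.hyps m 3
      by (simp add: shuffle_sign_greater)
    finally show ?thesis using 3 by simp
  qed
qed

lemma frame_wedge_wedge:
  assumes "finite I" "finite J"
  shows "wedge (frame_wedge r e I) (frame_wedge r e J) =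
    (if I \<inter> J = {} then shuffle_sign I J *m frame_wedge r e (I \<union> J) else 0)"
  using assms(1)
proof (induction rule: finite_linorder_min_induct)
  case empty
  then show ?case by (simp add: wedge_scalar_left[OF frame_wedge_mv_space[OF assms(2)]])
next
  case (insert i I)
  then have i: "i \<notin> I" by auto
  have "wedge (frame_wedge r e (insert i I)) (frame_wedge r e J) =
      wedge (vector_mv r (e i)) (wedge (frame_wedge r e I) (frame_wedge r e J))"
    using insert.hyps by (simp add: frame_wedge_insert_less wedge_assoc)
  also have "\<dots> = (if I \<inter> J = {} \<and> i \<notin> J then
      (shuffle_sign I J * shuffle_sign {i} (I \<union> J)) *m frame_wedge r e (insert i (I \<union> J)) else 0)"
    using insert assms(2) i by (simp add: vector_wedge_frame_wedge)
  also have "\<dots> = (if insert i I \<inter> J = {} then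
      shuffle_sign (insert i I) J *m frame_wedge r e (insert i I \<union> J) else 0)"
  proof -
    have "shuffle_sign (insert i I) J = shuffle_sign I J * shuffle_sign {i} (I \<union> J)" if "I \<inter> J = {}"
      using shuffle_sign_Un_left[of "{i}" I J] shuffle_sign_Un_right[of "{i}" I J] insert.hyps i that assms(2)
      by (simp add: shuffle_sign_less)
    then show ?thesis by auto
  qed
  finally show ?case .
qed

definition dual_vectors :: "nat \<Rightarrow> (nat \<Rightarrow> nat \<Rightarrow> real) \<Rightarrow> (nat \<Rightarrow> nat \<Rightarrow> real) \<Rightarrow> bool" where
  "dual_vectors r e \<epsilon> \<longleftrightarrow> (\<forall>i<r. \<forall>j<r. (\<Sum>k<r. \<epsilon> i k * e j k) = (if i = j then 1 else 0))"

lemma dual_vectors_sym: "dual_vectors r e \<epsilon> \<Longrightarrow> dual_vectors r \<epsilon> e"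
  by (auto simp: dual_vectors_def mult.commute)

lemma contract_vector_frame_wedge:
  assumes "dual_vectors r e \<epsilon>" "i < r" "J \<subseteq> {..<r}"
  shows "contract r (vector_mv r (\<epsilon> i)) (frame_wedge r e J) =
    (if i \<in> J then shuffle_sign {i} (J - {i}) *m frame_wedge r e (J - {i}) else 0)"
proof -
  have "finite J" using assms(3) by (rule finite_subset) simp
  then show ?thesis using assms(3)
  proof (induction rule: finite_linorder_min_induct)
    case empty
    then show ?case by simp
  next
    case (insert m J)
    have m: "m \<notin> J" "m < r" using insert by auto
    have 1: "contract r (vector_mv r (\<epsilon> i)) (frame_wedge r e (insert m J)) =
        (if i = m then 1 else 0) *m frame_wedge r e J -
        wedge (vector_mv r (e m)) (contract r (vector_mv r (\<epsilon> i)) (frame_wedge r e J))"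
      using insert.hyps assms m(2)
      by (simp add: frame_wedge_insert_less contract_vector_vector_wedge frame_wedge_mv_space dual_vectors_def)
    show ?case
    proof (cases "i = m")
      case True
      have "contract r (vector_mv r (\<epsilon> i)) (frame_wedge r e J) = 0"
        using insert m True by simp
      then show ?thesis using 1 insert.hyps m True by (simp add: shuffle_sign_less)
    next
      case False
      show ?thesis
      proof (cases "i \<in> J")
        case True
        have "m < i" using True insert.hyps by auto
        have "insert m J - {i} = insert m (J - {i})" using False by auto
        moreover have "shuffle_sign {i} (insert m (J - {i})) = - shuffle_sign {i} (J - {i})"
          using shuffle_sign_Un_right[of "{i}" "{m}" "J - {i}"] insert.hyps m \<open>m < i\<close>
          by (simp add: shuffle_sign_greater)
        ultimately show ?thesis
          using 1 False True insert frame_wedge_insert_less[of "J - {i}" m r e] by simp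
      next
        case iJ: False
        then show ?thesis using 1 False insert by simp
      qed
    qed
  qed
qed

text \<open>By i(X \<and> Y) = i_Y i_X the factors of the first argument contract one after another,
  the lowest first.\<close>

lemma contract_frame_wedge:
  assumes "dual_vectors r e \<epsilon>" "I \<subseteq> {..<r}" "J \<subseteq> {..<r}"
  shows "contract r (frame_wedge r \<epsilon> I) (frame_wedge r e J) =
    (if I \<subseteq> J then shuffle_sign I (J - I) *m frame_wedge r e (J - I) else 0)"
proof -
  have "finite I" using assms(2) by (rule finite_subset) simp
  then show ?thesis using assms(2,3)
  proof (induction arbitrary: J rule: finite_linorder_min_induct)
    case empty
    then show ?case by (simp add: contract_scalar)
  next
    case (insert i I)
    have i: "i \<notin> I" "i < r" using insert by auto
    have fJ: "finite J" using insert.prems by (auto intro: finite_subset)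
    have "contract r (frame_wedge r \<epsilon> (insert i I)) (frame_wedge r e J) =
        contract r (frame_wedge r \<epsilon> I) (contract r (vector_mv r (\<epsilon> i)) (frame_wedge r e J))"
      using insert.hyps by (simp add: frame_wedge_insert_less contract_wedge_mv frame_wedge_mv_space fJ)
    also have "\<dots> = (if i \<in> J \<and> I \<subseteq> J - {i} then
        (shuffle_sign {i} (J - {i}) * shuffle_sign I (J - {i} - I)) *m frame_wedge r e (J - {i} - I) else 0)"
    proof -
      have "J - {i} \<subseteq> {..<r}" "I \<subseteq> {..<r}" using insert.prems by auto
      then show ?thesis
        using insert.prems insert.IH[of "J - {i}"]
        by (simp add: contract_vector_frame_wedge[OF assms(1) i(2)])
    qed
    also have "\<dots> = (if insert i I \<subseteq> J then
        shuffle_sign (insert i I) (J - insert i I) *m frame_wedge r e (J - insert i I) else 0)"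
    proof -
      have eq: "J - {i} - I = J - insert i I" by auto
      have "shuffle_sign {i} (J - {i}) * shuffle_sign I (J - insert i I) =
          shuffle_sign (insert i I) (J - insert i I)" if "I \<subseteq> J - {i}"
      proof -
        have "J - {i} = I \<union> (J - insert i I)" "I \<inter> (J - insert i I) = {}" using that i by auto
        then show ?thesis
          using shuffle_sign_Un_left[of "{i}" I "J - insert i I"]
            shuffle_sign_Un_right[of "{i}" I "J - insert i I"] insert.hyps i fJ
          by (simp add: shuffle_sign_less)
      qed
      moreover have "i \<in> J \<and> I \<subseteq> J - {i} \<longleftrightarrow> insert i I \<subseteq> J" using i by auto
      ultimately show ?thesis unfolding eq by auto
    qed
    finally show ?case .
  qed
qed

text \<open>Passage from coordinates in the frame \<open>e\<close> to standard components. It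
  respects \<open>wedge\<close> and, for dual frames, \<open>contract\<close>; therefore the frame
  coordinates of products and contractions of sections are given by the same polynomial formulas and
  are smooth.\<close>

definition frame_mv :: "nat \<Rightarrow> (nat \<Rightarrow> nat \<Rightarrow> real) \<Rightarrow> multivector \<Rightarrow> multivector" where
  "frame_mv r e a = (\<Sum>I\<in>Pow {..<r}. a I *m frame_wedge r e I)"

lemma frame_mv_mv_space: "frame_mv r e a \<in> mv_space r"
  unfolding frame_mv_def
  by (intro mv_space_sum mv_space_linear frame_wedge_mv_space) (auto intro: finite_subset)

lemma frame_mv_wedge: "wedge (frame_mv r e a) (frame_mv r e b) = frame_mv r e (wedge a b)"
proof -
  let ?P = "Pow {..<r}" and ?F = "frame_wedge r e"
  have "wedge (frame_mv r e a) (frame_mv r e b) =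
      (\<Sum>I\<in>?P. \<Sum>J\<in>?P. (a I * b J) *m wedge (?F I) (?F J))"
    unfolding frame_mv_def wedge_sum(1) by (simp add: wedge_sum smv_distribs mult.commute)
  also have "\<dots> = (\<Sum>I\<in>?P. \<Sum>J\<in>Pow ({..<r} - I). (a I * b J * shuffle_sign I J) *m ?F (I \<union> J))"
  proof (rule sum.cong[OF refl], rule sum.mono_neutral_cong_right)
    show "(a I * b J) *m wedge (?F I) (?F J) = (a I * b J * shuffle_sign I J) *m ?F (I \<union> J)"
      if "I \<in> ?P" "J \<in> Pow ({..<r} - I)" for I J
    proof -
      have "finite I" "finite J" "I \<inter> J = {}" using that by (auto intro: finite_subset)
      then show ?thesis by (simp add: frame_wedge_wedge)
    qed
    show "\<forall>J\<in>?P - Pow ({..<r} - I). (a I * b J) *m wedge (?F I) (?F J) = 0" if "I \<in> ?P" for I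
    proof
      fix J assume "J \<in> ?P - Pow ({..<r} - I)"
      then have "finite I" "finite J" "I \<inter> J \<noteq> {}" using that by (auto intro: finite_subset)
      then show "(a I * b J) *m wedge (?F I) (?F J) = 0" by (simp add: frame_wedge_wedge)
    qed
  qed auto
  also have "\<dots> = (\<Sum>(I, J)\<in>(SIGMA I:?P. Pow ({..<r} - I)). (a I * b J * shuffle_sign I J) *m ?F (I \<union> J))"
    by (subst sum.Sigma) (auto intro: finite_subset)
  also have "\<dots> = (\<Sum>(L, I)\<in>(SIGMA L:?P. Pow L). (a I * b (L - I) * shuffle_sign I (L - I)) *m ?F L)"
  proof (rule sum.reindex_bij_witness[where i = "\<lambda>(L, I). (I, L - I)" and j = "\<lambda>(I, J). (I \<union> J, I)"], goal_cases)
    case (5 z)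
    then obtain I J where "z = (I, J)" "J \<inter> I = {}" by auto
    moreover from this have "I \<union> J - I = J" by auto
    ultimately show ?case by simp
  qed auto
  also have "\<dots> = (\<Sum>L\<in>?P. \<Sum>I\<in>Pow L. (a I * b (L - I) * shuffle_sign I (L - I)) *m ?F L)"
    by (subst sum.Sigma) (auto intro: finite_subset)
  also have "\<dots> = frame_mv r e (wedge a b)"
    by (simp add: frame_mv_def wedge_def mult_ac flip: sum_smv)
  finally show ?thesis .
qed

lemma frame_mv_contract:
  assumes "dual_vectors r e \<epsilon>"
  shows "contract r (frame_mv r \<epsilon> a) (frame_mv r e b) = frame_mv r e (contract r a b)"
proof -
  let ?P = "Pow {..<r}" and ?F = "frame_wedge r e"
  have "contract r (frame_mv r \<epsilon> a) (frame_mv r e b) =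
      (\<Sum>I\<in>?P. \<Sum>J\<in>?P. (a I * b J) *m contract r (frame_wedge r \<epsilon> I) (?F J))"
    unfolding frame_mv_def contract_sum(1) by (simp add: contract_sum smv_distribs mult.commute)
  also have "\<dots> = (\<Sum>I\<in>?P. \<Sum>J\<in>{J\<in>?P. I \<subseteq> J}. (a I * b J * shuffle_sign I (J - I)) *m ?F (J - I))"
    by (rule sum.cong[OF refl], rule sum.mono_neutral_cong_right)
      (auto simp: contract_frame_wedge[OF assms])
  also have "\<dots> = (\<Sum>(I, J)\<in>(SIGMA I:?P. {J\<in>?P. I \<subseteq> J}).
      (a I * b J * shuffle_sign I (J - I)) *m ?F (J - I))"
    by (subst sum.Sigma) auto
  also have "\<dots> = (\<Sum>(K, I)\<in>(SIGMA K:?P. Pow ({..<r} - K)). (shuffle_sign I K * a I * b (I \<union> K)) *m ?F K)"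
  proof (rule sum.reindex_bij_witness[where i = "\<lambda>(K, I). (I, I \<union> K)" and j = "\<lambda>(I, J). (J - I, I)"], goal_cases)
    case (5 z)
    then obtain I J where "z = (I, J)" "I \<subseteq> J" by auto
    then show ?case by (simp add: mult_ac Un_absorb1)
  qed auto
  also have "\<dots> = (\<Sum>K\<in>?P. \<Sum>I\<in>Pow ({..<r} - K). (shuffle_sign I K * a I * b (I \<union> K)) *m ?F K)"
    by (subst sum.Sigma) auto
  also have "\<dots> = frame_mv r e (contract r a b)"
    by (simp add: frame_mv_def contract_def flip: sum_smv)
  finally show ?thesis .
qed

text \<open>Frame coordinates are contractions with the dual frame, hence unique; the gluing of
  sections relies on this.\<close>

lemma contract_frame_mv_basis:
  assumes "dual_vectors r e \<epsilon>" "I \<subseteq> {..<r}"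
  shows "contract r (frame_wedge r \<epsilon> I) (frame_mv r e a) {} = a I"
proof -
  have "contract r (frame_wedge r \<epsilon> I) (frame_mv r e a) {} =
      (\<Sum>J\<in>Pow {..<r}. if J = I then a I else 0)"
    unfolding frame_mv_def contract_sum sum_fun_apply
  proof (rule sum.cong[OF refl])
    fix J assume J: "J \<in> Pow {..<r}"
    have "finite (J - I)" using J by (auto intro: finite_subset)
    have "frame_wedge r e (J - I) {} = (if J \<subseteq> I then 1 else 0)"
    proof (cases "J \<subseteq> I")
      case True
      then have "J - I = {}" by auto
      then show ?thesis unfolding \<open>J - I = {}\<close> using True by (simp add: scalar_mv_def)
    next
      case False
      then have "card (J - I) \<noteq> 0" using \<open>finite (J - I)\<close> by auto
      then show ?thesis using False frame_wedge_mv_deg[OF \<open>finite (J - I)\<close>, of r e]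
        by (auto simp: mv_deg_def)
    qed
    then show "contract r (frame_wedge r \<epsilon> I) (a J *m frame_wedge r e J) {} = (if J = I then a I else 0)"
      using J assms(2) by (auto simp: contract_frame_wedge[OF assms(1)] smv_apply scalar_mv_def)
  qed
  then show ?thesis using assms(2) by simp
qed

text \<open>For dual frames, contracting e_J with the i-th dual vector and multiplying by e_i again
  fixes e_J if i is in J and kills it otherwise, so the sum over i counts the elements of J.\<close>

lemma frame_mv_euler:
  fixes a :: multivector
  assumes "dual_vectors r e \<epsilon>"
  shows "(\<Sum>i<r. wedge (vector_mv r (e i)) (contract r (vector_mv r (\<epsilon> i)) (frame_mv r e a))) =
    frame_mv r e (\<lambda>I. real (card I) * a I)"
proof -
  let ?P = "Pow {..<r}" and ?F = "frame_wedge r e"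
  have "(\<Sum>i<r. wedge (vector_mv r (e i)) (contract r (vector_mv r (\<epsilon> i)) (frame_mv r e a))) =
      (\<Sum>J\<in>?P. \<Sum>i<r. a J *m wedge (vector_mv r (e i)) (contract r (vector_mv r (\<epsilon> i)) (?F J)))"
    by (subst sum.swap) (simp add: frame_mv_def contract_sum wedge_sum)
  also have "\<dots> = (\<Sum>J\<in>?P. \<Sum>i<r. if i \<in> J then a J *m ?F J else 0)"
  proof (intro sum.cong refl)
    fix J i assume J: "J \<in> ?P" and i: "i \<in> {..<r}"
    have fin: "finite J" using J by (auto intro: finite_subset)
    show "a J *m wedge (vector_mv r (e i)) (contract r (vector_mv r (\<epsilon> i)) (?F J)) =
        (if i \<in> J then a J *m ?F J else 0)"
      using J i fin by (simp add: contract_vector_frame_wedge[OF assms] vector_wedge_frame_wedge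
          insert_absorb)
  qed
  also have "\<dots> = (\<Sum>J\<in>?P. (real (card J) * a J) *m ?F J)"
  proof (rule sum.cong[OF refl])
    fix J assume J: "J \<in> ?P"
    have "(\<Sum>i<r. if i \<in> J then a J *m ?F J else 0) = (\<Sum>i\<in>{..<r} \<inter> J. a J *m ?F J)"
      by (rule sum.inter_restrict[symmetric]) simp
    also have "{..<r} \<inter> J = J" using J by auto
    also have "(\<Sum>i\<in>J. a J *m ?F J) = (real (card J) * a J) *m ?F J"
      unfolding sum_smv[symmetric] by simp
    finally show "(\<Sum>i<r. if i \<in> J then a J *m ?F J else 0) = (real (card J) * a J) *m ?F J" .
  qed
  finally show ?thesis by (simp add: frame_mv_def)
qed

text \<open>A left inverse of a square matrix is a right inverse: a vector \<open>u\<close> killed by the dual frame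
  anticommutes with all contractions, so contracting \<open>u \<and> e\<^sub>1 \<and> \<dots> \<and> e\<^sub>r = 0\<close> with the dual frame
  leaves \<open>u = 0\<close>.\<close>

lemma dual_vectors_kernel:
  assumes e: "dual_vectors r e \<epsilon>" and u: "\<And>i. i < r \<Longrightarrow> (\<Sum>k<r. \<epsilon> i k * w k) = 0"
  shows "vector_mv r w = 0"
proof -
  let ?u = "vector_mv r w" and ?top = "frame_wedge r e {..<r}"
  have "mv_deg (Suc r) (wedge ?u ?top)" "wedge ?u ?top \<in> mv_space r"
    using wedge_mv_deg[OF vector_mv_deg frame_wedge_mv_deg[of "{..<r}" r e], of r w]
    by (auto simp: wedge_mv_space mv_space_linear frame_wedge_mv_space)
  then have top: "wedge ?u ?top = 0"
    using card_mono[of "{..<r}"] by (auto simp: mv_deg_def mv_space_def fun_eq_iff)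
      (metis card_lessThan finite_lessThan Suc_n_not_le_n)
  have *: "contract r (frame_wedge r \<epsilon> I) (wedge ?u m) =
      ((-1) ^ card I) *m wedge ?u (contract r (frame_wedge r \<epsilon> I) m)"
    if "finite I" "I \<subseteq> {..<r}" "m \<in> mv_space r" for I m
    using that
  proof (induction arbitrary: m rule: finite_linorder_min_induct)
    case empty
    then show ?case by (simp add: contract_scalar)
  next
    case (insert i I)
    have i: "i \<notin> I" "i < r" using insert by auto
    have "contract r (vector_mv r (\<epsilon> i)) (wedge ?u m) = - wedge ?u (contract r (vector_mv r (\<epsilon> i)) m)"
      using insert.prems u[OF i(2)] by (simp add: contract_vector_vector_wedge)
    then show ?case using insert i
      by (simp add: frame_wedge_insert_less contract_wedge_mv wedge_mv_space mv_space_linear contract_mv_space)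
  qed
  have "0 = contract r (frame_wedge r \<epsilon> {..<r}) (wedge ?u ?top)" by (simp add: top)
  also have "\<dots> = ((-1) ^ r) *m wedge ?u (scalar_mv 1)"
    by (simp add: * frame_wedge_mv_space contract_frame_wedge[OF e])
  also have "wedge ?u (scalar_mv 1) = ?u"
    using wedge_sign_swap[OF vector_mv_deg scalar_mv_deg, of r w 1]
    by (simp add: wedge_scalar_left[OF mv_space_linear(7)])
  finally have "((-1) ^ r) *m ((-1) ^ r) *m ?u = 0" by simp
  then show ?thesis unfolding smv_simps by (simp flip: power_mult_distrib)
qed

text \<open>The difference of the two sides is killed by all dual vectors, so
  \<open>dual_vectors_kernel\<close> applies.\<close>

lemma dual_vectors_expand:
  assumes "dual_vectors r e \<epsilon>" "i < r"
  shows "w i = (\<Sum>j<r. (\<Sum>k<r. \<epsilon> j k * w k) * e j i)"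
proof -
  let ?c = "\<lambda>j. \<Sum>k<r. \<epsilon> j k * w k"
  let ?u = "\<lambda>i. w i - (\<Sum>j<r. ?c j * e j i)"
  have "vector_mv r ?u = 0"
  proof (rule dual_vectors_kernel[OF assms(1)])
    fix l assume l: "l < r"
    have "(\<Sum>k<r. \<epsilon> l k * ?u k) = ?c l - (\<Sum>k<r. \<Sum>j<r. ?c j * (\<epsilon> l k * e j k))"
      by (simp add: right_diff_distrib sum_subtractf sum_distrib_left mult_ac)
    also have "(\<Sum>k<r. \<Sum>j<r. ?c j * (\<epsilon> l k * e j k)) = (\<Sum>j<r. ?c j * (\<Sum>k<r. \<epsilon> l k * e j k))"
      by (subst sum.swap) (simp only: sum_distrib_left)
    also have "\<dots> = (\<Sum>j<r. if j = l then ?c l else 0)"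
      using assms(1) l by (intro sum.cong refl) (auto simp: dual_vectors_def)
    also have "\<dots> = ?c l" using l by simp
    finally show "(\<Sum>k<r. \<epsilon> l k * ?u k) = 0" by simp
  qed
  then have "vector_mv r ?u {i} = 0" by simp
  then show ?thesis using assms(2) by simp
qed

section \<open>The algebra of multivector fields\<close>

lemma smooth_fun_on_zero [simp]: "smooth_fun_on C V 0"
  using smooth_fun_on_const[of C V 0] by simp

definition fsg :: "'p mvfield \<Rightarrow> 'p mvfield" where
  "fsg X = (\<lambda>x. sg (X x))"

text \<open>One operator for three uses: the projection to a degree (\<open>deg_part\<close>), the
  grade involution (\<open>fsg\<close>) and multiplication by the degree
  (\<open>fweight real\<close>).\<close>

definition fweight :: "(nat \<Rightarrow> real) \<Rightarrow> 'p mvfield \<Rightarrow> 'p mvfield" where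
  "fweight w X = (\<lambda>x I. w (card I) * X x I)"

lemma cscale_apply: "cscale c X x = c *m X x"
  by (simp add: cscale_def smv_def)

lemma fscale_apply: "fscale f X x = f x *m X x"
  by (simp add: fscale_def smv_def)

lemma field_eqI: "(\<And>x. X x = Y x) \<Longrightarrow> X = (Y :: 'p mvfield)"
  by (rule ext)

lemma fwedge_linear [simp]:
  "(X + Y) \<^bold>\<and> Z = X \<^bold>\<and> Z + Y \<^bold>\<and> Z" "Z \<^bold>\<and> (X + Y) = Z \<^bold>\<and> X + Z \<^bold>\<and> Y"
  "(X - Y) \<^bold>\<and> Z = X \<^bold>\<and> Z - Y \<^bold>\<and> Z" "Z \<^bold>\<and> (X - Y) = Z \<^bold>\<and> X - Z \<^bold>\<and> Y"
  "(- X) \<^bold>\<and> Z = - (X \<^bold>\<and> Z)" "Z \<^bold>\<and> (- X) = - (Z \<^bold>\<and> X)"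
  "0 \<^bold>\<and> Z = 0" "Z \<^bold>\<and> 0 = 0"
  "cscale c X \<^bold>\<and> Z = cscale c (X \<^bold>\<and> Z)" "Z \<^bold>\<and> cscale c X = cscale c (Z \<^bold>\<and> X)"
  "fscale f X \<^bold>\<and> Z = fscale f (X \<^bold>\<and> Z)" "Z \<^bold>\<and> fscale f X = fscale f (Z \<^bold>\<and> X)"
  by (rule field_eqI, simp add: fwedge_def cscale_apply fscale_apply)+

lemma fwedge_sum:
  "sum F A \<^bold>\<and> Z = (\<Sum>i\<in>A. F i \<^bold>\<and> Z)" "Z \<^bold>\<and> sum F A = (\<Sum>i\<in>A. Z \<^bold>\<and> F i)"
  by (induction A rule: infinite_finite_induct) auto

lemma fwedge_assoc: "(X \<^bold>\<and> Y) \<^bold>\<and> Z = X \<^bold>\<and> (Y \<^bold>\<and> Z)"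
  by (simp add: fwedge_def wedge_assoc)

lemma ins_linear [simp]:
  "ins E (X + Y) m = ins E X m + ins E Y m" "ins E X (m + n) = ins E X m + ins E X n"
  "ins E (X - Y) m = ins E X m - ins E Y m" "ins E X (m - n) = ins E X m - ins E X n"
  "ins E (- X) m = - ins E X m" "ins E X (- m) = - ins E X m"
  "ins E 0 m = 0" "ins E X 0 = 0"
  "ins E (cscale c X) m = cscale c (ins E X m)" "ins E X (cscale c m) = cscale c (ins E X m)"
  "ins E (fscale f X) m = fscale f (ins E X m)" "ins E X (fscale f m) = fscale f (ins E X m)"
  by (rule field_eqI, simp add: ins_def cscale_apply fscale_apply)+

lemma ins_sum:
  "ins E (sum F A) m = (\<Sum>i\<in>A. ins E (F i) m)" "ins E X (sum F A) = (\<Sum>i\<in>A. ins E X (F i))"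
  by (induction A rule: infinite_finite_induct) auto

lemma fsg_linear [simp]:
  "fsg (X + Y) = fsg X + fsg Y" "fsg (X - Y) = fsg X - fsg Y" "fsg (- X) = - fsg X" "fsg 0 = 0"
  "fsg (cscale c X) = cscale c (fsg X)" "fsg (fscale f X) = fscale f (fsg X)" "fsg (fsg X) = X"
  "fsg (X \<^bold>\<and> Y) = fsg X \<^bold>\<and> fsg Y"
  by (rule field_eqI, simp add: fsg_def cscale_apply fscale_apply fwedge_def sg_wedge)+

lemma cscale_simps [simp]:
  "cscale c (cscale d X) = cscale (c * d) X" "cscale 1 X = X" "cscale 0 X = 0" "cscale c 0 = 0"
  "cscale (-1) X = - X" "cscale c (- X) = cscale (- c) X" "- cscale c X = cscale (- c) X"
  by (rule field_eqI, simp add: cscale_apply)+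

lemma cscale_distribs:
  "cscale c (X + Y) = cscale c X + cscale c Y" "cscale c (X - Y) = cscale c X - cscale c Y"
  "cscale (c + d) X = cscale c X + cscale d X" "cscale c (sum F A) = (\<Sum>i\<in>A. cscale c (F i))"
  by (rule field_eqI, simp add: cscale_apply smv_distribs sum_fun_apply)+

lemma fscale_distribs:
  "fscale f (X + Y) = fscale f X + fscale f Y" "fscale f (X - Y) = fscale f X - fscale f Y"
  "fscale f (- X) = - fscale f X" "fscale f (cscale c X) = cscale c (fscale f X)"
  "fscale f (fscale g X) = fscale (\<lambda>x. f x * g x) X"
  "fscale f (sum F A) = (\<Sum>i\<in>A. fscale f (F i))" "fscale f 0 = 0"
  by (rule field_eqI, simp add: cscale_apply fscale_apply smv_distribs sum_fun_apply mult.commute)+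

subsection \<open>Sections\<close>

lemma sections_iff:
  "s \<in> sections E \<longleftrightarrow> (\<forall>(U,e)\<in>frames E. \<exists>c.
     (\<forall>I\<subseteq>{..<fibre_dim E}. smooth_fun_on (charts E) U (c I)) \<and>
     (\<forall>x\<in>U. s x = frame_mv (fibre_dim E) (e x) (\<lambda>I. c I x)))"
  by (simp add: sections_def frame_mv_def fun_eq_iff sum_fun_apply smv_apply)

lemma sectionsI:
  assumes "\<And>U e. (U, e) \<in> frames E \<Longrightarrow> \<exists>c.
     (\<forall>I\<subseteq>{..<fibre_dim E}. smooth_fun_on (charts E) U (c I)) \<and>
     (\<forall>x\<in>U. s x = frame_mv (fibre_dim E) (e x) (\<lambda>I. c I x))"
  shows "s \<in> sections E"
  using assms by (auto simp: sections_iff)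

lemma sectionsE:
  assumes "s \<in> sections E" "(U, e) \<in> frames E"
  obtains c where "\<And>I. I \<subseteq> {..<fibre_dim E} \<Longrightarrow> smooth_fun_on (charts E) U (c I)"
    "\<And>x. x \<in> U \<Longrightarrow> s x = frame_mv (fibre_dim E) (e x) (\<lambda>I. c I x)"
  using assms by (fastforce simp: sections_iff)

lemma frame_mv_linear:
  "frame_mv r e (\<lambda>I. a I + b I) = frame_mv r e a + frame_mv r e b"
  "frame_mv r e (\<lambda>I. c * a I) = c *m frame_mv r e a" "frame_mv r e (\<lambda>I. 0) = 0"
  by (simp_all add: frame_mv_def smv_distribs sum.distrib)

text \<open>Products of frame vectors are homogeneous, so a weight by degree may be applied to frame
  coordinates or to standard components alike. This is why \<open>fweight\<close> preserves
  smoothness.\<close>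

lemma frame_mv_weight:
  "frame_mv r e (\<lambda>I. w (card I) * a I) = (\<lambda>K. w (card K) * frame_mv r e a K)"
proof
  fix K
  have "frame_mv r e (\<lambda>I. w (card I) * a I) K =
      (\<Sum>I\<in>Pow {..<r}. w (card I) * (a I * frame_wedge r e I K))"
    by (simp add: frame_mv_def sum_fun_apply smv_apply mult_ac)
  also have "\<dots> = (\<Sum>I\<in>Pow {..<r}. w (card K) * (a I * frame_wedge r e I K))"
  proof (rule sum.cong[OF refl])
    fix I assume "I \<in> Pow {..<r}"
    then have "finite I" by (auto intro: finite_subset)
    then have "frame_wedge r e I K = 0 \<or> card K = card I"
      using frame_wedge_mv_deg[of I r e] by (auto simp: mv_deg_def)
    then show "w (card I) * (a I * frame_wedge r e I K) = w (card K) * (a I * frame_wedge r e I K)"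
      by auto
  qed
  finally show "frame_mv r e (\<lambda>I. w (card I) * a I) K = w (card K) * frame_mv r e a K"
    by (simp add: frame_mv_def sum_fun_apply smv_apply sum_distrib_left)
qed

lemma frame_mv_scalar: "frame_mv r e (scalar_mv c) = scalar_mv c"
proof -
  have "frame_mv r e (scalar_mv c) = (\<Sum>I\<in>Pow {..<r}. if I = {} then c *m scalar_mv 1 else 0)"
    unfolding frame_mv_def by (rule sum.cong) (auto simp: scalar_mv_def[of c])
  then show ?thesis by (auto simp: smv_def scalar_mv_def)
qed

lemma frame_wedge_single: "frame_wedge r e {i} = vector_mv r (e i)"
proof -
  have "frame_wedge r e {i} = wedge (vector_mv r (e i)) (scalar_mv 1)"
    using frame_wedge_insert_less[of "{}" i r e] by simp
  also have "\<dots> = wedge (scalar_mv 1) (vector_mv r (e i))"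
    using wedge_sign_swap[OF vector_mv_deg scalar_mv_deg, of r "e i" 1] by simp
  finally show ?thesis by (simp add: wedge_scalar_left[OF mv_space_linear(7)])
qed

lemma frame_mv_vector: "frame_mv r e (vector_mv r v) = vector_mv r (\<lambda>l. \<Sum>j<r. v j * e j l)"
proof -
  have "frame_mv r e (vector_mv r v) = (\<Sum>I\<in>(\<lambda>i. {i}) ` {..<r}. vector_mv r v I *m frame_wedge r e I)"
    unfolding frame_mv_def by (rule sum.mono_neutral_right) (auto simp: vector_mv_def)
  also have "\<dots> = (\<Sum>j<r. v j *m vector_mv r (e j))"
    by (subst sum.reindex) (auto simp: frame_wedge_single)
  also have "\<dots> = vector_mv r (\<lambda>l. \<Sum>j<r. v j * e j l)"
    by (auto simp: fun_eq_iff sum_fun_apply smv_apply vector_mv_def intro!: sum.neutral)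
  finally show ?thesis .
qed

lemma frame_mv_at_empty: "frame_mv r e a {} = a {}"
proof -
  have "frame_mv r e a {} = (\<Sum>I\<in>Pow {..<r}. if I = {} then a {} else 0)"
    unfolding frame_mv_def sum_fun_apply
  proof (rule sum.cong[OF refl])
    fix I assume "I \<in> Pow {..<r}"
    then have "finite I" by (auto intro: finite_subset)
    then show "(a I *m frame_wedge r e I) {} = (if I = {} then a {} else 0)"
      using frame_wedge_mv_deg[of I r e] by (auto simp: mv_deg_def smv_apply scalar_mv_def)
  qed
  then show ?thesis by simp
qed

lemma dual_bundle_simps [simp]:
  "fibre_dim (dual_bundle E) = fibre_dim E" "charts (dual_bundle E) = charts E"
  "ins (dual_bundle E) = ins E"
  by (auto simp: dual_bundle_def ins_def fun_eq_iff)

lemma dual_frame_iff: "dual_frame r U e \<epsilon> \<longleftrightarrow> (\<forall>x\<in>U. dual_vectors r (e x) (\<epsilon> x))"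
  by (simp add: dual_frame_def dual_vectors_def)

lemma dual_bundle_frames:
  "(U, \<epsilon>) \<in> frames (dual_bundle E) \<longleftrightarrow> (\<exists>e. (U, e) \<in> frames E \<and> (\<forall>x\<in>U. dual_vectors (fibre_dim E) (e x) (\<epsilon> x)))"
  by (simp add: dual_bundle_def dual_frame_iff)

lemma vector_bundle_atlas: "vector_bundle E \<Longrightarrow> smooth_atlas (charts E)"
  by (simp add: vector_bundle_def)

lemma vector_bundle_frame:
  assumes "vector_bundle E"
  obtains U e \<epsilon> where "x \<in> U" "(U, e) \<in> frames E" "(U, \<epsilon>) \<in> frames (dual_bundle E)" "open U"
    "\<And>x. x \<in> U \<Longrightarrow> dual_vectors (fibre_dim E) (e x) (\<epsilon> x)"
proof -
  have "x \<in> \<Union>(fst ` frames E)" using assms unfolding vector_bundle_def by simp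
  then obtain U e where U: "x \<in> U" "(U, e) \<in> frames E" by auto
  then obtain \<epsilon> where "open U" "dual_frame (fibre_dim E) U e \<epsilon>"
    using assms unfolding vector_bundle_def by blast
  then show ?thesis using that[of U e \<epsilon>] U by (auto simp: dual_bundle_frames dual_frame_iff)
qed

lemma vector_bundle_frame_open: "vector_bundle E \<Longrightarrow> (U, e) \<in> frames E \<Longrightarrow> open U"
  unfolding vector_bundle_def by blast

lemma vector_bundle_dual_frame:
  assumes "vector_bundle E" "(U, e) \<in> frames E"
  obtains \<epsilon> where "(U, \<epsilon>) \<in> frames (dual_bundle E)"
    "\<And>x. x \<in> U \<Longrightarrow> dual_vectors (fibre_dim E) (e x) (\<epsilon> x)"
proof -
  obtain \<epsilon> where "dual_frame (fibre_dim E) U e \<epsilon>"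
    using assms unfolding vector_bundle_def by blast
  then show ?thesis using that[of \<epsilon>] assms by (auto simp: dual_bundle_frames dual_frame_iff)
qed

lemma vector_bundle_transition:
  assumes "vector_bundle E" "(U, e) \<in> frames E" "(U', e') \<in> frames E"
  obtains T where "\<And>j k. j < fibre_dim E \<Longrightarrow> k < fibre_dim E \<Longrightarrow> smooth_fun_on (charts E) (U \<inter> U') (T j k)"
    "\<And>x k i. x \<in> U \<inter> U' \<Longrightarrow> k < fibre_dim E \<Longrightarrow> i < fibre_dim E \<Longrightarrow>
      e' x k i = (\<Sum>j<fibre_dim E. T j k x * e x j i)"
proof -
  have "\<forall>(U,e)\<in>frames E. \<forall>(U',e')\<in>frames E. \<exists>T.
        (\<forall>j<fibre_dim E. \<forall>k<fibre_dim E. smooth_fun_on (charts E) (U \<inter> U') (T j k)) \<and>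
        (\<forall>x\<in>U \<inter> U'. \<forall>k<fibre_dim E. \<forall>i<fibre_dim E.
           e' x k i = (\<Sum>j<fibre_dim E. T j k x * e x j i))"
    using assms(1) unfolding vector_bundle_def by simp
  then show ?thesis using assms(2,3) that by fast
qed

lemma vector_bundle_dual:
  assumes "vector_bundle E"
  shows "vector_bundle (dual_bundle E)"
proof -
  let ?r = "fibre_dim E"
  have "\<Union>(fst ` frames (dual_bundle E)) = UNIV"
  proof (rule equalityI[OF subset_UNIV], rule subsetI)
    fix x
    obtain U e \<epsilon> where "x \<in> U" "(U, \<epsilon>) \<in> frames (dual_bundle E)"
      using vector_bundle_frame[OF assms] by metis
    then show "x \<in> \<Union>(fst ` frames (dual_bundle E))" by force
  qed
  moreover have "open U \<and> (\<exists>e. dual_frame ?r U \<epsilon> e)" if "(U, \<epsilon>) \<in> frames (dual_bundle E)" for U \<epsilon>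
    using that vector_bundle_frame_open[OF assms]
    unfolding dual_bundle_frames dual_frame_iff by (blast intro: dual_vectors_sym)
  moreover have "\<exists>T. (\<forall>j<?r. \<forall>k<?r. smooth_fun_on (charts E) (U \<inter> U') (T j k)) \<and>
        (\<forall>x\<in>U \<inter> U'. \<forall>k<?r. \<forall>i<?r. \<epsilon>' x k i = (\<Sum>j<?r. T j k x * \<epsilon> x j i))"
    if U: "(U, \<epsilon>) \<in> frames (dual_bundle E)" and U': "(U', \<epsilon>') \<in> frames (dual_bundle E)" for U \<epsilon> U' \<epsilon>'
  proof -
    obtain e where e: "(U, e) \<in> frames E" "\<forall>x\<in>U. dual_vectors ?r (e x) (\<epsilon> x)"
      using U by (auto simp: dual_bundle_frames)
    obtain e' where e': "(U', e') \<in> frames E" "\<forall>x\<in>U'. dual_vectors ?r (e' x) (\<epsilon>' x)"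
      using U' by (auto simp: dual_bundle_frames)
    \<comment> \<open>This matrix expresses \<open>e\<close> through \<open>e'\<close> and not the
      reverse: pairing with the dual frames shows that its transpose expresses \<epsilon>' through
      \<epsilon>, so no matrix has to be inverted.\<close>
    obtain T where T: "\<And>j k. j < ?r \<Longrightarrow> k < ?r \<Longrightarrow> smooth_fun_on (charts E) (U' \<inter> U) (T j k)"
      "\<And>x k i. x \<in> U' \<inter> U \<Longrightarrow> k < ?r \<Longrightarrow> i < ?r \<Longrightarrow> e x k i = (\<Sum>j<?r. T j k x * e' x j i)"
      using vector_bundle_transition[OF assms e'(1) e(1)] by blast
    have "\<epsilon>' x k i = (\<Sum>j<?r. T k j x * \<epsilon> x j i)" if x: "x \<in> U \<inter> U'" and k: "k < ?r" and i: "i < ?r" for x k i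
    proof -
      have "(\<Sum>l<?r. e x j l * \<epsilon>' x k l) = T k j x" if j: "j < ?r" for j
      proof -
        have "(\<Sum>l<?r. e x j l * \<epsilon>' x k l) = (\<Sum>l<?r. \<Sum>m<?r. T m j x * (\<epsilon>' x k l * e' x m l))"
          using x j by (intro sum.cong) (auto simp: T(2) sum_distrib_left mult_ac)
        also have "\<dots> = (\<Sum>m<?r. T m j x * (\<Sum>l<?r. \<epsilon>' x k l * e' x m l))"
          by (subst sum.swap) (simp only: sum_distrib_left)
        also have "\<dots> = (\<Sum>m<?r. if m = k then T k j x else 0)"
          using e'(2) x k by (intro sum.cong) (auto simp: dual_vectors_def)
        finally show ?thesis using k by simp
      qed
      moreover have "\<epsilon>' x k i = (\<Sum>j<?r. (\<Sum>l<?r. e x j l * \<epsilon>' x k l) * \<epsilon> x j i)"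
        using dual_vectors_expand[OF dual_vectors_sym i, of "e x" "\<epsilon> x" "\<epsilon>' x k"] e x by auto
      ultimately show ?thesis by simp
    qed
    then show ?thesis using T(1) by (intro exI[of _ "\<lambda>j k. T k j"]) (auto simp: Int_commute)
  qed
  ultimately show ?thesis
    using assms by (auto simp: vector_bundle_def split del: if_split)
qed

lemma sections_mv_space:
  assumes "vector_bundle E" "s \<in> sections E"
  shows "s x \<in> mv_space (fibre_dim E)"
proof -
  obtain U e \<epsilon> where "x \<in> U" "(U, e) \<in> frames E" using vector_bundle_frame[OF assms(1)] by metis
  then show ?thesis using assms(2) by (metis sectionsE frame_mv_mv_space)
qed

lemma sections_add: "s \<in> sections E \<Longrightarrow> t \<in> sections E \<Longrightarrow> s + t \<in> sections E"
proof (rule sectionsI)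
  fix U e assume st: "s \<in> sections E" "t \<in> sections E" and U: "(U, e) \<in> frames E"
  obtain c where c: "\<And>I. I \<subseteq> {..<fibre_dim E} \<Longrightarrow> smooth_fun_on (charts E) U (c I)"
    "\<And>x. x \<in> U \<Longrightarrow> s x = frame_mv (fibre_dim E) (e x) (\<lambda>I. c I x)"
    using st U by (metis sectionsE)
  obtain d where d: "\<And>I. I \<subseteq> {..<fibre_dim E} \<Longrightarrow> smooth_fun_on (charts E) U (d I)"
    "\<And>x. x \<in> U \<Longrightarrow> t x = frame_mv (fibre_dim E) (e x) (\<lambda>I. d I x)"
    using st U by (metis sectionsE)
  show "\<exists>c. (\<forall>I\<subseteq>{..<fibre_dim E}. smooth_fun_on (charts E) U (c I)) \<and>
     (\<forall>x\<in>U. (s + t) x = frame_mv (fibre_dim E) (e x) (\<lambda>I. c I x))"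
    using c d by (intro exI[of _ "\<lambda>I x. c I x + d I x"]) (auto simp: frame_mv_linear intro: smooth_fun_on_add)
qed

lemma sections_fscale: "f \<in> smooth_funs (charts E) \<Longrightarrow> s \<in> sections E \<Longrightarrow> fscale f s \<in> sections E"
proof (rule sectionsI)
  fix U e assume f: "f \<in> smooth_funs (charts E)" and s: "s \<in> sections E" and U: "(U, e) \<in> frames E"
  obtain c where c: "\<And>I. I \<subseteq> {..<fibre_dim E} \<Longrightarrow> smooth_fun_on (charts E) U (c I)"
    "\<And>x. x \<in> U \<Longrightarrow> s x = frame_mv (fibre_dim E) (e x) (\<lambda>I. c I x)"
    using s U by (metis sectionsE)
  have "smooth_fun_on (charts E) U f"
    using f smooth_fun_on_mono[of "charts E" UNIV f U] by (simp add: smooth_funs_def)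
  then show "\<exists>c. (\<forall>I\<subseteq>{..<fibre_dim E}. smooth_fun_on (charts E) U (c I)) \<and>
     (\<forall>x\<in>U. fscale f s x = frame_mv (fibre_dim E) (e x) (\<lambda>I. c I x))"
    using c by (intro exI[of _ "\<lambda>I x. f x * c I x"])
      (auto simp: frame_mv_linear fscale_apply intro: smooth_fun_on_mult)
qed

lemma smooth_funs_const: "(\<lambda>x. c) \<in> smooth_funs C"
  by (simp add: smooth_funs_def smooth_fun_on_const)

lemma smooth_funs_add: "f \<in> smooth_funs C \<Longrightarrow> g \<in> smooth_funs C \<Longrightarrow> (\<lambda>x. f x + g x) \<in> smooth_funs C"
  by (simp add: smooth_funs_def smooth_fun_on_add)

lemma smooth_funs_mult: "f \<in> smooth_funs C \<Longrightarrow> g \<in> smooth_funs C \<Longrightarrow> (\<lambda>x. f x * g x) \<in> smooth_funs C"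
  by (simp add: smooth_funs_def smooth_fun_on_mult)

lemma smooth_funs_diff: "f \<in> smooth_funs C \<Longrightarrow> g \<in> smooth_funs C \<Longrightarrow> (\<lambda>x. f x - g x) \<in> smooth_funs C"
  using smooth_funs_add[OF _ smooth_funs_mult[OF smooth_funs_const[of "-1"]], of f C g] by simp

lemma cscale_fscale: "cscale c X = fscale (\<lambda>x. c) X"
  by (simp add: cscale_def fscale_def)

lemma sections_cscale: "s \<in> sections E \<Longrightarrow> cscale c s \<in> sections E"
  by (simp add: cscale_fscale sections_fscale smooth_funs_const)

lemma sections_uminus: "s \<in> sections E \<Longrightarrow> - s \<in> sections E"
  using sections_cscale[of s E "-1"] by simp

lemma sections_diff: "s \<in> sections E \<Longrightarrow> t \<in> sections E \<Longrightarrow> s - t \<in> sections E"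
  using sections_add[OF _ sections_uminus, of s E t] by simp

lemma sections_zero: "0 \<in> sections E"
  by (rule sectionsI) (auto intro!: exI[of _ "\<lambda>I x. 0"] smooth_fun_on_const simp: frame_mv_linear(3)[simplified])

lemma sections_sum: "(\<And>i. i \<in> A \<Longrightarrow> F i \<in> sections E) \<Longrightarrow> sum F A \<in> sections E"
  by (induction A rule: infinite_finite_induct) (auto intro: sections_add sections_zero)

lemma sections_fweight: "s \<in> sections E \<Longrightarrow> fweight w s \<in> sections E"
proof (rule sectionsI)
  fix U e assume s: "s \<in> sections E" and U: "(U, e) \<in> frames E"
  obtain c where c: "\<And>I. I \<subseteq> {..<fibre_dim E} \<Longrightarrow> smooth_fun_on (charts E) U (c I)"
    "\<And>x. x \<in> U \<Longrightarrow> s x = frame_mv (fibre_dim E) (e x) (\<lambda>I. c I x)"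
    using s U by (metis sectionsE)
  then show "\<exists>c. (\<forall>I\<subseteq>{..<fibre_dim E}. smooth_fun_on (charts E) U (c I)) \<and>
     (\<forall>x\<in>U. fweight w s x = frame_mv (fibre_dim E) (e x) (\<lambda>I. c I x))"
    by (intro exI[of _ "\<lambda>I x. w (card I) * c I x"])
      (auto simp: frame_mv_weight[where w = w] fweight_def intro: smooth_fun_on_mult smooth_fun_on_const)
qed

lemma fsg_fweight: "fsg = fweight (\<lambda>k. (-1) ^ k)"
  by (simp add: fsg_def fweight_def sg_def fun_eq_iff)

lemma deg_part_fweight: "deg_part k = fweight (\<lambda>l. if l = k then 1 else 0)"
  by (auto simp: deg_part_def fweight_def fun_eq_iff)

lemma sections_fwedge: "s \<in> sections E \<Longrightarrow> t \<in> sections E \<Longrightarrow> s \<^bold>\<and> t \<in> sections E"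
proof (rule sectionsI)
  fix U e assume st: "s \<in> sections E" "t \<in> sections E" and U: "(U, e) \<in> frames E"
  obtain c where c: "\<And>I. I \<subseteq> {..<fibre_dim E} \<Longrightarrow> smooth_fun_on (charts E) U (c I)"
    "\<And>x. x \<in> U \<Longrightarrow> s x = frame_mv (fibre_dim E) (e x) (\<lambda>I. c I x)"
    using st U by (metis sectionsE)
  obtain d where d: "\<And>I. I \<subseteq> {..<fibre_dim E} \<Longrightarrow> smooth_fun_on (charts E) U (d I)"
    "\<And>x. x \<in> U \<Longrightarrow> t x = frame_mv (fibre_dim E) (e x) (\<lambda>I. d I x)"
    using st U by (metis sectionsE)
  let ?c = "\<lambda>I x. wedge (\<lambda>I. c I x) (\<lambda>I. d I x) I"
  have "smooth_fun_on (charts E) U (?c I)" if "I \<subseteq> {..<fibre_dim E}" for I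
    unfolding wedge_def
    by (intro smooth_fun_on_sum smooth_fun_on_mult smooth_fun_on_const c d) (use that in auto)
  then show "\<exists>c. (\<forall>I\<subseteq>{..<fibre_dim E}. smooth_fun_on (charts E) U (c I)) \<and>
     (\<forall>x\<in>U. (s \<^bold>\<and> t) x = frame_mv (fibre_dim E) (e x) (\<lambda>I. c I x))"
    using c(2) d(2) by (intro exI[of _ ?c]) (auto simp: fwedge_def frame_mv_wedge)
qed

text \<open>Stated for two bundles with mutually dual frames, since contraction is needed in both
  directions: multivector fields act on forms, and forms on multivector fields.\<close>

lemma sections_contract:
  assumes "X \<in> sections F" "s \<in> sections E" "fibre_dim F = fibre_dim E" "charts F = charts E"
    and dual: "\<And>U e. (U, e) \<in> frames E \<Longrightarrow> \<exists>\<epsilon>. (U, \<epsilon>) \<in> frames F \<and> (\<forall>x\<in>U. dual_vectors (fibre_dim E) (e x) (\<epsilon> x))"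
  shows "ins E X s \<in> sections E"
proof (rule sectionsI)
  fix U e assume U: "(U, e) \<in> frames E"
  obtain \<epsilon> where e: "(U, \<epsilon>) \<in> frames F" "\<forall>x\<in>U. dual_vectors (fibre_dim E) (e x) (\<epsilon> x)"
    using dual[OF U] by auto
  obtain c where c: "\<And>I. I \<subseteq> {..<fibre_dim E} \<Longrightarrow> smooth_fun_on (charts E) U (c I)"
    "\<And>x. x \<in> U \<Longrightarrow> s x = frame_mv (fibre_dim E) (e x) (\<lambda>I. c I x)"
    using assms U by (metis sectionsE)
  obtain d where d: "\<And>I. I \<subseteq> {..<fibre_dim F} \<Longrightarrow> smooth_fun_on (charts F) U (d I)"
    "\<And>x. x \<in> U \<Longrightarrow> X x = frame_mv (fibre_dim F) (\<epsilon> x) (\<lambda>I. d I x)"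
    using assms(1) e by (metis sectionsE)
  let ?c = "\<lambda>I x. contract (fibre_dim E) (\<lambda>I. d I x) (\<lambda>I. c I x) I"
  have "smooth_fun_on (charts E) U (?c I)" if "I \<subseteq> {..<fibre_dim E}" for I
    unfolding contract_def
    by (intro smooth_fun_on_sum smooth_fun_on_mult smooth_fun_on_const c d(1)[unfolded assms(3,4)])
      (use that in auto)
  then show "\<exists>c. (\<forall>I\<subseteq>{..<fibre_dim E}. smooth_fun_on (charts E) U (c I)) \<and>
     (\<forall>x\<in>U. ins E X s x = frame_mv (fibre_dim E) (e x) (\<lambda>I. c I x))"
    using c(2) d(2) e(2) by (intro exI[of _ ?c]) (auto simp: ins_def frame_mv_contract assms(3))
qed

lemma sections_ins_dual:
  assumes "vector_bundle E" "X \<in> sections (dual_bundle E)" "s \<in> sections E"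
  shows "ins E X s \<in> sections E"
  by (rule sections_contract[OF assms(2,3)]) (simp_all, metis vector_bundle_dual_frame[OF assms(1)])

lemma sections_ins:
  assumes "vector_bundle E" "X \<in> sections E" "s \<in> sections (dual_bundle E)"
  shows "ins E X s \<in> sections (dual_bundle E)"
  using sections_contract[OF assms(2,3)] by (force simp: dual_bundle_frames intro: dual_vectors_sym)

lemma sections_fun_field: "f \<in> smooth_funs (charts E) \<Longrightarrow> fun_field f \<in> sections E"
proof (rule sectionsI)
  fix U e assume f: "f \<in> smooth_funs (charts E)"
  have "smooth_fun_on (charts E) U f"
    using f smooth_fun_on_mono[of "charts E" UNIV f U] by (simp add: smooth_funs_def)
  then have "smooth_fun_on (charts E) U (\<lambda>x. scalar_mv (f x) I)" for I
    by (cases "I = {}") (simp_all add: scalar_mv_def)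
  then show "\<exists>c. (\<forall>I\<subseteq>{..<fibre_dim E}. smooth_fun_on (charts E) U (c I)) \<and>
     (\<forall>x\<in>U. fun_field f x = frame_mv (fibre_dim E) (e x) (\<lambda>I. c I x))"
    by (intro exI[of _ "\<lambda>I x. scalar_mv (f x) I"]) (simp add: fun_field_def frame_mv_scalar)
qed

lemma sections_at_empty:
  assumes "vector_bundle E" "s \<in> sections E"
  shows "(\<lambda>x. s x {}) \<in> smooth_funs (charts E)"
proof -
  have "\<exists>W. open W \<and> x \<in> W \<and> smooth_fun_on (charts E) W (\<lambda>x. s x {})" for x
  proof -
    obtain U e \<epsilon> where U: "x \<in> U" "(U, e) \<in> frames E" "open U" using vector_bundle_frame[OF assms(1)] by metis
    then obtain c where c: "\<And>I. I \<subseteq> {..<fibre_dim E} \<Longrightarrow> smooth_fun_on (charts E) U (c I)"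
      "\<And>x. x \<in> U \<Longrightarrow> s x = frame_mv (fibre_dim E) (e x) (\<lambda>I. c I x)"
      using assms(2) by (metis sectionsE)
    have "smooth_fun_on (charts E) U (\<lambda>x. s x {})"
      by (rule smooth_fun_on_cong[OF vector_bundle_atlas[OF assms(1)] U(3) _ c(1)[of "{}"]])
        (auto simp: c(2) frame_mv_at_empty)
    then show ?thesis using U by blast
  qed
  then show ?thesis unfolding smooth_funs_def
    by (auto intro: smooth_fun_on_local[OF vector_bundle_atlas[OF assms(1)]])
qed

text \<open>The coefficients in a frame, obtained by contraction with the dual frame, depend only on
  the value of \<open>s\<close> at the point; near each point they are those of a section, hence
  smooth.\<close>

lemma sections_glue:
  assumes E: "vector_bundle E"
    and loc: "\<And>x. \<exists>W t. open W \<and> x \<in> W \<and> t \<in> sections E \<and> (\<forall>y\<in>W. s y = t y)"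
  shows "s \<in> sections E"
proof (rule sectionsI)
  fix U e assume U: "(U, e) \<in> frames E"
  let ?r = "fibre_dim E"
  obtain \<epsilon> where e: "\<And>x. x \<in> U \<Longrightarrow> dual_vectors ?r (e x) (\<epsilon> x)"
    using vector_bundle_dual_frame[OF E U] by metis
  define c where "c I x = contract ?r (frame_wedge ?r (\<epsilon> x) I) (s x) {}" for I x
  have *: "\<exists>W. open W \<and> x \<in> W \<and> (\<forall>I\<subseteq>{..<?r}. smooth_fun_on (charts E) W (c I)) \<and>
      s x = frame_mv ?r (e x) (\<lambda>I. c I x)" if x: "x \<in> U" for x
  proof -
    obtain W t where W: "open W" "x \<in> W" "t \<in> sections E" "\<forall>y\<in>W. s y = t y" using loc by blast
    obtain d where d: "\<And>I. I \<subseteq> {..<?r} \<Longrightarrow> smooth_fun_on (charts E) U (d I)"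
      "\<And>x. x \<in> U \<Longrightarrow> t x = frame_mv ?r (e x) (\<lambda>I. d I x)"
      using W U by (metis sectionsE)
    have eq: "c I y = d I y" if "I \<subseteq> {..<?r}" "y \<in> U \<inter> W" for I y
      using that W(4) contract_frame_mv_basis[OF e that(1), of y] by (simp add: c_def d(2))
    have "smooth_fun_on (charts E) (U \<inter> W) (c I)" if "I \<subseteq> {..<?r}" for I
      by (rule smooth_fun_on_cong[OF vector_bundle_atlas[OF E] _ _ smooth_fun_on_mono[OF d(1)[OF that]]])
        (use eq that W(1) vector_bundle_frame_open[OF E U] in auto)
    moreover have "s x = frame_mv ?r (e x) (\<lambda>I. c I x)"
      using W x eq[of _ x] by (auto simp: d(2) frame_mv_def intro!: sum.cong)
    ultimately show ?thesis
      using W x vector_bundle_frame_open[OF E U] by (intro exI[of _ "U \<inter> W"]) auto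
  qed
  show "\<exists>c. (\<forall>I\<subseteq>{..<?r}. smooth_fun_on (charts E) U (c I)) \<and>
     (\<forall>x\<in>U. s x = frame_mv ?r (e x) (\<lambda>I. c I x))"
  proof (intro exI[of _ c] conjI allI impI ballI)
    fix I assume "I \<subseteq> {..<?r}"
    then show "smooth_fun_on (charts E) U (c I)"
      using * by (intro smooth_fun_on_local[OF vector_bundle_atlas[OF E]]) blast
  qed (use * in blast)
qed


subsection \<open>Sections of a given degree\<close>

lemma sections_deg_sections: "s \<in> sections_deg E k \<Longrightarrow> s \<in> sections E"
  by (simp add: sections_deg_def)

lemma sections_deg_linear:
  "s \<in> sections_deg E k \<Longrightarrow> t \<in> sections_deg E k \<Longrightarrow> s + t \<in> sections_deg E k"
  "s \<in> sections_deg E k \<Longrightarrow> t \<in> sections_deg E k \<Longrightarrow> s - t \<in> sections_deg E k"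
  "s \<in> sections_deg E k \<Longrightarrow> - s \<in> sections_deg E k"
  "s \<in> sections_deg E k \<Longrightarrow> cscale c s \<in> sections_deg E k"
  "s \<in> sections_deg E k \<Longrightarrow> f \<in> smooth_funs (charts E) \<Longrightarrow> fscale f s \<in> sections_deg E k"
  "0 \<in> sections_deg E k"
proof -
  show "s \<in> sections_deg E k \<Longrightarrow> t \<in> sections_deg E k \<Longrightarrow> s + t \<in> sections_deg E k"
    by (auto simp: sections_deg_def sections_add) (metis add_0)
  show "s \<in> sections_deg E k \<Longrightarrow> t \<in> sections_deg E k \<Longrightarrow> s - t \<in> sections_deg E k"
    by (auto simp: sections_deg_def sections_diff) (metis diff_0_right)
qed (auto simp: sections_deg_def sections_uminus sections_cscale sections_fscale sections_zero
    cscale_apply fscale_apply smv_apply)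

lemma sections_deg_sum: "(\<And>i. i \<in> A \<Longrightarrow> F i \<in> sections_deg E k) \<Longrightarrow> sum F A \<in> sections_deg E k"
  by (induction A rule: infinite_finite_induct) (auto intro: sections_deg_linear)

lemma fwedge_sections_deg:
  assumes "s \<in> sections_deg E k" "t \<in> sections_deg E l"
  shows "s \<^bold>\<and> t \<in> sections_deg E (k + l)"
proof -
  have "int (card K) = k + l" if nz: "(s \<^bold>\<and> t) x K \<noteq> 0" for x K
  proof -
    obtain I where "finite K" "I \<subseteq> K" "s x I \<noteq> 0" "t x (K - I) \<noteq> 0"
      using nz unfolding fwedge_def by (rule wedge_nonzero)
    then show ?thesis using assms by (auto simp: sections_deg_def card_split)
  qed
  then show ?thesis using assms by (simp add: sections_deg_def sections_fwedge)
qed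

lemma ins_degree:
  assumes "\<And>I. X x I \<noteq> 0 \<Longrightarrow> int (card I) = k" "\<And>I. s x I \<noteq> 0 \<Longrightarrow> int (card I) = l"
    "s x \<in> mv_space (fibre_dim E)" "ins E X s x K \<noteq> 0"
  shows "int (card K) = l - k"
proof -
  obtain I where I: "I \<subseteq> {..<fibre_dim E} - K" "X x I \<noteq> 0" "s x (I \<union> K) \<noteq> 0"
    using assms(4) unfolding ins_def by (rule contract_nonzero)
  then have "I \<union> K \<subseteq> {..<fibre_dim E}" using assms(3) by (auto simp: mv_space_def)
  then have "finite I" "finite K" by (auto intro: finite_subset)
  then have "card (I \<union> K) = card I + card K" using I by (intro card_Un_disjoint) auto
  then show ?thesis using assms(1)[OF I(2)] assms(2)[OF I(3)] by simp
qed

lemma ins_dual_sections_deg: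
  assumes "vector_bundle E" "X \<in> sections_deg (dual_bundle E) k" "s \<in> sections_deg E l"
  shows "ins E X s \<in> sections_deg E (l - k)"
proof -
  have "int (card K) = l - k" if "ins E X s x K \<noteq> 0" for x K
    by (rule ins_degree[OF _ _ _ that])
      (use assms sections_mv_space[OF assms(1)] in \<open>auto simp: sections_deg_def\<close>)
  then show ?thesis using assms sections_ins_dual by (auto simp: sections_deg_def)
qed

lemma ins_sections_deg:
  assumes "vector_bundle E" "X \<in> sections_deg E k" "s \<in> sections_deg (dual_bundle E) l"
  shows "ins E X s \<in> sections_deg (dual_bundle E) (l - k)"
proof -
  have "int (card K) = l - k" if "ins E X s x K \<noteq> 0" for x K
    by (rule ins_degree[OF _ _ _ that])
      (use assms sections_mv_space[OF vector_bundle_dual[OF assms(1)]] in \<open>auto simp: sections_deg_def\<close>)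
  then show ?thesis using assms sections_ins by (auto simp: sections_deg_def)
qed

lemma sections_deg_neg: "k < 0 \<Longrightarrow> s \<in> sections_deg E k \<Longrightarrow> s = 0"
  by (auto simp: sections_deg_def fun_eq_iff)

lemma sections_deg_ge:
  assumes "vector_bundle E" "s \<in> sections_deg E k" "k > int (fibre_dim E)"
  shows "s = 0"
proof (rule ccontr)
  assume "s \<noteq> 0"
  then obtain x I where "s x I \<noteq> 0" by (auto simp: fun_eq_iff)
  then have "int (card I) = k" "I \<subseteq> {..<fibre_dim E}"
    using assms sections_mv_space[OF assms(1), of s x] by (auto simp: sections_deg_def mv_space_def)
  then show False using card_mono[of "{..<fibre_dim E}" I] assms(3) by simp
qed

lemma sections_deg_mv_deg: "s \<in> sections_deg E (int k) \<Longrightarrow> mv_deg k (s x)"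
  by (auto simp: sections_deg_def mv_deg_def)

lemma sections_deg_vector:
  assumes "vector_bundle E" "s \<in> sections_deg E 1"
  shows "s x = vector_mv (fibre_dim E) (\<lambda>i. s x {i})"
  using assms sections_mv_space sections_deg_mv_deg[of s E 1] by (intro vector_mv_surj) (auto simp: sections_deg_def)

lemma deg_part_sections: "s \<in> sections E \<Longrightarrow> deg_part k s \<in> sections_deg E (int k)"
  by (auto simp: sections_deg_def deg_part_fweight sections_fweight) (auto simp: fweight_def split: if_splits)

lemma fun_field_sections_deg: "f \<in> smooth_funs (charts E) \<Longrightarrow> fun_field f \<in> sections_deg E 0"
  by (auto simp: sections_deg_def sections_fun_field) (auto simp: fun_field_def scalar_mv_def split: if_splits)

lemma sections_deg_0:
  assumes "vector_bundle E" "s \<in> sections_deg E 0"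
  shows "s = fun_field (\<lambda>x. s x {})"
proof (intro ext)
  fix x I
  show "s x I = fun_field (\<lambda>x. s x {}) x I"
  proof (cases "s x I = 0")
    case False
    then have "card I = 0" "finite I"
      using assms sections_mv_space[OF assms(1), of s x] finite_subset[of I "{..<fibre_dim E}"]
      by (auto simp: sections_deg_def mv_space_def)
    then show ?thesis by (simp add: fun_field_def scalar_mv_def)
  qed (auto simp: fun_field_def scalar_mv_def)
qed

lemma sum_deg_part:
  assumes "vector_bundle E" "s \<in> sections E"
  shows "(\<Sum>k\<le>fibre_dim E. cscale (w k) (deg_part k s)) = fweight w s"
proof (intro ext)
  fix x I
  have "(\<Sum>k\<le>fibre_dim E. cscale (w k) (deg_part k s)) x I =
      (\<Sum>k\<le>fibre_dim E. if k = card I then w (card I) * s x I else 0)"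
    unfolding sum_fun_apply by (rule sum.cong) (auto simp: cscale_def deg_part_def)
  also have "\<dots> = w (card I) * s x I"
  proof (cases "s x I = 0")
    case False
    then have "I \<subseteq> {..<fibre_dim E}" using sections_mv_space[OF assms, of x] by (auto simp: mv_space_def)
    then have "card I \<in> {..fibre_dim E}" using card_mono[of "{..<fibre_dim E}" I] by simp
    then show ?thesis by (simp only: sum.delta finite_atMost if_True)
  qed (simp add: sum.neutral)
  finally show "(\<Sum>k\<le>fibre_dim E. cscale (w k) (deg_part k s)) x I = fweight w s x I"
    by (simp add: fweight_def)
qed

lemma fun_field_wedge:
  assumes "vector_bundle E" "s \<in> sections E"
  shows "fun_field f \<^bold>\<and> s = fscale f s"
  using wedge_scalar_left[OF sections_mv_space[OF assms]]
  by (auto simp: fwedge_def fun_field_def fscale_apply)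

lemma fwedge_swap:
  assumes "s \<in> sections_deg E (int k)" "t \<in> sections_deg E (int l)"
  shows "s \<^bold>\<and> t = cscale ((-1) ^ (k * l)) (t \<^bold>\<and> s)"
  using wedge_sign_swap[OF sections_deg_mv_deg[OF assms(1)] sections_deg_mv_deg[OF assms(2)]]
  by (auto simp: fwedge_def cscale_apply)

lemma ins_wedge:
  assumes "vector_bundle E" "m \<in> sections E \<or> m \<in> sections (dual_bundle E)"
  shows "ins E (X \<^bold>\<and> Y) m = ins E Y (ins E X m)"
proof -
  have "m x \<in> mv_space (fibre_dim E)" for x
    using assms sections_mv_space[OF assms(1)] sections_mv_space[OF vector_bundle_dual[OF assms(1)]] by auto
  then show ?thesis by (simp add: ins_def fwedge_def contract_wedge_mv)
qed

lemma ins_derivation: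
  assumes "vector_bundle E" "X \<in> sections_deg E 1 \<or> X \<in> sections_deg (dual_bundle E) 1"
  shows "ins E X (s \<^bold>\<and> t) = ins E X s \<^bold>\<and> t + fsg s \<^bold>\<and> ins E X t"
proof (rule field_eqI)
  fix x
  have "\<exists>v. X x = vector_mv (fibre_dim E) v"
    using assms(2) sections_deg_vector[OF assms(1)] sections_deg_vector[OF vector_bundle_dual[OF assms(1)]]
    unfolding dual_bundle_simps by blast
  then show "ins E X (s \<^bold>\<and> t) x = (ins E X s \<^bold>\<and> t + fsg s \<^bold>\<and> ins E X t) x"
    by (auto simp: ins_def fwedge_def fsg_def contract_vector_wedge)
qed

subsection \<open>Local frames of global sections\<close>

text \<open>In another frame the coefficients are \<open>h\<close> times entries of the transition
  matrix on the overlap, and 0 outside \<open>U\<close>. Near points outside \<open>U\<close> they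
  vanish because the complement of \<open>K\<close> is open.\<close>

lemma cutoff_frame_section:
  assumes E: "vector_bundle E" and U: "(U, e) \<in> frames E" and i: "i < fibre_dim E"
    and h: "h \<in> smooth_funs (charts E)" and K: "closed K" "K \<subseteq> U" "\<And>y. y \<notin> K \<Longrightarrow> h y = 0"
  shows "(\<lambda>x. if x \<in> U then h x *m vector_mv (fibre_dim E) (e x i) else 0) \<in> sections_deg E 1"
proof -
  let ?r = "fibre_dim E" and ?C = "charts E"
  let ?G = "\<lambda>x. if x \<in> U then h x *m vector_mv ?r (e x i) else 0"
  note C = vector_bundle_atlas[OF E]
  have "?G \<in> sections E"
  proof (rule sectionsI)
    fix U' e' assume U': "(U', e') \<in> frames E"
    obtain T where T: "\<And>j k. j < ?r \<Longrightarrow> k < ?r \<Longrightarrow> smooth_fun_on ?C (U' \<inter> U) (T j k)"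
      "\<And>x k l. x \<in> U' \<inter> U \<Longrightarrow> k < ?r \<Longrightarrow> l < ?r \<Longrightarrow> e x k l = (\<Sum>j<?r. T j k x * e' x j l)"
      using vector_bundle_transition[OF E U' U] by blast
    define c where "c j x = (if x \<in> U then h x * T j i x else 0)" for j x
    have sm: "smooth_fun_on ?C U' (c j)" if j: "j < ?r" for j
    proof (rule smooth_fun_on_local[OF C])
      fix x assume x: "x \<in> U'"
      show "\<exists>W. open W \<and> x \<in> W \<and> smooth_fun_on ?C W (c j)"
      proof (cases "x \<in> U")
        case True
        have "smooth_fun_on ?C (U' \<inter> U) h"
          using h smooth_fun_on_mono[of ?C UNIV h "U' \<inter> U"] by (simp add: smooth_funs_def)
        then have "smooth_fun_on ?C (U' \<inter> U) (\<lambda>x. h x * T j i x)"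
          using T(1)[OF j i] by (rule smooth_fun_on_mult)
        then have "smooth_fun_on ?C (U' \<inter> U) (c j)"
          by (rule smooth_fun_on_cong[OF C, rotated 2])
            (use vector_bundle_frame_open[OF E U] vector_bundle_frame_open[OF E U'] in \<open>auto simp: c_def\<close>)
        then show ?thesis using True x vector_bundle_frame_open[OF E U] vector_bundle_frame_open[OF E U']
          by (intro exI[of _ "U' \<inter> U"]) auto
      next
        case False
        then have "x \<in> - K" using K by auto
        moreover have "smooth_fun_on ?C (- K) (c j)"
          by (rule smooth_fun_on_cong[OF C _ _ smooth_fun_on_const[of _ _ 0]]) (use K in \<open>auto simp: c_def\<close>)
        ultimately show ?thesis using K by blast
      qed
    qed
    have "?G x = frame_mv ?r (e' x) (vector_mv ?r (\<lambda>j. c j x))" if "x \<in> U'" for x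
    proof (cases "x \<in> U")
      case True
      then show ?thesis unfolding frame_mv_vector using that i
        by (auto simp: c_def T(2) fun_eq_iff smv_apply vector_mv_def sum_distrib_left mult_ac)
    next
      case False
      then show ?thesis unfolding frame_mv_vector by (auto simp: c_def vector_mv_def)
    qed
    moreover have "smooth_fun_on ?C U' (\<lambda>x. vector_mv ?r (\<lambda>j. c j x) I)" for I
    proof (cases "\<exists>i<?r. I = {i}")
      case True
      then show ?thesis using sm by auto
    next
      case False
      then have "vector_mv ?r (\<lambda>j. c j x) I = 0" for x by (auto simp: vector_mv_def)
      then show ?thesis by simp
    qed
    ultimately show "\<exists>c. (\<forall>I\<subseteq>{..<?r}. smooth_fun_on ?C U' (c I)) \<and>
        (\<forall>x\<in>U'. ?G x = frame_mv ?r (e' x) (\<lambda>I. c I x))"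
      by (intro exI[of _ "\<lambda>I x. vector_mv ?r (\<lambda>j. c j x) I"]) auto
  qed
  then show ?thesis
    using vector_mv_deg by (auto simp: sections_deg_def smv_apply mv_deg_def split: if_splits)
qed

text \<open>The cutoff enters once with the frame and once with the dual frame, hence the square of
  \<open>h\<close> in the Euler identity.\<close>

lemma euler_cutoff:
  assumes U: "(U, e) \<in> frames E"
    and \<epsilon>: "\<And>x. x \<in> U \<Longrightarrow> dual_vectors (fibre_dim E) (e x) (\<epsilon> x)"
    and s: "s \<in> sections E" and h: "\<And>x. x \<notin> U \<Longrightarrow> h x = 0"
  shows "(\<Sum>i<fibre_dim E. (\<lambda>x. if x \<in> U then h x *m vector_mv (fibre_dim E) (e x i) else 0) \<^bold>\<and>
      ins E (\<lambda>x. if x \<in> U then h x *m vector_mv (fibre_dim E) (\<epsilon> x i) else 0) s) =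
    fscale (\<lambda>x. h x * h x) (fweight real s)"
proof (rule field_eqI)
  fix x
  let ?r = "fibre_dim E"
  show "(\<Sum>i<?r. (\<lambda>x. if x \<in> U then h x *m vector_mv ?r (e x i) else 0) \<^bold>\<and>
      ins E (\<lambda>x. if x \<in> U then h x *m vector_mv ?r (\<epsilon> x i) else 0) s) x =
    fscale (\<lambda>x. h x * h x) (fweight real s) x"
  proof (cases "x \<in> U")
    case False
    then show ?thesis by (simp add: sum_fun_apply fwedge_def ins_def fscale_apply h)
  next
    case True
    obtain c where c: "s x = frame_mv ?r (e x) (\<lambda>I. c I x)"
      using s U True by (metis sectionsE)
    have "(\<Sum>i<?r. wedge (vector_mv ?r (e x i)) (contract ?r (vector_mv ?r (\<epsilon> x i)) (s x))) =
        fweight real s x"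
      unfolding fweight_def c frame_mv_euler[OF \<epsilon>[OF True]] by (rule frame_mv_weight)
    then show ?thesis using True
      by (simp add: sum_fun_apply fwedge_def ins_def fscale_apply mult_ac flip: smv_distribs(4))
  qed
qed

lemma fweight_sections_deg: "s \<in> sections_deg E (int k) \<Longrightarrow> fweight w s = cscale (w k) s"
  by (intro ext, rename_tac x I, case_tac "s x I = 0") (auto simp: fweight_def cscale_def sections_deg_def)

lemma local_frame:
  fixes E :: "('p::{t2_space,second_countable_topology}, 'b::real_inner) vbundle"
  assumes E: "vector_bundle E"
  obtains h W G \<gamma> where "h \<in> smooth_funs (charts E)" "open W" "x0 \<in> W" "\<And>y. y \<in> W \<Longrightarrow> h y = 1"
    "\<And>i. i < fibre_dim E \<Longrightarrow> G i \<in> sections_deg E 1"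
    "\<And>i. i < fibre_dim E \<Longrightarrow> \<gamma> i \<in> sections_deg (dual_bundle E) 1"
    "\<And>s. s \<in> sections E \<Longrightarrow>
      (\<Sum>i<fibre_dim E. G i \<^bold>\<and> ins E (\<gamma> i) s) = fscale (\<lambda>x. h x * h x) (fweight real s)"
    "\<And>s. s \<in> sections (dual_bundle E) \<Longrightarrow>
      (\<Sum>i<fibre_dim E. \<gamma> i \<^bold>\<and> ins E (G i) s) = fscale (\<lambda>x. h x * h x) (fweight real s)"
proof -
  let ?r = "fibre_dim E"
  obtain U e \<epsilon> where U: "x0 \<in> U" "(U, e) \<in> frames E" "(U, \<epsilon>) \<in> frames (dual_bundle E)" "open U"
    "\<And>x. x \<in> U \<Longrightarrow> dual_vectors ?r (e x) (\<epsilon> x)"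
    using vector_bundle_frame[OF E, of x0] by metis
  obtain h W K where h: "h \<in> smooth_funs (charts E)" "open W" "x0 \<in> W" "\<And>y. y \<in> W \<Longrightarrow> h y = 1"
    "closed K" "K \<subseteq> U" "\<And>y. y \<notin> K \<Longrightarrow> h y = 0"
    using bump_function[OF vector_bundle_atlas[OF E] U(4) U(1)] by metis
  have h0: "x \<notin> U \<Longrightarrow> h x = 0" for x using h by blast
  let ?G = "\<lambda>e i x. if x \<in> U then h x *m vector_mv ?r (e x i) else 0"
  show ?thesis
  proof (rule that[of h W "?G e" "?G \<epsilon>"])
    show "?G e i \<in> sections_deg E 1" if "i < ?r" for i
      by (rule cutoff_frame_section[OF E U(2) that h(1,5-7)])
    show "?G \<epsilon> i \<in> sections_deg (dual_bundle E) 1" if "i < ?r" for i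
      using cutoff_frame_section[OF vector_bundle_dual[OF E] U(3), of i h K, unfolded dual_bundle_simps]
        that h by blast
    show "(\<Sum>i<?r. ?G e i \<^bold>\<and> ins E (?G \<epsilon> i) s) = fscale (\<lambda>x. h x * h x) (fweight real s)"
      if "s \<in> sections E" for s
      by (rule euler_cutoff[OF U(2) U(5) that h0])
    show "(\<Sum>i<?r. ?G \<epsilon> i \<^bold>\<and> ins E (?G e i) s) = fscale (\<lambda>x. h x * h x) (fweight real s)"
      if "s \<in> sections (dual_bundle E)" for s
      using euler_cutoff[OF U(3) _ that, of e h, unfolded dual_bundle_simps]
        dual_vectors_sym[OF U(5)] h0 by blast
  qed (use h in auto)
qed

text \<open>With \<open>h\<close> supported in \<open>W\<close> and h x = 1, the product h (f - g)
  is zero, and the Leibniz rule at x turns this into D (f - g) = 0.\<close>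

lemma tangent_local:
  fixes C :: "('p::{t2_space,second_countable_topology} set \<times> ('p \<Rightarrow> 'b::real_inner)) set"
  assumes C: "smooth_atlas C" and D: "D \<in> tangent_space C x"
    and f: "f \<in> smooth_funs C" "g \<in> smooth_funs C" and W: "open W" "x \<in> W" "\<And>y. y \<in> W \<Longrightarrow> f y = g y"
  shows "D f = D g"
proof -
  have add: "D (\<lambda>y. u y + v y) = D u + D v" and scale: "D (\<lambda>y. c * u y) = c * D u"
    and leib: "D (\<lambda>y. u y * v y) = u x * D v + v x * D u"
    if "u \<in> smooth_funs C" "v \<in> smooth_funs C" for u v c
    using D that unfolding tangent_space_def by blast+
  obtain h K where h: "h \<in> smooth_funs C" "h x = 1" "K \<subseteq> W" "\<And>y. y \<notin> K \<Longrightarrow> h y = 0"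
    using bump_function[OF C W(1,2)] by metis
  let ?u = "\<lambda>y. f y + (-1) * g y"
  have u: "?u \<in> smooth_funs C" using f by (intro smooth_funs_add smooth_funs_mult smooth_funs_const)
  have "h y * ?u y = 0 * h y" for y using h W(3) by (cases "y \<in> K") auto
  then have "D (\<lambda>y. h y * ?u y) = 0 * D h"
    using scale[OF h(1) h(1), of 0] by (simp only:)
  moreover have "D (\<lambda>y. h y * ?u y) = D ?u"
    using leib[OF h(1) u] h(2) W(2,3) by simp
  ultimately have "D ?u = 0" by simp
  moreover have "D ?u = D f + (-1) * D g"
    using add[OF f(1) smooth_funs_mult[OF smooth_funs_const f(2)], of "-1"] scale[OF f(2) f(2), of "-1"] by simp
  ultimately show ?thesis by simp
qed

lemma tangent_const:
  assumes D: "D \<in> tangent_space C x"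
  shows "D (\<lambda>_. c) = 0"
proof -
  let ?one = "\<lambda>_. 1::real"
  have s: "?one \<in> smooth_funs C" by (rule smooth_funs_const)
  have "\<forall>f\<in>smooth_funs C. \<forall>g\<in>smooth_funs C. \<forall>c. D (\<lambda>y. c * f y) = c * D f \<and>
      D (\<lambda>y. f y * g y) = f x * D g + g x * D f"
    using D unfolding tangent_space_def by blast
  from this[rule_format, OF s s, of c] show ?thesis by simp
qed

section \<open>The exterior derivative\<close>

lemma form_eval_Nil [simp]: "form_eval E \<omega> [] = (\<lambda>x. \<omega> x {})"
  by (simp add: form_eval_def)

lemma form_eval_Cons [simp]: "form_eval E \<omega> (X # Xs) = form_eval E (ins E X \<omega>) Xs"
  by (simp add: form_eval_def)

lemma form_eval_linear [simp]:
  "form_eval E (\<omega> + \<eta>) Xs = form_eval E \<omega> Xs + form_eval E \<eta> Xs"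
  "form_eval E (\<omega> - \<eta>) Xs = form_eval E \<omega> Xs - form_eval E \<eta> Xs"
  "form_eval E (- \<omega>) Xs = - form_eval E \<omega> Xs" "form_eval E 0 Xs = 0"
  "form_eval E (fscale f \<omega>) Xs = f * form_eval E \<omega> Xs"
  "form_eval E (cscale c \<omega>) Xs = (\<lambda>x. c) * form_eval E \<omega> Xs"
  by (induction Xs arbitrary: \<omega> \<eta>)
    (simp_all add: fun_eq_iff fscale_apply cscale_apply smv_apply)

lemma form_eval_sum: "form_eval E (sum F A) Xs = (\<Sum>i\<in>A. form_eval E (F i) Xs)"
  by (induction A rule: infinite_finite_induct)
    (simp_all only: sum.infinite sum.empty sum.insert form_eval_linear not_False_eq_True)

lemma fun_field_linear:
  "fun_field (f + g) = fun_field f + fun_field g" "fun_field (f - g) = fun_field f - fun_field g"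
  "fun_field (f * g) = fscale f (fun_field g)" "fun_field 0 = 0" "fun_field (- f) = - fun_field f"
  by (auto simp: fun_field_def fun_eq_iff scalar_mv_def fscale_def)

lemma fscale_linear:
  "fscale (f + g) X = fscale f X + fscale g X" "fscale (f - g) X = fscale f X - fscale g X"
  "fscale (f * g) X = fscale f (fscale g X)" "fscale 0 X = 0" "fscale (- f) X = - fscale f X"
  by (auto simp: fscale_def fun_eq_iff algebra_simps)

lemma smooth_funs_ring:
  "f \<in> smooth_funs C \<Longrightarrow> g \<in> smooth_funs C \<Longrightarrow> f + g \<in> smooth_funs C"
  "f \<in> smooth_funs C \<Longrightarrow> g \<in> smooth_funs C \<Longrightarrow> f - g \<in> smooth_funs C"
  "f \<in> smooth_funs C \<Longrightarrow> g \<in> smooth_funs C \<Longrightarrow> f * g \<in> smooth_funs C"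
  "0 \<in> smooth_funs C"
  using smooth_funs_add[of f C g] smooth_funs_diff[of f C g] smooth_funs_mult[of f C g]
    smooth_funs_const[of 0 C]
  by (simp_all add: plus_fun_def times_fun_def fun_diff_def)

lemma fun_field_at_empty [simp]: "fun_field f x {} = f x"
  by (simp add: fun_field_def scalar_mv_def)

lemma omit_simps [simp]: "omit 0 (x # xs) = xs" "omit (Suc i) (x # xs) = x # omit i xs"
  by (simp_all add: omit_def)

locale algebroid =
  fixes E :: "('p::{t2_space,second_countable_topology}, 'b::real_inner) vbundle"
    and br :: "'p mvfield \<Rightarrow> 'p mvfield \<Rightarrow> 'p mvfield"
    and \<rho> :: "'p anchor"
  assumes vb: "vector_bundle E" and la: "lie_algebroid E br \<rho>"
begin

abbreviation "S1 \<equiv> sections_deg E 1"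
abbreviation "Om \<equiv> sections (dual_bundle E)"
abbreviation "Cinf \<equiv> smooth_funs (charts E)"
abbreviation "ev \<equiv> form_eval E"
abbreviation "ii \<equiv> ins E"

lemmas vbd = vector_bundle_dual[OF vb]

lemmas S1_sections = sections_deg_sections[of _ E 1]

lemma Om_closed [simp, intro]:
  "\<omega> \<in> Om \<Longrightarrow> \<eta> \<in> Om \<Longrightarrow> \<omega> + \<eta> \<in> Om" "\<omega> \<in> Om \<Longrightarrow> \<eta> \<in> Om \<Longrightarrow> \<omega> - \<eta> \<in> Om"
  "\<omega> \<in> Om \<Longrightarrow> - \<omega> \<in> Om" "0 \<in> Om" "\<omega> \<in> Om \<Longrightarrow> cscale c \<omega> \<in> Om"
  "\<omega> \<in> Om \<Longrightarrow> f \<in> Cinf \<Longrightarrow> fscale f \<omega> \<in> Om" "\<omega> \<in> Om \<Longrightarrow> \<eta> \<in> Om \<Longrightarrow> \<omega> \<^bold>\<and> \<eta> \<in> Om"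
  "\<omega> \<in> Om \<Longrightarrow> fsg \<omega> \<in> Om" "f \<in> Cinf \<Longrightarrow> fun_field f \<in> Om" "\<omega> \<in> Om \<Longrightarrow> fweight w \<omega> \<in> Om"
  "X \<in> sections E \<Longrightarrow> \<omega> \<in> Om \<Longrightarrow> ii X \<omega> \<in> Om" "X \<in> S1 \<Longrightarrow> \<omega> \<in> Om \<Longrightarrow> ii X \<omega> \<in> Om"
  by (auto intro: sections_add sections_diff sections_uminus sections_zero sections_cscale sections_fscale
      sections_fwedge sections_fweight sections_fun_field sections_ins[OF vb] S1_sections simp: fsg_fweight)

lemma S1_closed [simp, intro]:
  "X \<in> S1 \<Longrightarrow> Y \<in> S1 \<Longrightarrow> X + Y \<in> S1" "X \<in> S1 \<Longrightarrow> Y \<in> S1 \<Longrightarrow> X - Y \<in> S1"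
  "X \<in> S1 \<Longrightarrow> - X \<in> S1" "0 \<in> S1" "X \<in> S1 \<Longrightarrow> cscale c X \<in> S1" "f \<in> Cinf \<Longrightarrow> X \<in> S1 \<Longrightarrow> fscale f X \<in> S1"
  by (auto intro: sections_deg_linear)

lemma Cinf_closed [simp, intro]:
  "f \<in> Cinf \<Longrightarrow> g \<in> Cinf \<Longrightarrow> f + g \<in> Cinf" "f \<in> Cinf \<Longrightarrow> g \<in> Cinf \<Longrightarrow> f - g \<in> Cinf"
  "f \<in> Cinf \<Longrightarrow> g \<in> Cinf \<Longrightarrow> f * g \<in> Cinf" "0 \<in> Cinf" "(\<lambda>x. c) \<in> Cinf"
  "\<omega> \<in> Om \<Longrightarrow> (\<lambda>x. \<omega> x {}) \<in> Cinf"
  using sections_at_empty[OF vbd] by (auto intro: smooth_funs_ring smooth_funs_const)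

subsection \<open>The anchor and the bracket\<close>

definition act :: "'p mvfield \<Rightarrow> ('p \<Rightarrow> real) \<Rightarrow> 'p \<Rightarrow> real" where
  "act X f = (\<lambda>x. \<rho> x (X x) f)"

lemma anchor: "anchor_map E \<rho>"
  using la by (simp add: lie_algebroid_def)

lemma S1_range: "X \<in> S1 \<Longrightarrow> X x \<in> range (vector_mv (fibre_dim E))"
  using sections_deg_vector[OF vb, of X x] by blast

lemma act_tangent: "X \<in> S1 \<Longrightarrow> \<rho> x (X x) \<in> tangent_space (charts E) x"
  using anchor S1_range[of X x] unfolding anchor_map_def by blast

lemma act_smooth [simp, intro]: "X \<in> S1 \<Longrightarrow> f \<in> Cinf \<Longrightarrow> act X f \<in> Cinf"
  using anchor unfolding anchor_map_def act_def by blast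

lemma act_derivation:
  assumes "X \<in> S1" "f \<in> Cinf" "g \<in> Cinf"
  shows "act X (f + g) = act X f + act X g" "act X (f * g) = f * act X g + g * act X f"
    "act X (f - g) = act X f - act X g"
proof -
  have t: "\<rho> x (X x) (\<lambda>y. u y + v y) = \<rho> x (X x) u + \<rho> x (X x) v \<and>
     \<rho> x (X x) (\<lambda>y. c * u y) = c * \<rho> x (X x) u \<and>
      \<rho> x (X x) (\<lambda>y. u y * v y) = u x * \<rho> x (X x) v + v x * \<rho> x (X x) u"
    if "u \<in> Cinf" "v \<in> Cinf" for u v c x
    using act_tangent[OF assms(1), of x] that unfolding tangent_space_def by blast
  have add: "act X (f + g) = act X f + act X g" if "f \<in> Cinf" "g \<in> Cinf" for f g
    using t[OF that] by (simp add: act_def fun_eq_iff plus_fun_def)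
  from add[OF assms(2,3)] show "act X (f + g) = act X f + act X g" .
  from add[of "f - g" g] show "act X (f - g) = act X f - act X g" using assms by simp
  show "act X (f * g) = f * act X g + g * act X f"
    using t[OF assms(2,3)] by (simp add: act_def fun_eq_iff times_fun_def)
qed

lemma act_const [simp]: "X \<in> S1 \<Longrightarrow> act X (\<lambda>_. c) = 0" "X \<in> S1 \<Longrightarrow> act X 0 = 0"
  using tangent_const[OF act_tangent[of X], of _ c] tangent_const[OF act_tangent[of X], of _ 0]
  by (auto simp: act_def fun_eq_iff)

lemma act_linear:
  assumes "X \<in> S1" "Y \<in> S1" "f \<in> Cinf"
  shows "act (X + Y) f = act X f + act Y f" "act (fscale g X) f = g * act X f"
proof -
  have "\<rho> x (\<lambda>I. X x I + Y x I) f = \<rho> x (X x) f + \<rho> x (Y x) f \<and> \<rho> x (\<lambda>I. c * X x I) f = c * \<rho> x (X x) f" for x c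
    using anchor S1_range[OF assms(1), of x] S1_range[OF assms(2), of x] assms(3)
    unfolding anchor_map_def by blast
  then show "act (X + Y) f = act X f + act Y f" "act (fscale g X) f = g * act X f"
    by (auto simp: act_def fun_eq_iff plus_fun_def fscale_def)
qed

lemma act_zero: "f \<in> Cinf \<Longrightarrow> X x = 0 \<Longrightarrow> X \<in> S1 \<Longrightarrow> act X f x = 0"
proof -
  assume *: "f \<in> Cinf" "X x = 0" "X \<in> S1"
  have "act (fscale 0 X) f x = 0" using act_linear(2)[OF *(3) *(3) *(1), of 0] by simp
  moreover have "fscale 0 X x = X x" using *(2) by (simp add: fscale_apply)
  ultimately show ?thesis by (simp add: act_def)
qed

lemma br_closed [simp, intro]: "X \<in> S1 \<Longrightarrow> Y \<in> S1 \<Longrightarrow> br X Y \<in> S1"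
  using la unfolding lie_algebroid_def by blast

lemma br_skew: "X \<in> S1 \<Longrightarrow> Y \<in> S1 \<Longrightarrow> br X Y = - br Y X"
  using la unfolding lie_algebroid_def by blast

lemma br_add: "X \<in> S1 \<Longrightarrow> Y \<in> S1 \<Longrightarrow> Z \<in> S1 \<Longrightarrow> br X (Y + Z) = br X Y + br X Z"
  using la unfolding lie_algebroid_def by blast

lemma br_jacobi: "X \<in> S1 \<Longrightarrow> Y \<in> S1 \<Longrightarrow> Z \<in> S1 \<Longrightarrow> br X (br Y Z) = br (br X Y) Z + br Y (br X Z)"
  using la unfolding lie_algebroid_def by blast

lemma br_fscale:
  "X \<in> S1 \<Longrightarrow> Y \<in> S1 \<Longrightarrow> f \<in> Cinf \<Longrightarrow> br X (fscale f Y) = fscale f (br X Y) + fscale (act X f) Y"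
  using la unfolding lie_algebroid_def act_def by blast

lemma br_self: "X \<in> S1 \<Longrightarrow> br X X = 0"
proof -
  assume "X \<in> S1"
  then have "br X X x I = - br X X x I" for x I using br_skew[of X X] by (metis uminus_apply)
  then show ?thesis by (auto simp: fun_eq_iff)
qed

lemma br_left:
  assumes "X \<in> S1" "Y \<in> S1" "Z \<in> S1" "f \<in> Cinf"
  shows "br (X + Y) Z = br X Z + br Y Z" "br (fscale f X) Z = fscale f (br X Z) - fscale (act Z f) X"
  using assms br_skew[of "X + Y" Z] br_skew[of X Z] br_skew[of Y Z] br_add[of Z X Y]
    br_skew[of "fscale f X" Z] br_fscale[of Z X f]
  by (auto simp: fscale_distribs)

text \<open>Compare the coefficients of Z in the Jacobi identity for X, Y and f Z, expanded by the
  Leibniz rule. A section Z with Z x \<noteq> 0 isolates them; if there is none, then X, Y and their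
  bracket vanish at x and both sides are 0.\<close>

lemma act_br:
  assumes X: "X \<in> S1" and Y: "Y \<in> S1" and f: "f \<in> Cinf"
  shows "act X (act Y f) - act Y (act X f) = act (br X Y) f"
proof
  fix x
  show "(act X (act Y f) - act Y (act X f)) x = act (br X Y) f x"
  proof (cases "\<exists>Z\<in>S1. Z x \<noteq> 0")
    case False
    then have "X x = 0" "Y x = 0" "br X Y x = 0" using X Y by auto
    then show ?thesis using X Y f by (simp add: act_zero)
  next
    case True
    then obtain Z I where Z: "Z \<in> S1" "Z x I \<noteq> 0" by (auto simp: fun_eq_iff)
    note [simp] = X Y f Z(1)
    have XY: "br X (br Y (fscale f Z)) = fscale f (br X (br Y Z)) + fscale (act X f) (br Y Z)
        + fscale (act Y f) (br X Z) + fscale (act X (act Y f)) Z"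
      by (simp add: br_fscale br_add algebra_simps)
    have YX: "br Y (br X (fscale f Z)) = fscale f (br Y (br X Z)) + fscale (act Y f) (br X Z)
        + fscale (act X f) (br Y Z) + fscale (act Y (act X f)) Z"
      by (simp add: br_fscale br_add algebra_simps)
    have "br (br X Y) (fscale f Z) = fscale f (br (br X Y) Z) + fscale (act (br X Y) f) Z"
      by (simp add: br_fscale)
    then have "fscale (act X (act Y f)) Z = fscale (act (br X Y) f) Z + fscale (act Y (act X f)) Z"
      using br_jacobi[of X Y "fscale f Z"] br_jacobi[of X Y Z]
      by (simp add: XY YX fscale_distribs algebra_simps)
    then have "act X (act Y f) x * Z x I = (act (br X Y) f x + act Y (act X f) x) * Z x I"
      by (auto simp: fscale_def fun_eq_iff distrib_right)
    then have "act X (act Y f) x = act (br X Y) f x + act Y (act X f) x" using Z(2) by simp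
    then show ?thesis by simp
  qed
qed

lemma act_local:
  "X \<in> S1 \<Longrightarrow> f \<in> Cinf \<Longrightarrow> g \<in> Cinf \<Longrightarrow> open W \<Longrightarrow> x \<in> W \<Longrightarrow> (\<And>y. y \<in> W \<Longrightarrow> f y = g y) \<Longrightarrow>
    act X f x = act X g x"
  unfolding act_def by (rule tangent_local[OF vector_bundle_atlas[OF vb] act_tangent])

subsection \<open>Forms are determined by their values\<close>

lemma ins_swap:
  assumes "X \<in> S1" "Y \<in> S1" "\<omega> \<in> Om"
  shows "ii X (ii Y \<omega>) = - ii Y (ii X \<omega>)"
proof -
  have "X \<^bold>\<and> Y = - (Y \<^bold>\<and> X)" using fwedge_swap[of X E 1 Y 1] assms by simp
  then have "ii Y (ii X \<omega>) = - ii X (ii Y \<omega>)"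
    using ins_wedge[OF vb, of \<omega> X Y] ins_wedge[OF vb, of \<omega> Y X] assms(3) by (metis ins_linear(5))
  then show ?thesis by simp
qed

lemma ins_self: "X \<in> S1 \<Longrightarrow> \<omega> \<in> Om \<Longrightarrow> ii X (ii X \<omega>) = 0"
proof -
  assume "X \<in> S1" "\<omega> \<in> Om"
  then have "ii X (ii X \<omega>) x I = - ii X (ii X \<omega>) x I" for x I using ins_swap[of X X \<omega>] by (metis uminus_apply)
  then show ?thesis by (auto simp: fun_eq_iff)
qed

lemma ins_fun_field [simp]: "X \<in> S1 \<Longrightarrow> ii X (fun_field f) = 0"
  by (rule field_eqI, subst ins_def, subst sections_deg_vector[OF vb, of X]) (auto simp: fun_field_def)

lemma ins_sym: "X \<in> S1 \<Longrightarrow> \<mu> \<in> sections_deg (dual_bundle E) 1 \<Longrightarrow> ii X \<mu> = ii \<mu> X"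
  unfolding ins_def
  by (rule field_eqI, subst (1 2) sections_deg_vector[OF vb, of X],
      simp, subst (1 2) sections_deg_vector[OF vbd, of \<mu>], simp)
    (simp add: contract_vector_vector mult.commute)

definition frame_at :: "'p \<Rightarrow> ('p \<Rightarrow> real) \<Rightarrow> 'p set \<Rightarrow> (nat \<Rightarrow> 'p mvfield) \<Rightarrow> (nat \<Rightarrow> 'p mvfield) \<Rightarrow> bool" where
  "frame_at x h W G \<gamma> \<longleftrightarrow> h \<in> Cinf \<and> open W \<and> x \<in> W \<and> (\<forall>y\<in>W. h y = 1) \<and>
    (\<forall>i<fibre_dim E. G i \<in> S1) \<and> (\<forall>i<fibre_dim E. \<gamma> i \<in> sections_deg (dual_bundle E) 1) \<and>
    (\<forall>s\<in>sections E. (\<Sum>i<fibre_dim E. G i \<^bold>\<and> ii (\<gamma> i) s) = fscale (h * h) (fweight real s)) \<and>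
    (\<forall>s\<in>Om. (\<Sum>i<fibre_dim E. \<gamma> i \<^bold>\<and> ii (G i) s) = fscale (h * h) (fweight real s))"

lemma frame_exists:
  obtains h W G \<gamma> where "frame_at x h W G \<gamma>"
proof (rule local_frame[OF vb, of x], rule that)
  show "frame_at x h W G \<gamma>"
    if "h \<in> Cinf" "open W" "x \<in> W" "\<And>y. y \<in> W \<Longrightarrow> h y = 1"
      "\<And>i. i < fibre_dim E \<Longrightarrow> G i \<in> S1"
      "\<And>i. i < fibre_dim E \<Longrightarrow> \<gamma> i \<in> sections_deg (dual_bundle E) 1"
      "\<And>s. s \<in> sections E \<Longrightarrow>
        (\<Sum>i<fibre_dim E. G i \<^bold>\<and> ii (\<gamma> i) s) = fscale (\<lambda>x. h x * h x) (fweight real s)"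
      "\<And>s. s \<in> Om \<Longrightarrow>
        (\<Sum>i<fibre_dim E. \<gamma> i \<^bold>\<and> ii (G i) s) = fscale (\<lambda>x. h x * h x) (fweight real s)"
    for h W G \<gamma>
    unfolding frame_at_def times_fun_def using that by blast
qed

text \<open>By the Euler identity, contractions with sections determine all components of positive
  degree. The component of degree 0 is invisible to them and is assumed to vanish. The argument
  works at the single point \<open>x\<close>, where \<open>h\<close> is 1.\<close>

lemma form_zero_at:
  assumes "\<omega> \<in> Om" "\<And>X. X \<in> S1 \<Longrightarrow> ii X \<omega> x = 0" "\<omega> x {} = 0"
  shows "\<omega> x = 0"
proof
  fix I
  obtain h W G \<gamma> where F: "frame_at x h W G \<gamma>" by (rule frame_exists)
  have "fweight real \<omega> x = (\<Sum>i<fibre_dim E. \<gamma> i \<^bold>\<and> ii (G i) \<omega>) x"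
    using F assms(1) by (simp add: frame_at_def fscale_apply)
  also have "\<dots> = 0"
    using assms(2) F by (simp add: frame_at_def sum_fun_apply fwedge_def)
  finally have "real (card I) * \<omega> x I = 0" by (auto simp: fweight_def fun_eq_iff)
  \<comment> \<open>An infinite \<open>I\<close> also has \<open>card I = 0\<close> and must be
    excluded separately.\<close>
  moreover have "\<omega> x I = 0 \<or> finite I"
    using sections_mv_space[OF vbd assms(1), of x] finite_subset[of I "{..<fibre_dim E}"] by (auto simp: mv_space_def)
  ultimately show "\<omega> x I = 0 I" using assms(3) by auto
qed

lemma form_eqI:
  assumes "\<omega> \<in> Om" "\<eta> \<in> Om" "\<And>Xs. set Xs \<subseteq> S1 \<Longrightarrow> ev \<omega> Xs = ev \<eta> Xs"
  shows "\<omega> = \<eta>"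
proof -
  \<comment> \<open>The induction is over a strict bound on the degrees present at \<open>x\<close>,
    which contraction with a section of degree 1 lowers by one.\<close>
  have *: "\<omega> x = 0" if "\<omega> \<in> Om" "\<And>Xs. set Xs \<subseteq> S1 \<Longrightarrow> ev \<omega> Xs x = 0" "\<And>I. \<omega> x I \<noteq> 0 \<Longrightarrow> card I < n" for \<omega> x n
    using that
  proof (induction n arbitrary: \<omega>)
    case 0
    then show ?case by (auto simp: fun_eq_iff)
  next
    case (Suc n)
    show ?case
    proof (rule form_zero_at[OF Suc.prems(1)])
      fix X assume X: "X \<in> S1"
      show "ii X \<omega> x = 0"
      proof (rule Suc.IH)
        show "ii X \<omega> \<in> Om" using X Suc.prems by auto
        show "ev (ii X \<omega>) Xs x = 0" if "set Xs \<subseteq> S1" for Xs using Suc.prems(2)[of "X # Xs"] that X by simp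
        fix I assume "ii X \<omega> x I \<noteq> 0"
        then obtain J where J: "J \<subseteq> {..<fibre_dim E} - I" "X x J \<noteq> 0" "\<omega> x (J \<union> I) \<noteq> 0"
          unfolding ins_def by (rule contract_nonzero)
        have "J \<union> I \<subseteq> {..<fibre_dim E}"
          using J sections_mv_space[OF vbd Suc.prems(1), of x] by (auto simp: mv_space_def)
        then have "finite J" "finite I" by (auto intro: finite_subset)
        then have "card (J \<union> I) = card J + card I" using J by (intro card_Un_disjoint) auto
        moreover have "card J = 1" using J X by (auto simp: sections_deg_def)
        ultimately show "card I < n" using Suc.prems(3)[OF J(3)] by simp
      qed
    qed (use Suc.prems(2)[of "[]"] in simp)
  qed
  have "(\<omega> - \<eta>) x = 0" for x
  proof (rule *[of "\<omega> - \<eta>" x])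
    fix I assume "(\<omega> - \<eta>) x I \<noteq> 0"
    then have "I \<subseteq> {..<fibre_dim E}"
      using sections_mv_space[OF vbd, of "\<omega> - \<eta>" x] assms by (auto simp: mv_space_def)
    then show "card I < Suc (fibre_dim E)" using card_mono[of "{..<fibre_dim E}" I] by simp
  qed (use assms in auto)
  then show ?thesis by (auto simp: fun_eq_iff)
qed

lemma ev_degree:
  assumes "\<omega> \<in> sections_deg (dual_bundle E) k" "set Xs \<subseteq> S1" "int (length Xs) \<noteq> k"
  shows "ev \<omega> Xs = 0"
  using assms
proof (induction Xs arbitrary: \<omega> k)
  case Nil
  then show ?case by (auto simp: sections_deg_def fun_eq_iff) (metis card.empty of_nat_0)
next
  case (Cons X Xs)
  then show ?case using ins_sections_deg[OF vb, of X 1 \<omega> k] by auto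
qed

lemma form_eqI_deg:
  assumes "\<omega> \<in> sections_deg (dual_bundle E) (int n)" "\<eta> \<in> sections_deg (dual_bundle E) (int n)"
    "\<And>Xs. set Xs \<subseteq> S1 \<Longrightarrow> length Xs = n \<Longrightarrow> ev \<omega> Xs = ev \<eta> Xs"
  shows "\<omega> = \<eta>"
proof (rule form_eqI)
  show "ev \<omega> Xs = ev \<eta> Xs" if "set Xs \<subseteq> S1" for Xs
    using assms that ev_degree[of \<omega> "int n" Xs] ev_degree[of \<eta> "int n" Xs] by (cases "length Xs = n") auto
qed (use assms sections_deg_sections in auto)

lemma ev_deg_part:
  assumes "\<omega> \<in> Om" "set Xs \<subseteq> S1"
  shows "ev (deg_part k \<omega>) Xs = (if length Xs = k then ev \<omega> Xs else 0)"
proof (cases "length Xs = k")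
  case False
  then show ?thesis using ev_degree[OF deg_part_sections[OF assms(1)] assms(2), of k] by simp
next
  case True
  have "fweight (\<lambda>_. 1) \<omega> = \<omega>" by (simp add: fweight_def)
  then have "\<omega> = (\<Sum>j\<le>fibre_dim E. deg_part j \<omega>)"
    using sum_deg_part[OF vbd, of \<omega> "\<lambda>_. 1"] assms(1) by simp
  then have "ev \<omega> Xs = (\<Sum>j\<le>fibre_dim E. ev (deg_part j \<omega>) Xs)" by (metis form_eval_sum)
  also have "\<dots> = (\<Sum>j\<le>fibre_dim E. if j = k then ev (deg_part k \<omega>) Xs else 0)"
    using ev_degree[OF deg_part_sections[OF assms(1)] assms(2)] True by (intro sum.cong) auto
  also have "\<dots> = ev (deg_part k \<omega>) Xs"
  proof (cases "k \<le> fibre_dim E")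
    case False
    then have "deg_part k \<omega> = 0"
      using sections_deg_ge[OF vbd deg_part_sections[OF assms(1)], of k] by simp
    then show ?thesis by simp
  qed (simp add: sum.delta)
  finally show ?thesis using True by simp
qed

lemma sections_degI:
  assumes "\<omega> \<in> Om" "\<And>Xs. set Xs \<subseteq> S1 \<Longrightarrow> int (length Xs) \<noteq> k \<Longrightarrow> ev \<omega> Xs = 0"
  shows "\<omega> \<in> sections_deg (dual_bundle E) k"
proof -
  have "int (card I) = k" if "\<omega> x I \<noteq> 0" for x I
  proof (rule ccontr)
    assume "int (card I) \<noteq> k"
    then have "deg_part (card I) \<omega> = 0"
      using assms by (intro form_eqI) (auto simp: ev_deg_part intro!: sections_deg_sections[OF deg_part_sections])
    then have "deg_part (card I) \<omega> x I = 0" by simp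
    then show False using that by (simp add: deg_part_def)
  qed
  then show ?thesis using assms(1) by (simp add: sections_deg_def)
qed


abbreviation "Omd \<equiv> sections_deg (dual_bundle E)"

subsection \<open>Forms from alternating multilinear maps\<close>

text \<open>Conditions on the first one or two arguments suffice, since the recursion imposes them
  on the later ones too. Peeling off the first argument matches \<open>form_eval\<close>.\<close>

primrec alternating :: "nat \<Rightarrow> ('p mvfield list \<Rightarrow> 'p \<Rightarrow> real) \<Rightarrow> bool" where
  "alternating 0 F \<longleftrightarrow> F [] \<in> Cinf"
| "alternating (Suc n) F \<longleftrightarrow> (\<forall>X\<in>S1. alternating n (\<lambda>Xs. F (X # Xs))) \<and>
     (\<forall>X\<in>S1. \<forall>Y\<in>S1. \<forall>Zs. set Zs \<subseteq> S1 \<longrightarrow> F ((X + Y) # Zs) = F (X # Zs) + F (Y # Zs)) \<and>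
     (\<forall>f\<in>Cinf. \<forall>X\<in>S1. \<forall>Zs. set Zs \<subseteq> S1 \<longrightarrow> F (fscale f X # Zs) = f * F (X # Zs)) \<and>
     (\<forall>X\<in>S1. \<forall>Zs. set Zs \<subseteq> S1 \<longrightarrow> F (X # X # Zs) = 0)"

lemma alternating_diff:
  "alternating n F \<Longrightarrow> alternating n G \<Longrightarrow> alternating n (\<lambda>Xs. F Xs - G Xs)"
  by (induction n arbitrary: F G) (auto simp: algebra_simps)

lemma alternating_ev: "\<omega> \<in> Om \<Longrightarrow> alternating n (ev \<omega>)"
  by (induction n arbitrary: \<omega>) (auto simp: ins_self)

text \<open>The candidate is the sum of the \<gamma>_i \<and> A (G_i), divided by n + 1. Before the
  division, its contraction with X consists of A (h^2 X), from the factors \<gamma>_i, and, by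
  skew-symmetry, of the Euler sum of the n-form A X, which is n h^2 A X.\<close>

lemma form_from_contractions_local:
  assumes A: "\<And>X. X \<in> S1 \<Longrightarrow> A X \<in> Omd (int n)"
    and add: "\<And>X Y. X \<in> S1 \<Longrightarrow> Y \<in> S1 \<Longrightarrow> A (X + Y) = A X + A Y"
    and scale: "\<And>f X. f \<in> Cinf \<Longrightarrow> X \<in> S1 \<Longrightarrow> A (fscale f X) = fscale f (A X)"
    and alt: "\<And>X. X \<in> S1 \<Longrightarrow> ii X (A X) = 0"
    and F: "frame_at x h W G \<gamma>"
  shows "\<exists>t\<in>Omd (int (Suc n)). \<forall>X\<in>S1. ii X t = fscale (h * h) (A X)"
proof -
  let ?r = "fibre_dim E"
  have G: "\<And>i. i < ?r \<Longrightarrow> G i \<in> S1" and \<gamma>: "\<And>i. i < ?r \<Longrightarrow> \<gamma> i \<in> Omd 1" and h: "h \<in> Cinf"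
    and euler: "\<And>s. s \<in> sections E \<Longrightarrow> (\<Sum>i<?r. G i \<^bold>\<and> ii (\<gamma> i) s) = fscale (h * h) (fweight real s)"
      "\<And>s. s \<in> Om \<Longrightarrow> (\<Sum>i<?r. \<gamma> i \<^bold>\<and> ii (G i) s) = fscale (h * h) (fweight real s)"
    using F by (auto simp: frame_at_def)
  have AOm: "A X \<in> Om" if "X \<in> S1" for X using A[OF that] by (rule sections_deg_sections)
  \<comment> \<open>Polarisation of \<open>alt\<close>.\<close>
  have skew: "ii X (A Y) = - ii Y (A X)" if "X \<in> S1" "Y \<in> S1" for X Y
  proof -
    have "0 = ii (X + Y) (A (X + Y))" using alt[of "X + Y"] that by (simp only: S1_closed)
    also have "\<dots> = ii X (A Y) + ii Y (A X)" using alt that by (simp add: add)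
    finally show ?thesis by (simp add: eq_neg_iff_add_eq_0)
  qed
  have A_zero: "A 0 = 0" using scale[of 0 0] by (simp add: fscale_linear)
  have A_sum: "A (\<Sum>i<m. fscale (c i) (G i)) = (\<Sum>i<m. fscale (c i) (A (G i)))"
    if "m \<le> ?r" "\<And>i. i < ?r \<Longrightarrow> c i \<in> Cinf" for m c
    using that(1)
  proof (induction m)
    case (Suc m)
    then have m: "m < ?r" by simp
    have "(\<Sum>i<m. fscale (c i) (G i)) \<in> S1"
      using that m G by (intro sections_deg_sum sections_deg_linear(5)) auto
    then have "A (fscale (c m) (G m) + (\<Sum>i<m. fscale (c i) (G i))) =
        fscale (c m) (A (G m)) + A (\<Sum>i<m. fscale (c i) (G i))"
      using m that(2) G by (simp add: add scale)
    then show ?case using Suc by (simp only: sum.lessThan_Suc add.commute)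
  qed (simp add: A_zero)
  define t where "t = cscale (1 / real (Suc n)) (\<Sum>i<?r. \<gamma> i \<^bold>\<and> A (G i))"
  have deg: "\<gamma> i \<^bold>\<and> A (G i) \<in> Omd (int (Suc n))" if "i < ?r" for i
    using fwedge_sections_deg[OF \<gamma>[OF that] A[OF G[OF that]]] by (simp add: add.commute)
  then have "t \<in> Omd (int (Suc n))"
    unfolding t_def by (intro sections_deg_linear(4) sections_deg_sum) auto
  moreover have "ii X t = fscale (h * h) (A X)" if X: "X \<in> S1" for X
  proof -
    define c where "c i = (\<lambda>x. ii X (\<gamma> i) x {})" for i
    have c: "ii X (\<gamma> i) = fun_field (c i)" "c i \<in> Cinf" if "i < ?r" for i
    proof -
      have "ii X (\<gamma> i) \<in> Omd 0" using ins_sections_deg[OF vb X \<gamma>[OF that]] by simp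
      then show "ii X (\<gamma> i) = fun_field (c i)" "c i \<in> Cinf"
        unfolding c_def by (rule sections_deg_0[OF vbd], rule Cinf_closed(6)[OF sections_deg_sections])
    qed
    have "(\<Sum>i<?r. fscale (c i) (G i)) = (\<Sum>i<?r. G i \<^bold>\<and> ii (\<gamma> i) X)"
    proof (rule sum.cong[OF refl])
      fix i assume "i \<in> {..<?r}"
      then have i: "i < ?r" by simp
      have "ii (\<gamma> i) X = fun_field (c i)" using ins_sym[OF X \<gamma>[OF i]] c(1)[OF i] by simp
      moreover have "G i \<^bold>\<and> fun_field (c i) = fun_field (c i) \<^bold>\<and> G i"
        using fwedge_swap[of "G i" E 1 "fun_field (c i)" 0] G[OF i] fun_field_sections_deg[OF c(2)[OF i]] by simp
      ultimately show "fscale (c i) (G i) = G i \<^bold>\<and> ii (\<gamma> i) X"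
        using fun_field_wedge[OF vb S1_sections[OF G[OF i]]] by simp
    qed
    also have "\<dots> = fscale (h * h) X"
      using euler(1)[OF S1_sections[OF X]] fweight_sections_deg[of X E 1 real] X by simp
    finally have sumX: "(\<Sum>i<?r. fscale (c i) (G i)) = fscale (h * h) X" .
    have "ii X (\<Sum>i<?r. \<gamma> i \<^bold>\<and> A (G i)) = (\<Sum>i<?r. fscale (c i) (A (G i)) + \<gamma> i \<^bold>\<and> ii (G i) (A X))"
      unfolding ins_sum
    proof (rule sum.cong[OF refl])
      fix i assume "i \<in> {..<?r}"
      then have i: "i < ?r" by simp
      have "fsg (\<gamma> i) = - \<gamma> i" using fweight_sections_deg[of "\<gamma> i" "dual_bundle E" 1 "\<lambda>k. (-1) ^ k"] \<gamma>[OF i]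
        by (simp add: fsg_fweight)
      then show "ii X (\<gamma> i \<^bold>\<and> A (G i)) = fscale (c i) (A (G i)) + \<gamma> i \<^bold>\<and> ii (G i) (A X)"
        using ins_derivation[OF vb, of X "\<gamma> i" "A (G i)"] X skew[OF X G[OF i]]
          fun_field_wedge[OF vbd AOm[OF G[OF i]]] c(1)[OF i] by simp
    qed
    also have "\<dots> = A (\<Sum>i<?r. fscale (c i) (G i)) + fscale (h * h) (fweight real (A X))"
      using A_sum[of ?r c] c(2) euler(2)[OF AOm[OF X]] by (simp add: sum.distrib)
    also have "\<dots> = fscale (h * h) (A X) + fscale (h * h) (cscale (real n) (A X))"
      unfolding sumX using fweight_sections_deg[OF A[OF X], of real] scale[of "h * h" X] h X by simp
    also have "\<dots> = cscale (real (Suc n)) (fscale (h * h) (A X))"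
      by (simp add: fscale_distribs cscale_distribs)
    finally show ?thesis by (simp add: t_def)
  qed
  ultimately show ?thesis by blast
qed

text \<open>The local forms agree on overlaps, because a form of positive degree is determined by
  its contractions. They are glued by taking, at each point, the value of the form chosen for that
  point.\<close>

lemma form_from_contractions:
  assumes A: "\<And>X. X \<in> S1 \<Longrightarrow> A X \<in> Omd (int n)"
    and add: "\<And>X Y. X \<in> S1 \<Longrightarrow> Y \<in> S1 \<Longrightarrow> A (X + Y) = A X + A Y"
    and scale: "\<And>f X. f \<in> Cinf \<Longrightarrow> X \<in> S1 \<Longrightarrow> A (fscale f X) = fscale f (A X)"
    and alt: "\<And>X. X \<in> S1 \<Longrightarrow> ii X (A X) = 0"
  shows "\<exists>t\<in>Omd (int (Suc n)). \<forall>X\<in>S1. ii X t = A X"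
proof -
  have "\<exists>t W. open W \<and> x \<in> W \<and> t \<in> Omd (int (Suc n)) \<and> (\<forall>y\<in>W. \<forall>X\<in>S1. ii X t y = A X y)" for x
  proof -
    obtain h W G \<gamma> where F: "frame_at x h W G \<gamma>" by (rule frame_exists)
    obtain t where t: "t \<in> Omd (int (Suc n))" "\<forall>X\<in>S1. ii X t = fscale (h * h) (A X)"
      using form_from_contractions_local[OF assms F] by blast
    then show ?thesis using F by (intro exI[of _ t] exI[of _ W]) (auto simp: frame_at_def fscale_apply)
  qed
  then obtain t W where t: "\<And>x. open (W x)" "\<And>x. x \<in> W x" "\<And>x. t x \<in> Omd (int (Suc n))"
    "\<And>x y X. y \<in> W x \<Longrightarrow> X \<in> S1 \<Longrightarrow> ii X (t x) y = A X y" by metis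
  have tOm: "t x \<in> Om" for x using t(3) by (rule sections_deg_sections)
  have t0: "t x y {} = 0" for x y
    using t(3)[of x] by (auto simp: sections_deg_def dest!: spec[of _ y] spec[of _ "{}"])
  define \<eta> where "\<eta> x = t x x" for x
  have eq: "\<eta> y = t x y" if "y \<in> W x" for x y
  proof -
    have "(t y - t x) y = 0"
    proof (rule form_zero_at[of "t y - t x" y])
      show "ii X (t y - t x) y = 0" if "X \<in> S1" for X
        using t(2)[of y] t(4)[OF _ that] \<open>y \<in> W x\<close> by simp
    qed (use tOm t0 in auto)
    then show ?thesis by (simp add: \<eta>_def)
  qed
  have "\<eta> \<in> Om"
  proof (rule sections_glue[OF vbd])
    show "\<exists>V s. open V \<and> x \<in> V \<and> s \<in> Om \<and> (\<forall>y\<in>V. \<eta> y = s y)" for x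
      using t(1,2) tOm eq by (intro exI[of _ "W x"] exI[of _ "t x"]) auto
  qed
  moreover have "int (card I) = int (Suc n)" if "\<eta> x I \<noteq> 0" for x I
    using that t(3)[of x] by (simp add: \<eta>_def sections_deg_def)
  moreover have "ii X \<eta> = A X" if "X \<in> S1" for X
  proof
    fix x
    have "ii X \<eta> x = ii X (t x) x" by (simp add: ins_def \<eta>_def)
    then show "ii X \<eta> x = A X x" using t that by simp
  qed
  ultimately show ?thesis unfolding sections_deg_def by blast
qed

text \<open>Fixing the first argument leaves an alternating map with one argument less. The form
  that this map defines depends tensorially on the fixed argument, and
  \<open>form_from_contractions\<close> assembles these forms into one.\<close>

lemma form_of_alternating:
  assumes "alternating n F"
  shows "\<exists>\<eta>\<in>Omd (int n). \<forall>Xs. set Xs \<subseteq> S1 \<longrightarrow> length Xs = n \<longrightarrow> ev \<eta> Xs = F Xs"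
  using assms
proof (induction n arbitrary: F)
  case 0
  then show ?case by (intro bexI[of _ "fun_field (F [])"]) (auto simp: fun_field_sections_deg)
next
  case (Suc n)
  note alt = Suc.prems[unfolded alternating.simps]
  have "\<forall>X\<in>S1. \<exists>\<eta>\<in>Omd (int n). \<forall>Xs. set Xs \<subseteq> S1 \<longrightarrow> length Xs = n \<longrightarrow> ev \<eta> Xs = F (X # Xs)"
    using alt by (intro ballI Suc.IH) blast
  then obtain A where A: "\<And>X. X \<in> S1 \<Longrightarrow> A X \<in> Omd (int n)"
    "\<And>X Xs. X \<in> S1 \<Longrightarrow> set Xs \<subseteq> S1 \<Longrightarrow> length Xs = n \<Longrightarrow> ev (A X) Xs = F (X # Xs)"
    by metis
  have "\<exists>t\<in>Omd (int (Suc n)). \<forall>X\<in>S1. ii X t = A X"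
  proof (rule form_from_contractions)
    show "A (X + Y) = A X + A Y" if "X \<in> S1" "Y \<in> S1" for X Y
      using that alt by (intro form_eqI_deg[of _ n]) (auto simp: A intro: sections_deg_linear)
    show "A (fscale f X) = fscale f (A X)" if "f \<in> Cinf" "X \<in> S1" for f X
      using that alt by (intro form_eqI_deg[of _ n]) (auto simp: A intro: sections_deg_linear)
    show "ii X (A X) = 0" if X: "X \<in> S1" for X
    proof (rule form_eqI)
      show "ii X (A X) \<in> Om" using A(1)[OF X] X sections_deg_sections by blast
      fix Zs assume Zs: "set Zs \<subseteq> S1"
      have "ev (A X) (X # Zs) = 0"
      proof (cases "Suc (length Zs) = n")
        case True
        then show ?thesis using A(2)[OF X, of "X # Zs"] Zs X alt by simp
      next
        case False
        then show ?thesis using ev_degree[OF A(1)[OF X], of "X # Zs"] Zs X by auto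
      qed
      then show "ev (ii X (A X)) Zs = ev 0 Zs" by simp
    qed simp
  qed (use A in auto)
  then obtain t where "t \<in> Omd (int (Suc n))" "\<forall>X\<in>S1. ii X t = A X" by blast
  then show ?case by (intro bexI[of _ t] allI impI, rename_tac Xs, case_tac Xs) (auto simp: A)
qed

subsection \<open>Recursive form of the formula of Koszul\<close>

text \<open>The values of the Lie derivative, by the commutation rule i_Y L_X = L_X i_Y -
  i_[X,Y].\<close>

primrec lie_fun :: "'p mvfield \<Rightarrow> 'p mvfield \<Rightarrow> 'p mvfield list \<Rightarrow> 'p \<Rightarrow> real" where
  "lie_fun X \<omega> [] = act X (\<lambda>x. \<omega> x {})"
| "lie_fun X \<omega> (Y # Ys) = lie_fun X (ii Y \<omega>) Ys - ev (ii (br X Y) \<omega>) Ys"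

text \<open>The values of the exterior derivative, by Cartan's formula i_X d = L_X - d i_X.\<close>

primrec d_fun :: "'p mvfield \<Rightarrow> 'p mvfield list \<Rightarrow> 'p \<Rightarrow> real" where
  "d_fun \<omega> [] = 0"
| "d_fun \<omega> (X # Xs) = lie_fun X \<omega> Xs - d_fun (ii X \<omega>) Xs"

lemma lie_fun_expand:
  assumes "X \<in> S1" "\<omega> \<in> Om" "set Ys \<subseteq> S1"
  shows "lie_fun X \<omega> Ys x = act X (ev \<omega> Ys) x - (\<Sum>j<length Ys. (-1) ^ j * ev \<omega> (br X (Ys ! j) # omit j Ys) x)"
  using assms(2,3)
proof (induction Ys arbitrary: \<omega>)
  case (Cons Y Ys)
  have "ev (ii Y \<omega>) (br X (Ys ! j) # omit j Ys) x = - ev \<omega> (br X (Ys ! j) # Y # omit j Ys) x"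
    if "j < length Ys" for j
  proof -
    have "Ys ! j \<in> S1" using Cons.prems(2) that by auto
    then show ?thesis using ins_swap[of "br X (Ys ! j)" Y \<omega>] Cons.prems assms(1) by simp
  qed
  then have "(\<Sum>j<length Ys. (-1) ^ j * ev (ii Y \<omega>) (br X (Ys ! j) # omit j Ys) x) =
      - (\<Sum>j<length Ys. (-1) ^ j * ev \<omega> (br X (Ys ! j) # Y # omit j Ys) x)"
    by (simp add: sum_negf)
  then show ?case using Cons by (simp add: sum.lessThan_Suc_shift sum_negf del: sum.lessThan_Suc)
qed simp

text \<open>The terms of Koszul's formula in which X is differentiated along or bracketed make up
  \<open>lie_fun\<close>. The others are the formula for the contraction with X, with a minus sign:
  from the shift of the index in the first sum, and from moving X past the bracket in the
  second.\<close>

lemma koszul_d_fun: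
  assumes "\<omega> \<in> Om" "set Xs \<subseteq> S1"
  shows "koszul E br \<rho> \<omega> Xs = d_fun \<omega> Xs"
  using assms
proof (induction Xs arbitrary: \<omega>)
  case Nil
  then show ?case by (simp add: koszul_def fun_eq_iff)
next
  case (Cons X Xs)
  show ?case
  proof
    fix x
    have "ev \<omega> (br (Xs ! i) (Xs ! j) # X # ys) x = - ev (ii X \<omega>) (br (Xs ! i) (Xs ! j) # ys) x"
      if "i < length Xs" "j < length Xs" for i j ys
    proof -
      have "Xs ! i \<in> S1" "Xs ! j \<in> S1" using Cons.prems(2) that by auto
      then show ?thesis using ins_swap[of "br (Xs ! i) (Xs ! j)" X \<omega>] Cons.prems by simp
    qed
    then have 1: "(\<Sum>j<length Xs. \<Sum>i<j. (-1) ^ (i + j) * ev \<omega> (br (Xs ! i) (Xs ! j) # X # omit i (omit j Xs)) x) =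
        - (\<Sum>j<length Xs. \<Sum>i<j. (-1) ^ (i + j) * ev (ii X \<omega>) (br (Xs ! i) (Xs ! j) # omit i (omit j Xs)) x)"
      by (simp add: sum_negf)
    have "koszul E br \<rho> \<omega> (X # Xs) x = lie_fun X \<omega> Xs x - koszul E br \<rho> (ii X \<omega>) Xs x"
      using Cons.prems 1
      by (simp add: lie_fun_expand koszul_def sum.lessThan_Suc_shift sum.distrib sum_subtractf act_def sum_negf
          del: sum.lessThan_Suc)
    then show "koszul E br \<rho> \<omega> (X # Xs) x = d_fun \<omega> (X # Xs) x"
      using Cons by simp
  qed
qed

subsection \<open>Existence of the exterior derivative\<close>

lemma lie_fun_add:
  assumes "X \<in> S1" "set Ys \<subseteq> S1"
  shows "\<omega> \<in> Om \<Longrightarrow> \<eta> \<in> Om \<Longrightarrow> lie_fun X (\<omega> + \<eta>) Ys = lie_fun X \<omega> Ys + lie_fun X \<eta> Ys"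
  using assms(2)
proof (induction Ys arbitrary: \<omega> \<eta>)
  case Nil
  then show ?case
    using act_derivation(1)[OF assms(1), of "\<lambda>x. \<omega> x {}" "\<lambda>x. \<eta> x {}"] by (simp add: plus_fun_def)
qed (simp add: algebra_simps)

lemma lie_fun_fscale:
  assumes "X \<in> S1" "set Ys \<subseteq> S1" "f \<in> Cinf"
  shows "\<omega> \<in> Om \<Longrightarrow> lie_fun X (fscale f \<omega>) Ys = f * lie_fun X \<omega> Ys + act X f * ev \<omega> Ys"
  using assms(2)
proof (induction Ys arbitrary: \<omega>)
  case Nil
  then show ?case
    using act_derivation(2)[OF assms(1,3), of "\<lambda>x. \<omega> x {}"]
    by (simp add: times_fun_def fscale_def mult.commute plus_fun_def)
qed (simp add: algebra_simps)

lemma lie_fun_zero: "X \<in> S1 \<Longrightarrow> set Ys \<subseteq> S1 \<Longrightarrow> lie_fun X 0 Ys = 0"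
  using lie_fun_add[of X Ys 0 0] by simp

lemma br_add_left: "X \<in> S1 \<Longrightarrow> Y \<in> S1 \<Longrightarrow> Z \<in> S1 \<Longrightarrow> br (X + Y) Z = br X Z + br Y Z"
  using br_left(1)[of X Y Z 0] by simp

lemma br_fscale_left:
  "X \<in> S1 \<Longrightarrow> Z \<in> S1 \<Longrightarrow> f \<in> Cinf \<Longrightarrow> br (fscale f X) Z = fscale f (br X Z) - fscale (act Z f) X"
  by (rule br_left(2)[of X X Z])

lemma lie_fun_left_add:
  assumes "X \<in> S1" "X' \<in> S1" "set Ys \<subseteq> S1"
  shows "\<omega> \<in> Om \<Longrightarrow> lie_fun (X + X') \<omega> Ys = lie_fun X \<omega> Ys + lie_fun X' \<omega> Ys"
  using assms(3)
  by (induction Ys arbitrary: \<omega>) (use assms(1,2) in \<open>simp_all add: act_linear br_add_left algebra_simps\<close>)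

text \<open>Linearity over functions: the derivative of f in L_X (f i_Y \<omega>) cancels the one in
  the bracket [X, f Y].\<close>

lemma alternating_lie_fun: "X \<in> S1 \<Longrightarrow> \<omega> \<in> Om \<Longrightarrow> alternating n (lie_fun X \<omega>)"
proof (induction n arbitrary: \<omega>)
  case (Suc n)
  have "lie_fun X \<omega> (Y # Y # Zs) = 0" if "Y \<in> S1" "set Zs \<subseteq> S1" for Y Zs
    using that Suc.prems ins_swap[of "br X Y" Y \<omega>] by (simp add: ins_self lie_fun_zero)
  moreover have "lie_fun X \<omega> ((Y + Z) # Zs) = lie_fun X \<omega> (Y # Zs) + lie_fun X \<omega> (Z # Zs)"
    if "Y \<in> S1" "Z \<in> S1" "set Zs \<subseteq> S1" for Y Z Zs
    using that Suc.prems by (simp add: lie_fun_add br_add algebra_simps)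
  moreover have "lie_fun X \<omega> (fscale f Y # Zs) = f * lie_fun X \<omega> (Y # Zs)"
    if "f \<in> Cinf" "Y \<in> S1" "set Zs \<subseteq> S1" for f Y Zs
    using that Suc.prems by (simp add: lie_fun_fscale br_fscale algebra_simps)
  moreover have "alternating n (\<lambda>Xs. lie_fun X \<omega> (Y # Xs))" if "Y \<in> S1" for Y
    using that Suc by (simp add: alternating_diff alternating_ev)
  ultimately show ?case by simp
qed simp

text \<open>The differential of a function is constructed before d exists, because the tensoriality
  of \<open>d_fun\<close> is expressed with it.\<close>

lemma differential_exists:
  assumes "f \<in> Cinf"
  shows "\<exists>\<eta>\<in>Omd 1. \<forall>X\<in>S1. ii X \<eta> = fun_field (act X f)"
  using form_from_contractions[of "\<lambda>X. fun_field (act X f)" 0] assms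
  by (simp add: fun_field_sections_deg act_linear fun_field_linear fun_field_wedge
      flip: fscale_linear)

definition differential :: "('p \<Rightarrow> real) \<Rightarrow> 'p mvfield" where
  "differential f = (SOME \<eta>. \<eta> \<in> Omd 1 \<and> (\<forall>X\<in>S1. ii X \<eta> = fun_field (act X f)))"

lemma differential:
  assumes "f \<in> Cinf"
  shows "differential f \<in> Omd 1" "X \<in> S1 \<Longrightarrow> ii X (differential f) = fun_field (act X f)"
proof -
  have "\<exists>\<eta>. \<eta> \<in> Omd 1 \<and> (\<forall>X\<in>S1. ii X \<eta> = fun_field (act X f))"
    using differential_exists[OF assms] by blast
  from someI_ex[OF this] show "differential f \<in> Omd 1" "X \<in> S1 \<Longrightarrow> ii X (differential f) = fun_field (act X f)"
    unfolding differential_def by blast+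
qed

lemma differential_Om [simp]: "f \<in> Cinf \<Longrightarrow> differential f \<in> Om"
  using differential(1) by (rule sections_deg_sections)

lemma Omd1_fsg: "\<alpha> \<in> Omd 1 \<Longrightarrow> fsg \<alpha> = - \<alpha>"
  using fweight_sections_deg[of \<alpha> "dual_bundle E" 1 "\<lambda>k. (-1) ^ k"] by (simp add: fsg_fweight)

lemma ins_differential_wedge:
  assumes "f \<in> Cinf" "X \<in> S1" "\<omega> \<in> Om"
  shows "ii X (differential f \<^bold>\<and> \<omega>) = fscale (act X f) \<omega> - differential f \<^bold>\<and> ii X \<omega>"
  using assms ins_derivation[OF vb, of X "differential f" \<omega>]
  by (simp add: differential(2) fun_field_wedge[OF vbd] Omd1_fsg[OF differential(1)])

lemma wedge_at_empty: "(\<omega> \<^bold>\<and> \<eta>) x {} = \<omega> x {} * \<eta> x {}"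
  by (simp add: fwedge_def wedge_def)

lemma Omd_at_empty: "\<alpha> \<in> Omd k \<Longrightarrow> k \<noteq> 0 \<Longrightarrow> \<alpha> x {} = 0"
  by (auto simp: sections_deg_def dest!: spec[of _ x] spec[of _ "{}"])

lemma lie_fun_left_fscale:
  assumes "X \<in> S1" "f \<in> Cinf" "set Ys \<subseteq> S1"
  shows "\<omega> \<in> Om \<Longrightarrow> lie_fun (fscale f X) \<omega> Ys = f * lie_fun X \<omega> Ys + ev (differential f \<^bold>\<and> ii X \<omega>) Ys"
  using assms(3)
proof (induction Ys arbitrary: \<omega>)
  case Nil
  then show ?case using assms(1,2) Omd_at_empty[OF differential(1)[OF assms(2)]]
    by (simp add: act_linear wedge_at_empty)
next
  case (Cons Y Ys)
  then show ?case using assms(1,2) ins_swap[of X Y \<omega>]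
    by (simp add: br_fscale_left ins_differential_wedge algebra_simps)
qed

lemma d_fun_add:
  "set Ys \<subseteq> S1 \<Longrightarrow> \<omega> \<in> Om \<Longrightarrow> \<eta> \<in> Om \<Longrightarrow> d_fun (\<omega> + \<eta>) Ys = d_fun \<omega> Ys + d_fun \<eta> Ys"
  by (induction Ys arbitrary: \<omega> \<eta>) (auto simp: lie_fun_add algebra_simps)

lemma d_fun_zero: "set Ys \<subseteq> S1 \<Longrightarrow> d_fun 0 Ys = 0"
  using d_fun_add[of Ys 0 0] by simp

lemma d_fun_fscale:
  assumes "f \<in> Cinf"
  shows "set Ys \<subseteq> S1 \<Longrightarrow> \<omega> \<in> Om \<Longrightarrow>
    d_fun (fscale f \<omega>) Ys = f * d_fun \<omega> Ys + ev (differential f \<^bold>\<and> \<omega>) Ys"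
proof (induction Ys arbitrary: \<omega>)
  case Nil
  then show ?case using Omd_at_empty[OF differential(1)[OF assms]] by (simp add: wedge_at_empty)
next
  case (Cons Y Ys)
  then show ?case using assms
    by (simp add: lie_fun_fscale ins_differential_wedge algebra_simps)
qed

text \<open>The terms df \<and> i_X \<omega> that arise from L_(f X) \<omega> and from d (f i_X
  \<omega>) cancel, which leaves linearity over functions in the first argument.\<close>

lemma alternating_d_fun: "\<omega> \<in> Om \<Longrightarrow> alternating n (d_fun \<omega>)"
proof (induction n arbitrary: \<omega>)
  case (Suc n)
  have "d_fun \<omega> (X # X # Zs) = 0" if "X \<in> S1" "set Zs \<subseteq> S1" for X Zs
    using that Suc.prems by (simp add: ins_self br_self d_fun_zero)
  moreover have "d_fun \<omega> ((X + Y) # Zs) = d_fun \<omega> (X # Zs) + d_fun \<omega> (Y # Zs)"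
    if "X \<in> S1" "Y \<in> S1" "set Zs \<subseteq> S1" for X Y Zs
    using that Suc.prems by (simp add: lie_fun_left_add d_fun_add algebra_simps)
  moreover have "d_fun \<omega> (fscale f X # Zs) = f * d_fun \<omega> (X # Zs)"
    if "f \<in> Cinf" "X \<in> S1" "set Zs \<subseteq> S1" for f X Zs
    using that Suc.prems by (simp add: lie_fun_left_fscale d_fun_fscale algebra_simps)
  moreover have "alternating n (\<lambda>Xs. d_fun \<omega> (X # Xs))" if "X \<in> S1" for X
    using that Suc by (simp add: alternating_diff alternating_lie_fun)
  ultimately show ?case by simp
qed simp

lemma d_exists:
  assumes "\<omega> \<in> Om"
  shows "\<exists>\<eta>\<in>Om. \<forall>Xs. set Xs \<subseteq> S1 \<longrightarrow> ev \<eta> Xs = d_fun \<omega> Xs"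
proof -
  have "\<forall>n. \<exists>\<eta>\<in>Omd (int n). \<forall>Xs. set Xs \<subseteq> S1 \<longrightarrow> length Xs = n \<longrightarrow> ev \<eta> Xs = d_fun \<omega> Xs"
    using form_of_alternating alternating_d_fun assms by blast
  then obtain \<eta> where \<eta>: "\<And>n. \<eta> n \<in> Omd (int n)"
    "\<And>n Xs. set Xs \<subseteq> S1 \<Longrightarrow> length Xs = n \<Longrightarrow> ev (\<eta> n) Xs = d_fun \<omega> Xs" by metis
  have "ev (\<Sum>n\<le>fibre_dim E. \<eta> n) Xs = d_fun \<omega> Xs" if Xs: "set Xs \<subseteq> S1" for Xs
  proof -
    have "ev (\<Sum>n\<le>fibre_dim E. \<eta> n) Xs = (\<Sum>n\<le>fibre_dim E. if n = length Xs then d_fun \<omega> Xs else 0)"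
      unfolding form_eval_sum using \<eta>(2)[OF Xs] ev_degree[OF \<eta>(1) Xs] by (intro sum.cong) auto
    also have "\<dots> = d_fun \<omega> Xs"
    proof (cases "length Xs \<le> fibre_dim E")
      case False
      \<comment> \<open>Forms of degree above the rank vanish, so \<open>d_fun\<close> is 0 on lists
        of that length and the finite sum misses nothing.\<close>
      then have "\<eta> (length Xs) = 0" using sections_deg_ge[OF vbd \<eta>(1)[of "length Xs"]] by simp
      then show ?thesis using \<eta>(2)[OF Xs, of "length Xs"] by (intro trans[OF sum.neutral]) auto
    qed (simp add: sum.delta)
    finally show ?thesis .
  qed
  moreover have "(\<Sum>n\<le>fibre_dim E. \<eta> n) \<in> Om"
    using \<eta>(1) by (intro sections_sum sections_deg_sections)
  ultimately show ?thesis by blast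
qed

abbreviation "d \<equiv> ext_deriv E br \<rho>"

text \<open>The definite description is legitimate: \<open>d_exists\<close> gives existence and
  \<open>form_eqI\<close> uniqueness.\<close>

lemma d_spec:
  assumes "\<omega> \<in> Om"
  shows "d \<omega> \<in> Om" "set Xs \<subseteq> S1 \<Longrightarrow> ev (d \<omega>) Xs = d_fun \<omega> Xs"
proof -
  let ?P = "\<lambda>\<eta>. \<eta> \<in> Om \<and> (\<forall>Xs. set Xs \<subseteq> S1 \<longrightarrow> ev \<eta> Xs = koszul E br \<rho> \<omega> Xs)"
  have "\<exists>!\<eta>. ?P \<eta>"
  proof (rule ex_ex1I)
    show "\<exists>\<eta>. ?P \<eta>" using d_exists[OF assms] koszul_d_fun[OF assms] by auto
    show "\<eta> = \<eta>'" if "?P \<eta>" "?P \<eta>'" for \<eta> \<eta>' using that by (intro form_eqI) auto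
  qed
  then have "?P (d \<omega>)" unfolding ext_deriv_def by (rule theI')
  then show "d \<omega> \<in> Om" "set Xs \<subseteq> S1 \<Longrightarrow> ev (d \<omega>) Xs = d_fun \<omega> Xs"
    using koszul_d_fun[OF assms] by auto
qed

end

context algebroid
begin

subsection \<open>Cartan calculus\<close>

lemma d_Om [simp, intro]: "\<omega> \<in> Om \<Longrightarrow> d \<omega> \<in> Om"
  by (rule d_spec)

lemma ev_d [simp]: "\<omega> \<in> Om \<Longrightarrow> set Xs \<subseteq> S1 \<Longrightarrow> ev (d \<omega>) Xs = d_fun \<omega> Xs"
  by (rule d_spec)

lemma d_add: "\<omega> \<in> Om \<Longrightarrow> \<eta> \<in> Om \<Longrightarrow> d (\<omega> + \<eta>) = d \<omega> + d \<eta>"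
  by (rule form_eqI) (auto simp: d_fun_add)

lemma d_zero [simp]: "d 0 = 0"
  using d_add[of 0 0] by simp

lemma d_uminus: "\<omega> \<in> Om \<Longrightarrow> d (- \<omega>) = - d \<omega>"
  using d_add[of \<omega> "- \<omega>"] by (simp add: eq_neg_iff_add_eq_0 add.commute)

lemma d_diff: "\<omega> \<in> Om \<Longrightarrow> \<eta> \<in> Om \<Longrightarrow> d (\<omega> - \<eta>) = d \<omega> - d \<eta>"
  using d_add[of \<omega> "- \<eta>"] by (simp add: d_uminus)

lemma differential_const: "differential (\<lambda>_. c) = 0"
  by (rule form_eqI_deg[of _ 1])
    (auto simp: differential fun_field_linear sections_deg_linear length_Suc_conv intro!: differential(1)[simplified])

lemma d_fscale: "\<omega> \<in> Om \<Longrightarrow> f \<in> Cinf \<Longrightarrow> d (fscale f \<omega>) = fscale f (d \<omega>) + differential f \<^bold>\<and> \<omega>"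
  by (rule form_eqI) (auto simp: d_fun_fscale)

lemma d_cscale: "\<omega> \<in> Om \<Longrightarrow> d (cscale c \<omega>) = cscale c (d \<omega>)"
  using d_fscale[of \<omega> "\<lambda>_. c"] by (simp add: cscale_fscale differential_const)

lemma d_sum: "(\<And>i. i \<in> A \<Longrightarrow> F i \<in> Om) \<Longrightarrow> d (sum F A) = (\<Sum>i\<in>A. d (F i))"
  by (induction A rule: infinite_finite_induct) (simp_all only: sum.infinite sum.empty sum.insert d_zero not_False_eq_True
      d_add sections_sum insert_iff simp_thms)

definition lie :: "'p mvfield \<Rightarrow> 'p mvfield \<Rightarrow> 'p mvfield" where
  "lie X \<omega> = ii X (d \<omega>) + d (ii X \<omega>)"

lemma lie_Om [simp, intro]: "X \<in> S1 \<Longrightarrow> \<omega> \<in> Om \<Longrightarrow> lie X \<omega> \<in> Om"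
  by (auto simp: lie_def)

lemma ev_lie [simp]: "X \<in> S1 \<Longrightarrow> \<omega> \<in> Om \<Longrightarrow> set Xs \<subseteq> S1 \<Longrightarrow> ev (lie X \<omega>) Xs = lie_fun X \<omega> Xs"
  using ev_d[of \<omega> "X # Xs"] by (simp add: lie_def)

lemma ins_d: "ii X (d \<omega>) = lie X \<omega> - d (ii X \<omega>)"
  by (simp add: lie_def)

lemma lie_ins:
  assumes "X \<in> S1" "Y \<in> S1" "\<omega> \<in> Om"
  shows "ii Y (lie X \<omega>) = lie X (ii Y \<omega>) - ii (br X Y) \<omega>"
proof (rule form_eqI)
  fix Xs assume "set Xs \<subseteq> S1"
  then show "ev (ii Y (lie X \<omega>)) Xs = ev (lie X (ii Y \<omega>) - ii (br X Y) \<omega>) Xs"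
    using assms ev_lie[of X \<omega> "Y # Xs"] by simp
qed (use assms in auto)

lemma lie_add: "X \<in> S1 \<Longrightarrow> \<omega> \<in> Om \<Longrightarrow> \<eta> \<in> Om \<Longrightarrow> lie X (\<omega> + \<eta>) = lie X \<omega> + lie X \<eta>"
  by (simp add: lie_def d_add)

lemma lie_diff: "X \<in> S1 \<Longrightarrow> \<omega> \<in> Om \<Longrightarrow> \<eta> \<in> Om \<Longrightarrow> lie X (\<omega> - \<eta>) = lie X \<omega> - lie X \<eta>"
  by (simp add: lie_def d_diff)

lemma d_at_empty [simp]: "\<omega> \<in> Om \<Longrightarrow> d \<omega> x {} = 0"
  using ev_d[of \<omega> "[]"] by (simp add: fun_eq_iff)

lemma lie_at_empty [simp]: "X \<in> S1 \<Longrightarrow> \<omega> \<in> Om \<Longrightarrow> lie X \<omega> x {} = act X (\<lambda>x. \<omega> x {}) x"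
  using ev_lie[of X \<omega> "[]"] by (simp add: fun_eq_iff)

lemma lie_fun_degree:
  "X \<in> S1 \<Longrightarrow> \<omega> \<in> Omd k \<Longrightarrow> set Ys \<subseteq> S1 \<Longrightarrow> int (length Ys) \<noteq> k \<Longrightarrow> lie_fun X \<omega> Ys = 0"
proof (induction Ys arbitrary: \<omega> k)
  case Nil
  then have "(\<lambda>x. \<omega> x {}) = (\<lambda>_. 0)" using Omd_at_empty[of \<omega> k] by auto
  then show ?case using Nil(1) by (simp del: zero_fun_fold)
next
  case (Cons Y Ys)
  then have 1: "ii Y \<omega> \<in> Omd (k - 1)" "ii (br X Y) \<omega> \<in> Omd (k - 1)"
    using ins_sections_deg[OF vb _ Cons.prems(2), of _ 1] by auto
  then show ?case using Cons.IH[OF Cons.prems(1) 1(1)] ev_degree[OF 1(2), of Ys] Cons.prems by simp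
qed

lemma d_fun_degree:
  "\<omega> \<in> Omd k \<Longrightarrow> set Ys \<subseteq> S1 \<Longrightarrow> int (length Ys) \<noteq> k + 1 \<Longrightarrow> d_fun \<omega> Ys = 0"
proof (induction Ys arbitrary: \<omega> k)
  case (Cons X Xs)
  then have 1: "ii X \<omega> \<in> Omd (k - 1)"
    using ins_sections_deg[OF vb _ Cons.prems(1), of _ 1] by auto
  then show ?case using Cons.IH[OF 1] lie_fun_degree[OF _ Cons.prems(1), of X Xs] Cons.prems by simp
qed simp

lemma d_sections_deg: "\<omega> \<in> Omd k \<Longrightarrow> d \<omega> \<in> Omd (k + 1)"
  using sections_deg_sections[of \<omega> _ k] by (intro sections_degI) (auto simp: d_fun_degree)

text \<open>For additive identities whose signs refer to a degree: these are settled on homogeneous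
  forms, and every form is a finite sum of such.\<close>

lemma Om_deg_induct [consumes 1, case_names deg add]:
  assumes "\<omega> \<in> Om" "\<And>k \<omega>. \<omega> \<in> Omd (int k) \<Longrightarrow> Q \<omega>"
    and add: "\<And>\<omega> \<eta>. \<omega> \<in> Om \<Longrightarrow> \<eta> \<in> Om \<Longrightarrow> Q \<omega> \<Longrightarrow> Q \<eta> \<Longrightarrow> Q (\<omega> + \<eta>)"
  shows "Q \<omega>"
proof -
  have "Q (\<Sum>j\<le>n. deg_part j \<omega>)" for n
  proof (induction n)
    case 0
    have "Q (deg_part 0 \<omega>)" by (rule assms(2)[OF deg_part_sections[OF assms(1)]])
    then show ?case by (simp only: atMost_0 sum.insert[OF finite.emptyI] empty_iff not_False_eq_True sum.empty add_0_right)
  next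
    case (Suc n)
    have "deg_part j \<omega> \<in> Om" for j using deg_part_sections[OF assms(1)] by (rule sections_deg_sections)
    then have "Q ((\<Sum>j\<le>n. deg_part j \<omega>) + deg_part (Suc n) \<omega>)"
      by (intro add Suc assms(2)[OF deg_part_sections[OF assms(1)]] sections_sum)
    then show ?case by (simp only: sum.atMost_Suc)
  qed
  moreover have "\<omega> = (\<Sum>j\<le>fibre_dim E. deg_part j \<omega>)"
    using sum_deg_part[OF vbd, of \<omega> "\<lambda>_. 1"] assms(1) by (simp add: fweight_def)
  ultimately show ?thesis by metis
qed

lemma Omd_fsg: "\<omega> \<in> Omd (int k) \<Longrightarrow> fsg \<omega> = cscale ((-1) ^ k) \<omega>"
  by (simp add: fsg_fweight fweight_sections_deg)

lemma d_fsg: "\<omega> \<in> Om \<Longrightarrow> d (fsg \<omega>) = - fsg (d \<omega>)"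
proof (induction \<omega> rule: Om_deg_induct)
  case (deg k \<omega>)
  then have "fsg (d \<omega>) = cscale ((-1) ^ Suc k) (d \<omega>)"
    using d_sections_deg[of \<omega> "int k"] by (intro Omd_fsg) (simp add: add.commute)
  moreover have "fsg \<omega> = cscale ((-1) ^ k) \<omega>" "\<omega> \<in> Om" using deg Omd_fsg sections_deg_sections by blast+
  ultimately show ?case by (simp only: d_cscale) simp
next
  case (add \<omega> \<eta>)
  have "d (fsg (\<omega> + \<eta>)) = - fsg (d (\<omega> + \<eta>))"
    by (simp only: fsg_linear d_add add Om_closed minus_add_distrib)
  then show ?case .
qed

lemma ins_fsg: "X \<in> S1 \<Longrightarrow> \<omega> \<in> Om \<Longrightarrow> ii X (fsg \<omega>) = - fsg (ii X \<omega>)"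
proof -
  assume X: "X \<in> S1"
  show "ii X (fsg \<omega>) = - fsg (ii X \<omega>)" if "\<omega> \<in> Om"
    using that
  proof (induction \<omega> rule: Om_deg_induct)
    case (deg k \<omega>)
    show ?case
    proof (cases k)
      case 0
      then have "ii X \<omega> \<in> Omd (-1)" using ins_sections_deg[OF vb X, of \<omega> 0] deg by simp
      then have "ii X \<omega> = 0" by (rule sections_deg_neg[rotated]) simp
      then show ?thesis using deg by (simp add: Omd_fsg)
    next
      case (Suc n)
      then have "fsg (ii X \<omega>) = cscale ((-1) ^ n) (ii X \<omega>)"
        using ins_sections_deg[OF vb X, of \<omega> "int k"] deg by (intro Omd_fsg) simp
      moreover have "fsg \<omega> = cscale ((-1) ^ Suc n) \<omega>" using Omd_fsg[OF deg] Suc by simp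
      ultimately show ?thesis by (simp only: ins_linear) simp
    qed
  next
    case (add \<omega> \<eta>)
    have IH: "ii X (fsg \<omega>) = - fsg (ii X \<omega>)" "ii X (fsg \<eta>) = - fsg (ii X \<eta>)"
      by (rule add)+
    have "ii X (fsg (\<omega> + \<eta>)) = - fsg (ii X (\<omega> + \<eta>))"
      by (simp add: IH)
    then show ?case .
  qed
qed

lemma ins_wedge_form:
  "X \<in> S1 \<Longrightarrow> ii X (\<omega> \<^bold>\<and> \<eta>) = ii X \<omega> \<^bold>\<and> \<eta> + fsg \<omega> \<^bold>\<and> ii X \<eta>"
  using ins_derivation[OF vb] by blast

lemma lie_fsg: "X \<in> S1 \<Longrightarrow> \<omega> \<in> Om \<Longrightarrow> lie X (fsg \<omega>) = fsg (lie X \<omega>)"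
  by (simp add: lie_def d_fsg ins_fsg d_uminus)

text \<open>Contraction with Y reduces the defect at \<omega>, \<eta> to the defects at i_Y
  \<omega>, \<eta> and at fsg \<omega>, i_Y \<eta>. The induction on the number of arguments
  therefore runs over arbitrary forms; its base is the Leibniz rule of the anchor.\<close>

lemma lie_wedge:
  assumes X: "X \<in> S1" and \<omega>: "\<omega> \<in> Om" and \<eta>: "\<eta> \<in> Om"
  shows "lie X (\<omega> \<^bold>\<and> \<eta>) = lie X \<omega> \<^bold>\<and> \<eta> + \<omega> \<^bold>\<and> lie X \<eta>"
proof (rule form_eqI)
  fix Xs assume "set Xs \<subseteq> S1"
  then show "ev (lie X (\<omega> \<^bold>\<and> \<eta>)) Xs = ev (lie X \<omega> \<^bold>\<and> \<eta> + \<omega> \<^bold>\<and> lie X \<eta>) Xs"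
    using \<omega> \<eta>
  proof (induction Xs arbitrary: \<omega> \<eta>)
    case Nil
    then have "act X (\<lambda>x. \<omega> x {} * \<eta> x {}) = (\<lambda>x. \<omega> x {}) * act X (\<lambda>x. \<eta> x {}) + (\<lambda>x. \<eta> x {}) * act X (\<lambda>x. \<omega> x {})"
      using act_derivation(2)[OF X, of "\<lambda>x. \<omega> x {}" "\<lambda>x. \<eta> x {}"] by (simp add: times_fun_def)
    then show ?case using Nil X by (simp add: fun_eq_iff wedge_at_empty)
  next
    case (Cons Y Ys)
    note [simp] = X Cons.prems(2,3)
    have Y [simp]: "Y \<in> S1" and Ys: "set Ys \<subseteq> S1" using Cons.prems by auto
    have "ii Y (lie X (\<omega> \<^bold>\<and> \<eta>)) = lie X (ii Y \<omega> \<^bold>\<and> \<eta>) + lie X (fsg \<omega> \<^bold>\<and> ii Y \<eta>)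
        - (ii (br X Y) \<omega> \<^bold>\<and> \<eta> + fsg \<omega> \<^bold>\<and> ii (br X Y) \<eta>)"
      by (simp add: lie_ins ins_wedge_form lie_add)
    moreover have "ii Y (lie X \<omega> \<^bold>\<and> \<eta> + \<omega> \<^bold>\<and> lie X \<eta>) =
        (lie X (ii Y \<omega>) \<^bold>\<and> \<eta> + ii Y \<omega> \<^bold>\<and> lie X \<eta>) + (lie X (fsg \<omega>) \<^bold>\<and> ii Y \<eta> + fsg \<omega> \<^bold>\<and> lie X (ii Y \<eta>))
        - (ii (br X Y) \<omega> \<^bold>\<and> \<eta> + fsg \<omega> \<^bold>\<and> ii (br X Y) \<eta>)"
      by (simp add: lie_ins ins_wedge_form lie_fsg algebra_simps)
    ultimately show ?case
      using Cons.IH[OF Ys, of "ii Y \<omega>" \<eta>] Cons.IH[OF Ys, of "fsg \<omega>" "ii Y \<eta>"]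
      by (simp only: form_eval_Cons form_eval_linear Om_closed X Y Cons.prems(2,3) simp_thms)
  qed
qed (use assms in auto)

text \<open>The reduction used for \<open>lie_wedge\<close>, now through Cartan's formula; in the
  base case the components of degree 0 of both sides vanish.\<close>

lemma d_wedge:
  assumes \<omega>: "\<omega> \<in> Om" and \<eta>: "\<eta> \<in> Om"
  shows "d (\<omega> \<^bold>\<and> \<eta>) = d \<omega> \<^bold>\<and> \<eta> + fsg \<omega> \<^bold>\<and> d \<eta>"
proof (rule form_eqI)
  fix Xs assume "set Xs \<subseteq> S1"
  then show "ev (d (\<omega> \<^bold>\<and> \<eta>)) Xs = ev (d \<omega> \<^bold>\<and> \<eta> + fsg \<omega> \<^bold>\<and> d \<eta>) Xs"
    using \<omega> \<eta>
  proof (induction Xs arbitrary: \<omega> \<eta>)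
    case Nil
    then show ?case using Nil by (simp add: fun_eq_iff wedge_at_empty)
  next
    case (Cons X Xs)
    note [simp] = Cons.prems(2,3)
    have X [simp]: "X \<in> S1" and Xs: "set Xs \<subseteq> S1" using Cons.prems by auto
    have "ii X (d (\<omega> \<^bold>\<and> \<eta>)) = (lie X \<omega> \<^bold>\<and> \<eta> + \<omega> \<^bold>\<and> lie X \<eta>) - d (ii X \<omega> \<^bold>\<and> \<eta>) - d (fsg \<omega> \<^bold>\<and> ii X \<eta>)"
      by (simp add: ins_d lie_wedge ins_wedge_form d_add)
    moreover have "ii X (d \<omega> \<^bold>\<and> \<eta> + fsg \<omega> \<^bold>\<and> d \<eta>) = (lie X \<omega> \<^bold>\<and> \<eta> + \<omega> \<^bold>\<and> lie X \<eta>)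
        - (d (ii X \<omega>) \<^bold>\<and> \<eta> + fsg (ii X \<omega>) \<^bold>\<and> d \<eta>) - (d (fsg \<omega>) \<^bold>\<and> ii X \<eta> + fsg (fsg \<omega>) \<^bold>\<and> d (ii X \<eta>))"
      by (simp add: ins_wedge_form ins_d d_fsg ins_fsg algebra_simps)
    ultimately show ?case
      using Cons.IH[OF Xs, of "ii X \<omega>" \<eta>] Cons.IH[OF Xs, of "fsg \<omega>" "ii X \<eta>"]
      by (simp only: form_eval_Cons form_eval_linear Om_closed X Cons.prems(2,3) simp_thms)
  qed
qed (use assms in auto)

text \<open>The defect commutes with contractions by the Jacobi identity of \<open>br\<close>, and
  on functions it vanishes by \<open>act_br\<close>.\<close>

lemma lie_commutator:
  assumes X [simp]: "X \<in> S1" and Y [simp]: "Y \<in> S1" and \<omega>: "\<omega> \<in> Om"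
  shows "lie X (lie Y \<omega>) - lie Y (lie X \<omega>) = lie (br X Y) \<omega>"
proof (rule form_eqI)
  fix Xs assume "set Xs \<subseteq> S1"
  then show "ev (lie X (lie Y \<omega>) - lie Y (lie X \<omega>)) Xs = ev (lie (br X Y) \<omega>) Xs"
    using \<omega>
  proof (induction Xs arbitrary: \<omega>)
    case Nil
    then show ?case using act_br[OF X Y, of "\<lambda>x. \<omega> x {}"] by (simp add: fun_eq_iff)
  next
    case (Cons Z Zs)
    note [simp] = Cons.prems(2)
    have Z [simp]: "Z \<in> S1" and Zs: "set Zs \<subseteq> S1" using Cons.prems by auto
    have "ii Z (lie X (lie Y \<omega>) - lie Y (lie X \<omega>)) - ii Z (lie (br X Y) \<omega>) =
        (lie X (lie Y (ii Z \<omega>)) - lie Y (lie X (ii Z \<omega>))) - lie (br X Y) (ii Z \<omega>)"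
      by (simp add: lie_ins lie_diff br_jacobi[of X Y Z] algebra_simps)
    moreover have "ev (lie X (lie Y (ii Z \<omega>))) Zs - ev (lie Y (lie X (ii Z \<omega>))) Zs = ev (lie (br X Y) (ii Z \<omega>)) Zs"
      using Cons.IH[OF Zs, of "ii Z \<omega>"] by (simp only: form_eval_linear Om_closed Z Cons.prems(2) simp_thms)
    ultimately have "ev (ii Z (lie X (lie Y \<omega>) - lie Y (lie X \<omega>)) - ii Z (lie (br X Y) \<omega>)) Zs = 0"
      by (simp only: form_eval_linear diff_self)
    then show ?case by (simp only: form_eval_linear form_eval_Cons) simp
  qed
qed (use assms in auto)

text \<open>By Cartan's formula and \<open>lie_commutator\<close> the defect anticommutes with
  contractions; its component of degree 0 vanishes because that of any \<open>d \<omega>\<close>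
  does.\<close>

lemma lie_d:
  assumes X [simp]: "X \<in> S1" and \<omega>: "\<omega> \<in> Om"
  shows "lie X (d \<omega>) = d (lie X \<omega>)"
proof (rule form_eqI)
  fix Xs assume "set Xs \<subseteq> S1"
  then show "ev (lie X (d \<omega>)) Xs = ev (d (lie X \<omega>)) Xs"
    using \<omega>
  proof (induction Xs arbitrary: \<omega>)
    case Nil
    then show ?case using Nil by simp
  next
    case (Cons Z Zs)
    note [simp] = Cons.prems(2)
    have Z [simp]: "Z \<in> S1" and Zs: "set Zs \<subseteq> S1" using Cons.prems by auto
    have "ii Z (lie X (d \<omega>)) - ii Z (d (lie X \<omega>)) =
        (lie X (lie Z \<omega>) - lie Z (lie X \<omega>) - lie (br X Z) \<omega>) - (lie X (d (ii Z \<omega>)) - d (lie X (ii Z \<omega>)))"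
      by (simp add: lie_ins lie_diff ins_d d_diff algebra_simps)
    then have "ii Z (lie X (d \<omega>)) - ii Z (d (lie X \<omega>)) = - (lie X (d (ii Z \<omega>)) - d (lie X (ii Z \<omega>)))"
      by (simp add: lie_commutator)
    then have "ev (ii Z (lie X (d \<omega>)) - ii Z (d (lie X \<omega>))) Zs = 0"
      using Cons.IH[OF Zs, of "ii Z \<omega>"] by (simp only: form_eval_linear) simp
    then show ?case by (simp only: form_eval_linear form_eval_Cons) simp
  qed
qed (use assms in auto)

text \<open>By \<open>lie_d\<close> the square of d commutes with contractions.\<close>

lemma d_d:
  assumes \<omega>: "\<omega> \<in> Om"
  shows "d (d \<omega>) = 0"
proof (rule form_eqI)
  fix Xs assume "set Xs \<subseteq> S1"
  then show "ev (d (d \<omega>)) Xs = ev 0 Xs"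
    using \<omega>
  proof (induction Xs arbitrary: \<omega>)
    case (Cons X Xs)
    note [simp] = Cons.prems(2)
    have X [simp]: "X \<in> S1" and Xs: "set Xs \<subseteq> S1" using Cons.prems by auto
    have "ii X (d (d \<omega>)) = d (d (ii X \<omega>))"
      by (simp add: ins_d lie_d d_diff)
    then show ?case using Cons.IH[OF Xs, of "ii X \<omega>"] by (simp only: form_eval_Cons) simp
  qed simp
qed (use assms in auto)

lemma d_fun_field: "f \<in> Cinf \<Longrightarrow> d (fun_field f) = differential f"
proof (rule form_eqI_deg[of _ 1])
  assume f: "f \<in> Cinf"
  show "d (fun_field f) \<in> Omd (int 1)" using d_sections_deg[OF fun_field_sections_deg[of f "dual_bundle E"]] f by simp
  show "differential f \<in> Omd (int 1)" using differential(1)[OF f] by simp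
  show "ev (d (fun_field f)) Xs = ev (differential f) Xs" if "set Xs \<subseteq> S1" "length Xs = 1" for Xs
    using that f by (auto simp: length_Suc_conv differential)
qed


section \<open>Contraction with bivector fields\<close>

abbreviation "S2 \<equiv> sections_deg E 2"

lemma S2_sections: "Q \<in> S2 \<Longrightarrow> Q \<in> sections E"
  by (rule sections_deg_sections)

lemma wedge_S2 [simp, intro]: "X \<in> S1 \<Longrightarrow> Y \<in> S1 \<Longrightarrow> X \<^bold>\<and> Y \<in> S2"
  using fwedge_sections_deg[of X E 1 Y 1] by simp

lemma S2_closed [simp, intro]:
  "Q \<in> S2 \<Longrightarrow> R \<in> S2 \<Longrightarrow> Q + R \<in> S2" "f \<in> Cinf \<Longrightarrow> Q \<in> S2 \<Longrightarrow> fscale f Q \<in> S2" "0 \<in> S2"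
  by (auto intro: sections_deg_linear)

lemma ins2_Om [simp, intro]: "Q \<in> S2 \<Longrightarrow> \<omega> \<in> Om \<Longrightarrow> ii Q \<omega> \<in> Om"
  by (auto intro: S2_sections)

lemma ins_form_S1 [simp, intro]: "Q \<in> S2 \<Longrightarrow> \<alpha> \<in> Omd 1 \<Longrightarrow> ii \<alpha> Q \<in> S1"
  using ins_dual_sections_deg[OF vb, of \<alpha> 1 Q 2] by simp

lemma ins_wedge2: "\<omega> \<in> Om \<Longrightarrow> ii (X \<^bold>\<and> Y) \<omega> = ii Y (ii X \<omega>)"
  by (rule ins_wedge[OF vb]) simp

lemma ins2_sections_deg: "Q \<in> S2 \<Longrightarrow> \<omega> \<in> Omd k \<Longrightarrow> ii Q \<omega> \<in> Omd (k - 2)"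
  by (rule ins_sections_deg[OF vb])

text \<open>The Euler identity in degree 2 writes h^2 Q as half the sum of the products of G_i with
  the contraction of Q by \<gamma>_i. The function returned is therefore the square of the
  cutoff.\<close>

lemma bivector_local:
  assumes Q: "Q \<in> S2"
  obtains h W X Y where "h \<in> Cinf" "open W" "x \<in> W" "\<And>y. y \<in> W \<Longrightarrow> h y = 1"
    "\<And>i. i < fibre_dim E \<Longrightarrow> X i \<in> S1" "\<And>i. i < fibre_dim E \<Longrightarrow> Y i \<in> S1"
    "fscale h Q = (\<Sum>i<fibre_dim E. X i \<^bold>\<and> Y i)"
proof -
  obtain h W G \<gamma> where F: "frame_at x h W G \<gamma>" by (rule frame_exists)
  have "fweight real Q = cscale 2 Q" using fweight_sections_deg[of Q E 2 real] Q by simp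
  moreover have "\<forall>s\<in>sections E. (\<Sum>i<fibre_dim E. G i \<^bold>\<and> ii (\<gamma> i) s) = fscale (h * h) (fweight real s)"
    using F unfolding frame_at_def by blast
  ultimately have "(\<Sum>i<fibre_dim E. G i \<^bold>\<and> ii (\<gamma> i) Q) = fscale (h * h) (cscale 2 Q)"
    using S2_sections[OF Q] by simp
  then have "fscale (h * h) Q = cscale (1 / 2) (\<Sum>i<fibre_dim E. G i \<^bold>\<and> ii (\<gamma> i) Q)"
    by (simp add: fscale_distribs)
  then have "fscale (h * h) Q = (\<Sum>i<fibre_dim E. G i \<^bold>\<and> cscale (1 / 2) (ii (\<gamma> i) Q))"
    by (simp add: cscale_distribs)
  then show ?thesis
    by (rule that[rotated 6]) (use F Q in \<open>auto simp: frame_at_def\<close>)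
qed

text \<open>Reduces identities that are linear over functions in Q to decomposable fields:
  multiplied by a cutoff, Q is a finite sum of such fields.\<close>

lemma bivector_zero:
  assumes Q: "Q \<in> S2" and dec: "\<And>X Y. X \<in> S1 \<Longrightarrow> Y \<in> S1 \<Longrightarrow> T (X \<^bold>\<and> Y) = (0 :: 'p mvfield)"
    and add: "\<And>Q R. Q \<in> S2 \<Longrightarrow> R \<in> S2 \<Longrightarrow> T (Q + R) = T Q + T R"
    and scale: "\<And>f Q. f \<in> Cinf \<Longrightarrow> Q \<in> S2 \<Longrightarrow> T (fscale f Q) = fscale f (T Q)"
  shows "T Q = 0"
proof
  fix x
  obtain h W X Y where h: "h \<in> Cinf" "open W" "x \<in> W" "\<And>y. y \<in> W \<Longrightarrow> h y = 1"
    "\<And>i. i < fibre_dim E \<Longrightarrow> X i \<in> S1" "\<And>i. i < fibre_dim E \<Longrightarrow> Y i \<in> S1"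
    "fscale h Q = (\<Sum>i<fibre_dim E. X i \<^bold>\<and> Y i)"
    by (rule bivector_local[OF Q, of x]) blast
  have T0: "T 0 = 0" using scale[of 0 0] by (simp add: fscale_linear)
  have "T (\<Sum>i<m. X i \<^bold>\<and> Y i) = 0" if "m \<le> fibre_dim E" for m
    using that
  proof (induction m)
    case (Suc m)
    then have "(\<Sum>i<m. X i \<^bold>\<and> Y i) \<in> S2" "X m \<^bold>\<and> Y m \<in> S2" using h(5,6) by (auto intro!: sections_deg_sum)
    from add[OF this] show ?case using Suc h(5,6) dec[of "X m" "Y m"] by (simp only: sum.lessThan_Suc) simp
  qed (simp add: T0)
  then have "T (fscale h Q) = 0" using h(7) by (metis order_refl)
  then have "fscale h (T Q) = 0" using scale[OF h(1) Q] by simp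
  then have "fscale h (T Q) x = 0" by simp
  then show "T Q x = 0 x" using h(3,4) by (simp add: fscale_apply)
qed

lemma pairing:
  assumes "X \<in> S1" "\<alpha> \<in> Omd 1"
  obtains c where "c \<in> Cinf" "ii X \<alpha> = fun_field c" "ii \<alpha> X = fun_field c"
proof -
  have "ii X \<alpha> \<in> Omd 0" using ins_sections_deg[OF vb assms] by simp
  then show ?thesis using that[of "\<lambda>x. ii X \<alpha> x {}"] sections_deg_0[OF vbd, of "ii X \<alpha>"] ins_sym[OF assms]
      Cinf_closed(6)[OF sections_deg_sections] by metis
qed

lemma wedge_fun_field_right: "X \<in> S1 \<Longrightarrow> c \<in> Cinf \<Longrightarrow> X \<^bold>\<and> fun_field c = fscale c X"
  using fwedge_swap[of X E 1 "fun_field c" 0] fun_field_sections_deg[of c E] fun_field_wedge[OF vb S1_sections, of X c]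
  by simp

lemma S1_fsg: "X \<in> S1 \<Longrightarrow> fsg X = - X"
  using fweight_sections_deg[of X E 1 "\<lambda>k. (-1) ^ k"] by (simp add: fsg_fweight)

lemma ins_form_wedge:
  assumes X: "X \<in> S1" and \<alpha>: "\<alpha> \<in> Omd 1" and \<omega>: "\<omega> \<in> Om" and c: "ii X \<alpha> = fun_field c"
  shows "ii X (\<alpha> \<^bold>\<and> \<omega>) = fscale c \<omega> - \<alpha> \<^bold>\<and> ii X \<omega>"
  using ins_wedge_form[OF X, of \<alpha> \<omega>] by (simp add: c Omd1_fsg[OF \<alpha>] fun_field_wedge[OF vbd \<omega>])

lemma ins2_form_wedge:
  assumes Q: "Q \<in> S2" and \<alpha>: "\<alpha> \<in> Omd 1" and \<omega>: "\<omega> \<in> Om"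
  shows "ii Q (\<alpha> \<^bold>\<and> \<omega>) = ii (ii \<alpha> Q) \<omega> + \<alpha> \<^bold>\<and> ii Q \<omega>"
proof -
  have \<alpha>O: "\<alpha> \<in> Om" using \<alpha> by (rule sections_deg_sections)
  have "ii Q (\<alpha> \<^bold>\<and> \<omega>) - (ii (ii \<alpha> Q) \<omega> + \<alpha> \<^bold>\<and> ii Q \<omega>) = 0"
  proof (rule bivector_zero[OF Q, where T = "\<lambda>Q. ii Q (\<alpha> \<^bold>\<and> \<omega>) - (ii (ii \<alpha> Q) \<omega> + \<alpha> \<^bold>\<and> ii Q \<omega>)"])
    fix X Y assume XY [simp]: "X \<in> S1" "Y \<in> S1"
    obtain c where c: "c \<in> Cinf" "ii X \<alpha> = fun_field c" "ii \<alpha> X = fun_field c" using pairing[OF XY(1) \<alpha>] by blast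
    obtain b where b: "b \<in> Cinf" "ii Y \<alpha> = fun_field b" "ii \<alpha> Y = fun_field b" using pairing[OF XY(2) \<alpha>] by blast
    have 1: "ii \<alpha> (X \<^bold>\<and> Y) = fscale c Y - fscale b X"
      using ins_derivation[OF vb, of \<alpha> X Y] \<alpha>
      by (simp add: c b S1_fsg wedge_fun_field_right fun_field_wedge[OF vb S1_sections])
    show "ii (X \<^bold>\<and> Y) (\<alpha> \<^bold>\<and> \<omega>) - (ii (ii \<alpha> (X \<^bold>\<and> Y)) \<omega> + \<alpha> \<^bold>\<and> ii (X \<^bold>\<and> Y) \<omega>) = 0"
      using \<omega> \<alpha>O \<alpha>
      by (simp add: 1 ins_wedge2 ins_form_wedge[OF _ _ _ c(2)] ins_form_wedge[OF _ _ _ b(2)] algebra_simps)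
  qed (simp_all add: fscale_distribs algebra_simps)
  then show ?thesis by simp
qed

text \<open>The degree of \<eta> is the integer k - 1, so that contractions of functions, where k =
  0 and \<eta> = 0, are covered. The sign (-1)^((k - 1) l) is split into (-1)^(k l) and the one
  inside \<open>fsg \<nu>\<close>.\<close>

lemma wedge_swap_pred:
  assumes "\<eta> \<in> Omd (int k - 1)" "\<nu> \<in> Omd (int l)"
  shows "\<eta> \<^bold>\<and> \<nu> = cscale ((-1) ^ (k * l)) (fsg \<nu> \<^bold>\<and> \<eta>)"
proof (cases k)
  case 0
  then have "\<eta> = 0" using assms sections_deg_neg[of "-1" \<eta>] by simp
  then show ?thesis by simp
next
  case (Suc n)
  then have "\<eta> \<in> Omd (int n)" using assms(1) by simp
  from fwedge_swap[OF this assms(2)] show ?thesis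
    unfolding Omd_fsg[OF assms(2)] by (cases "even l"; simp add: Suc power_add)
qed

lemma ins_wedge_swap:
  assumes "X \<in> S1" "\<mu> \<in> Omd (int k)" "\<nu> \<in> Omd (int l)"
  shows "ii X \<mu> \<^bold>\<and> \<nu> = cscale ((-1) ^ (k * l)) (fsg \<nu> \<^bold>\<and> ii X \<mu>)"
  by (rule wedge_swap_pred[OF ins_sections_deg[OF vb assms(1,2)] assms(3)])

text \<open>The defect of i_Q from being a derivation. On 1-forms it is the pairing of Q with \<mu>
  \<and> \<nu>.\<close>

definition biv :: "'p mvfield \<Rightarrow> 'p mvfield \<Rightarrow> 'p mvfield \<Rightarrow> 'p mvfield" where
  "biv Q \<mu> \<nu> = ii Q (\<mu> \<^bold>\<and> \<nu>) - ii Q \<mu> \<^bold>\<and> \<nu> - \<mu> \<^bold>\<and> ii Q \<nu>"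

lemma biv_decomposable:
  assumes "X \<in> S1" "Y \<in> S1" "\<mu> \<in> Om" "\<nu> \<in> Om"
  shows "biv (X \<^bold>\<and> Y) \<mu> \<nu> = fsg (ii X \<mu>) \<^bold>\<and> ii Y \<nu> - fsg (ii Y \<mu>) \<^bold>\<and> ii X \<nu>"
  using assms by (simp add: biv_def ins_wedge2 ins_wedge_form ins_fsg)

text \<open>This expresses that i_Q is an operator of second order. Both sides are linear over
  functions in Q, and for Q = X \<and> Y the defect is a combination of products of single
  contractions, which are derivations.\<close>

lemma biv_leibniz:
  assumes Q: "Q \<in> S2" and \<mu>: "\<mu> \<in> Omd (int k)" and \<nu>: "\<nu> \<in> Omd (int l)" and \<kappa>: "\<kappa> \<in> Om"
  shows "biv Q \<mu> (\<nu> \<^bold>\<and> \<kappa>) = biv Q \<mu> \<nu> \<^bold>\<and> \<kappa> + cscale ((-1) ^ (k * l)) (\<nu> \<^bold>\<and> biv Q \<mu> \<kappa>)"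
proof -
  have [simp]: "\<mu> \<in> Om" "\<nu> \<in> Om" "\<kappa> \<in> Om" using assms sections_deg_sections by blast+
  have "biv Q \<mu> (\<nu> \<^bold>\<and> \<kappa>) - (biv Q \<mu> \<nu> \<^bold>\<and> \<kappa> + cscale ((-1) ^ (k * l)) (\<nu> \<^bold>\<and> biv Q \<mu> \<kappa>)) = 0"
  proof (rule bivector_zero[OF Q, where T = "\<lambda>Q. biv Q \<mu> (\<nu> \<^bold>\<and> \<kappa>) -
      (biv Q \<mu> \<nu> \<^bold>\<and> \<kappa> + cscale ((-1) ^ (k * l)) (\<nu> \<^bold>\<and> biv Q \<mu> \<kappa>))"])
    fix X Y assume [simp]: "X \<in> S1" "Y \<in> S1"
    have sw: "fsg (ii X \<mu>) \<^bold>\<and> (fsg \<nu> \<^bold>\<and> \<eta>) = cscale ((-1) ^ (k * l)) (\<nu> \<^bold>\<and> (fsg (ii X \<mu>) \<^bold>\<and> \<eta>))"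
      if "X \<in> S1" for X \<eta>
    proof -
      have "fsg (ii X \<mu> \<^bold>\<and> \<nu>) = cscale ((-1) ^ (k * l)) (\<nu> \<^bold>\<and> fsg (ii X \<mu>))"
        unfolding ins_wedge_swap[OF that \<mu> \<nu>] by simp
      then show ?thesis by (simp flip: fwedge_assoc)
    qed
    show "biv (X \<^bold>\<and> Y) \<mu> (\<nu> \<^bold>\<and> \<kappa>) -
        (biv (X \<^bold>\<and> Y) \<mu> \<nu> \<^bold>\<and> \<kappa> + cscale ((-1) ^ (k * l)) (\<nu> \<^bold>\<and> biv (X \<^bold>\<and> Y) \<mu> \<kappa>)) = 0"
      by (simp add: biv_decomposable ins_wedge_form sw fwedge_assoc cscale_distribs algebra_simps)
  qed (simp_all add: biv_def fscale_distribs cscale_distribs algebra_simps)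
  then show ?thesis by simp
qed

subsection \<open>The Lie derivative along a bivector field\<close>

text \<open>This is \<open>lie_deriv\<close> in degree 2, where x = 1 makes the second sign
  negative.\<close>

definition lie2 :: "'p mvfield \<Rightarrow> 'p mvfield \<Rightarrow> 'p mvfield" where
  "lie2 Q \<omega> = ii Q (d \<omega>) - d (ii Q \<omega>)"

lemma lie2_Om [simp, intro]: "Q \<in> S2 \<Longrightarrow> \<omega> \<in> Om \<Longrightarrow> lie2 Q \<omega> \<in> Om"
  by (auto simp: lie2_def)

lemma lie2_add:
  "Q \<in> S2 \<Longrightarrow> \<omega> \<in> Om \<Longrightarrow> \<eta> \<in> Om \<Longrightarrow> lie2 Q (\<omega> + \<eta>) = lie2 Q \<omega> + lie2 Q \<eta>"
  "Q \<in> S2 \<Longrightarrow> \<omega> \<in> Om \<Longrightarrow> \<eta> \<in> Om \<Longrightarrow> lie2 Q (\<omega> - \<eta>) = lie2 Q \<omega> - lie2 Q \<eta>"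
  "Q \<in> S2 \<Longrightarrow> \<omega> \<in> Om \<Longrightarrow> lie2 Q (- \<omega>) = - lie2 Q \<omega>"
  "Q \<in> S2 \<Longrightarrow> \<omega> \<in> Om \<Longrightarrow> lie2 Q (cscale c \<omega>) = cscale c (lie2 Q \<omega>)"
  "Q \<in> S2 \<Longrightarrow> R \<in> S2 \<Longrightarrow> \<omega> \<in> Om \<Longrightarrow> lie2 (Q + R) \<omega> = lie2 Q \<omega> + lie2 R \<omega>"
  by (simp_all add: lie2_def d_add d_diff d_uminus d_cscale cscale_distribs)

lemma lie2_wedge:
  assumes "X \<in> S1" "Y \<in> S1" "\<omega> \<in> Om"
  shows "lie2 (X \<^bold>\<and> Y) \<omega> = ii Y (lie X \<omega>) - lie Y (ii X \<omega>)"
  using assms by (simp add: lie2_def ins_wedge2 lie_def)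

lemma lie_ins': "X \<in> S1 \<Longrightarrow> Y \<in> S1 \<Longrightarrow> \<omega> \<in> Om \<Longrightarrow> lie X (ii Y \<omega>) = ii Y (lie X \<omega>) + ii (br X Y) \<omega>"
  by (simp add: lie_ins)

lemma differential_zero_at:
  assumes "f \<in> Cinf" "open W" "x \<in> W" "\<And>y. y \<in> W \<Longrightarrow> f y = c"
  shows "differential f x = 0"
proof (rule form_zero_at)
  show "ii X (differential f) x = 0" if "X \<in> S1" for X
    using act_local[OF that assms(1) Cinf_closed(5)[of c] assms(2-4)] that assms(1)
    by (simp add: differential fun_field_def scalar_mv_def fun_eq_iff)
qed (use assms Omd_at_empty[OF differential(1)[OF assms(1)]] in auto)

text \<open>\<open>lie2\<close> is of first order in Q and in \<omega>, so a factor \<open>h\<close>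
  enters only through h x and the differential of \<open>h\<close> at x.\<close>

lemma lie2_fscale_at:
  assumes Q: "Q \<in> S2" and \<omega>: "\<omega> \<in> Om" and h: "h \<in> Cinf" "differential h x = 0" "h x = 1"
  shows "lie2 (fscale h Q) \<omega> x = lie2 Q \<omega> x" "lie2 Q (fscale h \<omega>) x = lie2 Q \<omega> x"
proof -
  have z: "(differential h \<^bold>\<and> \<eta>) x = 0" for \<eta> using h(2) by (simp add: fwedge_def)
  show "lie2 (fscale h Q) \<omega> x = lie2 Q \<omega> x"
    using assms z by (simp add: lie2_def d_fscale fscale_apply)
  have "ii Q (differential h \<^bold>\<and> \<omega>) x = 0" unfolding ins_def using z by simp
  then show "lie2 Q (fscale h \<omega>) x = lie2 Q \<omega> x"
    using assms z by (simp add: lie2_def d_fscale fscale_apply)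
qed

end

section \<open>The Schouten bracket as a derived bracket\<close>

locale algebroid_schouten = algebroid E br \<rho>
  for E :: "('p::{t2_space,second_countable_topology}, 'b::real_inner) vbundle"
    and br :: "'p mvfield \<Rightarrow> 'p mvfield \<Rightarrow> 'p mvfield" and \<rho> :: "'p anchor" +
  fixes S :: "'p mvfield \<Rightarrow> 'p mvfield \<Rightarrow> 'p mvfield"
  assumes schouten: "schouten_bracket E br \<rho> S"
begin

lemma S_bilinear:
  assumes "X \<in> sections E" "Y \<in> sections E" "Z \<in> sections E"
  shows "S (X + Y) Z = S X Z + S Y Z" "S X (Y + Z) = S X Y + S X Z"
    "S (cscale c X) Y = cscale c (S X Y)" "S X (cscale c Y) = cscale c (S X Y)"
  using schouten assms unfolding schouten_bracket_def by blast+

lemma S_deg: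
  assumes "X \<in> sections_deg E k" "Y \<in> sections_deg E l"
  shows "S X Y \<in> sections_deg E (k + l - 1)" "S X Y = - cscale ((-1) powi ((k - 1) * (l - 1))) (S Y X)"
    "Z \<in> sections E \<Longrightarrow> S X (Y \<^bold>\<and> Z) = S X Y \<^bold>\<and> Z + cscale ((-1) powi ((k - 1) * l)) (Y \<^bold>\<and> S X Z)"
  using schouten assms unfolding schouten_bracket_def by blast+

lemma S_br: "X \<in> S1 \<Longrightarrow> Y \<in> S1 \<Longrightarrow> S X Y = br X Y"
  using schouten unfolding schouten_bracket_def by blast

text \<open>The axioms give the Leibniz rule in the second argument; graded skew-symmetry carries it
  over to the first.\<close>

lemma S_bivector_vector:
  assumes "X \<in> S1" "Y \<in> S1" "Z \<in> S1"
  shows "S (X \<^bold>\<and> Y) Z = br X Z \<^bold>\<and> Y + X \<^bold>\<and> br Y Z"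
proof -
  have "S (X \<^bold>\<and> Y) Z = - S Z (X \<^bold>\<and> Y)"
    using S_deg(2)[of "X \<^bold>\<and> Y" 2 Z 1] assms by simp
  also have "S Z (X \<^bold>\<and> Y) = br Z X \<^bold>\<and> Y + X \<^bold>\<and> br Z Y"
    using S_deg(3)[of Z 1 X 1 Y] assms by (simp add: S_br S1_sections)
  also have "- (br Z X \<^bold>\<and> Y + X \<^bold>\<and> br Z Y) = br X Z \<^bold>\<and> Y + X \<^bold>\<and> br Y Z"
    using assms br_skew[of Z X] br_skew[of Z Y] by simp
  finally show ?thesis .
qed

lemma S_bivectors:
  assumes "X \<in> S1" "Y \<in> S1" "Z \<in> S1" "W \<in> S1"
  shows "S (X \<^bold>\<and> Y) (Z \<^bold>\<and> W) = br X Z \<^bold>\<and> Y \<^bold>\<and> W + X \<^bold>\<and> br Y Z \<^bold>\<and> W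
    - Z \<^bold>\<and> br X W \<^bold>\<and> Y - Z \<^bold>\<and> X \<^bold>\<and> br Y W"
  using S_deg(3)[of "X \<^bold>\<and> Y" 2 Z 1 W] assms
  by (simp add: S_bivector_vector S1_sections fwedge_assoc algebra_simps)

text \<open>Moving i_X, i_Y or i_[Y,X] past the pair i_W i_Z costs no sign, so all terms with L_X,
  L_Y or [Y,X] cancel. What remains are the brackets of X and Y with Z and W, the four terms of
  \<open>S_bivectors\<close>.\<close>

lemma derived_bracket_decomposable:
  assumes [simp]: "X \<in> S1" "Y \<in> S1" "Z \<in> S1" "W \<in> S1" "\<omega> \<in> Om"
  shows "lie2 (X \<^bold>\<and> Y) (ii (Z \<^bold>\<and> W) \<omega>) - ii (Z \<^bold>\<and> W) (lie2 (X \<^bold>\<and> Y) \<omega>) +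
    ii (S (X \<^bold>\<and> Y) (Z \<^bold>\<and> W)) \<omega> = 0"
proof -
  have sw: "ii B (ii A \<eta>) = - ii A (ii B \<eta>)" if "A \<in> S1" "B \<in> S1" "\<eta> \<in> Om" for A B \<eta>
    using ins_swap that by blast
  have 1: "lie2 (X \<^bold>\<and> Y) (ii (Z \<^bold>\<and> W) \<omega>) - ii (Z \<^bold>\<and> W) (lie2 (X \<^bold>\<and> Y) \<omega>) =
      ii Y (ii W (ii Z (lie X \<omega>))) - ii W (ii Z (ii Y (lie X \<omega>)))
      - (ii X (ii W (ii Z (lie Y \<omega>))) - ii W (ii Z (ii X (lie Y \<omega>))))
      - (ii (br Y X) (ii W (ii Z \<omega>)) - ii W (ii Z (ii (br Y X) \<omega>)))
      + ii Y (ii W (ii (br X Z) \<omega>)) + ii Y (ii (br X W) (ii Z \<omega>))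
      - ii X (ii (br Y W) (ii Z \<omega>)) - ii X (ii W (ii (br Y Z) \<omega>))"
    by (simp add: lie2_wedge ins_wedge2 lie_ins' algebra_simps)
  have 2: "ii A (ii W (ii Z \<eta>)) = ii W (ii Z (ii A \<eta>))" if "A \<in> S1" "\<eta> \<in> Om" for A \<eta>
    using that by (simp add: sw[of W A] sw[of Z A])
  have 3: "ii (S (X \<^bold>\<and> Y) (Z \<^bold>\<and> W)) \<omega> = ii W (ii Y (ii (br X Z) \<omega>)) + ii W (ii (br Y Z) (ii X \<omega>))
      - ii Y (ii (br X W) (ii Z \<omega>)) - ii (br Y W) (ii X (ii Z \<omega>))"
    by (simp add: S_bivectors ins_wedge[OF vb])
  have 4: "ii W (ii Y (ii (br X Z) \<omega>)) = - ii Y (ii W (ii (br X Z) \<omega>))"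
    "ii (br Y W) (ii X (ii Z \<omega>)) = - ii X (ii (br Y W) (ii Z \<omega>))"
    "ii W (ii (br Y Z) (ii X \<omega>)) = ii X (ii W (ii (br Y Z) \<omega>))"
    using sw[of Y W] sw[of X "br Y W"] sw[of X "br Y Z"] sw[of X W] by simp_all
  show ?thesis unfolding 1 3 4 by (simp add: 2)
qed

text \<open>Only additivity in Q and R is established for it, not linearity over functions. Hence
  \<open>derived_bracket\<close> does not go through \<open>bivector_zero\<close>, but argues with a
  cutoff at one point.\<close>

definition derived_defect :: "'p mvfield \<Rightarrow> 'p mvfield \<Rightarrow> 'p mvfield \<Rightarrow> 'p mvfield" where
  "derived_defect \<omega> Q R = lie2 Q (ii R \<omega>) - ii R (lie2 Q \<omega>) + ii (S Q R) \<omega>"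

lemma derived_defect_add:
  assumes "Q \<in> S2" "Q' \<in> S2" "R \<in> S2" "R' \<in> S2" "\<omega> \<in> Om"
  shows "derived_defect \<omega> (Q + Q') R = derived_defect \<omega> Q R + derived_defect \<omega> Q' R"
    "derived_defect \<omega> Q (R + R') = derived_defect \<omega> Q R + derived_defect \<omega> Q R'"
  using assms by (simp_all add: derived_defect_def lie2_add S_bilinear S2_sections algebra_simps)

text \<open>The axioms give no formula for the bracket of a bivector field with a function. But S A
  f is a vector field, so by the Leibniz axiom each of its components at x is a derivation at x,
  which is local and kills constants.\<close>

lemma S_fun_at:
  assumes A: "A \<in> S2" and h: "h \<in> Cinf" and W: "open W" "x \<in> W" "\<And>y. y \<in> W \<Longrightarrow> h y = 1"
  shows "S A (fun_field h) x = 0"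
proof
  fix I
  let ?D = "\<lambda>f. S A (fun_field f) x I"
  have fd: "fun_field f \<in> sections_deg E 0" "fun_field f \<in> sections E" if "f \<in> Cinf" for f
    using that fun_field_sections_deg sections_fun_field by blast+
  have SA: "S A (fun_field f) \<in> sections_deg E 1" if "f \<in> Cinf" for f
    using S_deg(1)[OF A fd(1)[OF that]] by simp
  have "?D \<in> tangent_space (charts E) x"
    unfolding tangent_space_def
  proof (intro CollectI ballI allI conjI)
    fix f g c assume f: "f \<in> Cinf" and g: "g \<in> Cinf"
    have "fun_field (\<lambda>y. f y + g y) = fun_field f + fun_field g" "fun_field (\<lambda>y. c * f y) = cscale c (fun_field f)"
      by (auto simp: fun_field_def scalar_mv_def cscale_def fun_eq_iff)
    then show "?D (\<lambda>y. f y + g y) = ?D f + ?D g" "?D (\<lambda>y. c * f y) = c * ?D f"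
      using S_bilinear(2)[OF _ fd(2)[OF f] fd(2)[OF g], of A] S_bilinear(4)[OF _ fd(2)[OF f] fd(2)[OF f], of A c]
        S2_sections[OF A] by (simp_all add: cscale_apply smv_apply)
    have "fun_field (\<lambda>y. f y * g y) = fun_field f \<^bold>\<and> fun_field g"
      using fun_field_wedge[OF vb fd(2)[OF g], of f] by (auto simp: fun_field_def scalar_mv_def fscale_def fun_eq_iff)
    moreover have "S A (fun_field f \<^bold>\<and> fun_field g) = fscale g (S A (fun_field f)) + fscale f (S A (fun_field g))"
      using S_deg(3)[OF A fd(1)[OF f] fd(2)[OF g]] wedge_fun_field_right[OF SA[OF f] g]
        fun_field_wedge[OF vb S1_sections[OF SA[OF g]], of f] by simp
    ultimately show "?D (\<lambda>y. f y * g y) = f x * ?D g + g x * ?D f"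
      by (simp add: fscale_apply smv_apply)
  qed
  note D = this
  have "?D h = ?D (\<lambda>_. 1)"
    using tangent_local[OF vector_bundle_atlas[OF vb] D h smooth_funs_const[of 1] W] by simp
  moreover have "?D (\<lambda>_. 1) = 0"
    using tangent_const[OF D, of 1] by simp
  ultimately show "S A (fun_field h) x I = 0 I" by simp
qed

lemma S_fscale_at:
  assumes A: "A \<in> S2" and Q: "Q \<in> S2" and h: "h \<in> Cinf" and W: "open W" "x \<in> W" "\<And>y. y \<in> W \<Longrightarrow> h y = 1"
  shows "S A (fscale h Q) x = S A Q x"
proof -
  have "S A (fun_field h \<^bold>\<and> Q) = S A (fun_field h) \<^bold>\<and> Q + fun_field h \<^bold>\<and> S A Q"
    using S_deg(3)[OF A fun_field_sections_deg[OF h] S2_sections[OF Q]] by simp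
  moreover have "S A Q \<in> sections E" using S_deg(1)[OF A Q] by (rule sections_deg_sections)
  ultimately have "S A (fscale h Q) = S A (fun_field h) \<^bold>\<and> Q + fscale h (S A Q)"
    using fun_field_wedge[OF vb] S2_sections[OF Q] by simp
  then show ?thesis using S_fun_at[OF A h W] W by (simp add: fwedge_def fscale_apply)
qed

text \<open>The field h Q is a finite sum of decomposable fields, so its defect vanishes by
  biadditivity; and at x each of the three terms is the same for h Q as for Q.\<close>

theorem derived_bracket:
  assumes Q: "Q \<in> S2" and \<omega>: "\<omega> \<in> Om"
  shows "lie2 Q (ii Q \<omega>) - ii Q (lie2 Q \<omega>) = - ii (S Q Q) \<omega>"
proof
  fix x
  obtain h W X Y where h: "h \<in> Cinf" "open W" "x \<in> W" "\<And>y. y \<in> W \<Longrightarrow> h y = 1"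
    "\<And>i. i < fibre_dim E \<Longrightarrow> X i \<in> S1" "\<And>i. i < fibre_dim E \<Longrightarrow> Y i \<in> S1"
    "fscale h Q = (\<Sum>i<fibre_dim E. X i \<^bold>\<and> Y i)"
    by (rule bivector_local[OF Q, of x]) blast
  have part: "(\<Sum>i<m. X i \<^bold>\<and> Y i) \<in> S2" if "m \<le> fibre_dim E" for m
    using that h(5,6) by (intro sections_deg_sum) auto
  have zero: "derived_defect \<omega> 0 R = 0" "derived_defect \<omega> R 0 = 0" if "R \<in> S2" for R
    using derived_defect_add[OF S2_closed(3) S2_closed(3) that that \<omega>]
      derived_defect_add(2)[OF that that S2_closed(3) S2_closed(3) \<omega>] by simp_all
  have right: "derived_defect \<omega> (A \<^bold>\<and> B) (\<Sum>i<m. X i \<^bold>\<and> Y i) = 0"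
    if "A \<in> S1" "B \<in> S1" "m \<le> fibre_dim E" for A B m
    using that(3)
  proof (induction m)
    case (Suc m)
    then have m: "X m \<in> S1" "Y m \<in> S1" "m \<le> fibre_dim E" using h(5,6) by auto
    have "derived_defect \<omega> (A \<^bold>\<and> B) (X m \<^bold>\<and> Y m) = 0"
      using derived_bracket_decomposable[OF that(1,2) m(1,2) \<omega>] by (simp add: derived_defect_def)
    then show ?case
      using derived_defect_add(2)[OF wedge_S2[OF that(1,2)] S2_closed(3) part[OF m(3)] wedge_S2[OF m(1,2)] \<omega>]
        Suc.IH[OF m(3)] by (simp only: sum.lessThan_Suc) simp
  qed (use zero that in simp)
  have "derived_defect \<omega> (\<Sum>i<m. X i \<^bold>\<and> Y i) (fscale h Q) = 0" if "m \<le> fibre_dim E" for m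
    using that
  proof (induction m)
    case (Suc m)
    then have m: "X m \<in> S1" "Y m \<in> S1" "m \<le> fibre_dim E" using h(5,6) by auto
    then show ?case
      using derived_defect_add(1)[OF part[OF m(3)] wedge_S2[OF m(1,2)] S2_closed(2)[OF h(1) Q] S2_closed(3) \<omega>]
        Suc.IH[OF m(3)] right[OF m(1,2) order_refl] by (simp only: sum.lessThan_Suc h(7)) simp
  qed (use zero Q h(1) in simp)
  from this[OF order_refl] have "derived_defect \<omega> (fscale h Q) (fscale h Q) = 0"
    by (simp only: h(7))
  then have "derived_defect \<omega> (fscale h Q) (fscale h Q) x = 0" by simp
  moreover have dh: "differential h x = 0" using differential_zero_at h(1-4) by blast
  have hx: "h x = 1" using h by blast
  have hQ: "fscale h Q \<in> S2" by (rule S2_closed(2)[OF h(1) Q])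
  have "lie2 (fscale h Q) (ii (fscale h Q) \<omega>) x = lie2 Q (ii Q \<omega>) x"
    using lie2_fscale_at(1)[OF Q _ h(1) dh hx, of "fscale h (ii Q \<omega>)"] lie2_fscale_at(2)[OF Q _ h(1) dh hx, of "ii Q \<omega>"]
      Q \<omega> h(1) by simp
  moreover have "ii (fscale h Q) (lie2 (fscale h Q) \<omega>) x = ii Q (lie2 Q \<omega>) x"
    using lie2_fscale_at(1)[OF Q \<omega> h(1) dh hx] by (simp add: ins_def fscale_apply hx)
  moreover have "S (fscale h Q) (fscale h Q) x = S Q Q x"
  proof -
    \<comment> \<open>One factor at a time; in between the arguments are exchanged, as the bracket
      of two bivector fields is symmetric (both shifted degrees are 1).\<close>
    have "S (fscale h Q) (fscale h Q) x = S (fscale h Q) Q x" by (rule S_fscale_at[OF hQ Q h(1-4)])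
    also have "\<dots> = S Q (fscale h Q) x" using S_deg(2)[OF hQ Q] by simp
    also have "\<dots> = S Q Q x" by (rule S_fscale_at[OF Q Q h(1-4)])
    finally show ?thesis .
  qed
  then have "ii (S (fscale h Q) (fscale h Q)) \<omega> x = ii (S Q Q) \<omega> x" by (simp add: ins_def)
  ultimately show "(lie2 Q (ii Q \<omega>) - ii Q (lie2 Q \<omega>)) x = (- ii (S Q Q) \<omega>) x"
    by (simp add: derived_defect_def del: ins_linear) (simp add: eq_neg_iff_add_eq_0)
qed

end

section \<open>The homology operator\<close>

lemma fweight_linear [simp]:
  "fweight w (X + Y) = fweight w X + fweight w Y" "fweight w (cscale c X) = cscale c (fweight w X)"
  "fweight w (X - Y) = fweight w X - fweight w Y" "fweight w (- X) = - fweight w X" "fweight w 0 = 0"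
  by (simp_all add: fweight_def cscale_def fun_eq_iff algebra_simps)

lemma fweight_real_deg: "s \<in> sections_deg E k \<Longrightarrow> fweight real s = cscale (real_of_int k) s"
proof (intro ext)
  fix x I assume s: "s \<in> sections_deg E k"
  show "fweight real s x I = cscale (real_of_int k) s x I"
  proof (cases "s x I = 0")
    case False
    then have "k = int (card I)" using s by (auto simp: sections_deg_def)
    then show ?thesis by (simp add: fweight_def cscale_def)
  qed (simp add: fweight_def cscale_def)
qed

lemma cscale_cancel:
  "cscale a X + cscale (- a) X = 0" "cscale a X + (cscale (- a) X + Y) = Y"
  by (simp_all add: cscale_def fun_eq_iff algebra_simps)

lemma self_neg: "(a :: 'p mvfield) = - a \<Longrightarrow> a = 0"
proof (intro ext)
  fix x I assume "a = - a"
  then have "a x I = - a x I" by (metis uminus_apply)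
  then show "a x I = 0 x I" by simp
qed

locale jacobi_algebroid = algebroid_schouten E br \<rho> S
  for E :: "('p::{t2_space,second_countable_topology}, 'b::real_inner) vbundle"
    and br S :: "'p mvfield \<Rightarrow> 'p mvfield \<Rightarrow> 'p mvfield" and \<rho> :: "'p anchor" +
  fixes \<Phi> P :: "'p mvfield"
  assumes Phi [simp, intro]: "\<Phi> \<in> sections_deg (dual_bundle E) 1" and d_Phi [simp]: "ext_deriv E br \<rho> \<Phi> = 0"
    and P [simp, intro]: "P \<in> sections_deg E 2" and jacobi: "schouten_jacobi E S \<Phi> 2 2 P P = 0"
begin

abbreviation "V \<equiv> ins E \<Phi> P"
abbreviation "p \<equiv> ins E P"
abbreviation "v \<equiv> ins E V"
abbreviation "L \<equiv> lie2 P"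
abbreviation "N \<equiv> fweight real"

lemma Phi_Om [simp, intro]: "\<Phi> \<in> Om"
  using Phi by (rule sections_deg_sections)

lemma V_S1 [simp, intro]: "V \<in> S1"
  by (rule ins_form_S1) auto

lemma Phi_Phi: "\<Phi> \<^bold>\<and> \<Phi> = 0"
  using fwedge_swap[of \<Phi> "dual_bundle E" 1 \<Phi> 1] by (intro self_neg) simp

lemma V_Phi: "v \<Phi> = 0"
  using ins_sym[OF V_S1 Phi] ins_wedge[OF vb, of P \<Phi> \<Phi>] S2_sections[OF P] by (simp add: Phi_Phi)

lemma Phi_rules [simp]:
  assumes "\<omega> \<in> Om"
  shows "p (\<Phi> \<^bold>\<and> \<omega>) = v \<omega> + \<Phi> \<^bold>\<and> p \<omega>" "v (\<Phi> \<^bold>\<and> \<omega>) = - (\<Phi> \<^bold>\<and> v \<omega>)" "\<Phi> \<^bold>\<and> (\<Phi> \<^bold>\<and> \<omega>) = 0"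
    "d (\<Phi> \<^bold>\<and> \<omega>) = - (\<Phi> \<^bold>\<and> d \<omega>)"
proof -
  show "p (\<Phi> \<^bold>\<and> \<omega>) = v \<omega> + \<Phi> \<^bold>\<and> p \<omega>" by (rule ins2_form_wedge) (use assms in auto)
  show "v (\<Phi> \<^bold>\<and> \<omega>) = - (\<Phi> \<^bold>\<and> v \<omega>)" by (simp add: ins_wedge_form V_Phi Omd1_fsg)
  show "\<Phi> \<^bold>\<and> (\<Phi> \<^bold>\<and> \<omega>) = 0" by (simp add: Phi_Phi flip: fwedge_assoc)
  show "d (\<Phi> \<^bold>\<and> \<omega>) = - (\<Phi> \<^bold>\<and> d \<omega>)" using assms by (simp add: d_wedge Omd1_fsg)
qed

lemma pv: "\<omega> \<in> Om \<Longrightarrow> v (p \<omega>) = p (v \<omega>)"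
  using ins_wedge2[of \<omega> P V] ins_wedge2[of \<omega> V P] fwedge_swap[of P E 2 V 1] by simp

lemma vv: "\<omega> \<in> Om \<Longrightarrow> v (v \<omega>) = 0"
  by (rule ins_self) auto

text \<open>For k = l = 2 the two corrections in the Schouten-Jacobi bracket are P \<and> V and V
  \<and> P, both with a positive sign, and they coincide because P has even degree.\<close>

lemma S_P_P: "S P P = - cscale 2 (V \<^bold>\<and> P)"
proof -
  have "P \<^bold>\<and> V = V \<^bold>\<and> P" using fwedge_swap[of P E 2 V 1] by simp
  then have "S P P + cscale 2 (V \<^bold>\<and> P) = schouten_jacobi E S \<Phi> 2 2 P P"
    by (intro ext) (simp add: schouten_jacobi_def cscale_apply smv_apply)
  then have "S P P + cscale 2 (V \<^bold>\<and> P) = 0" unfolding jacobi .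
  then show ?thesis by (rule eq_neg_iff_add_eq_0[THEN iffD2])
qed

lemma L_p: "\<omega> \<in> Om \<Longrightarrow> L (p \<omega>) = p (L \<omega>) + cscale 2 (p (v \<omega>))"
proof -
  assume \<omega>: "\<omega> \<in> Om"
  have "L (p \<omega>) = p (L \<omega>) + (L (p \<omega>) - p (L \<omega>))" by simp
  also have "L (p \<omega>) - p (L \<omega>) = cscale 2 (p (v \<omega>))"
    unfolding derived_bracket[OF P \<omega>] S_P_P using \<omega> by (simp add: ins_wedge2)
  finally show ?thesis .
qed

text \<open>As \<Phi> is closed, d anticommutes with the product by \<Phi>, while i_P produces an
  additional i_V; the two terms combining d with i_V form the Lie derivative along V.\<close>

lemma L_Phi: "\<omega> \<in> Om \<Longrightarrow> L (\<Phi> \<^bold>\<and> \<omega>) = - lie V \<omega> - \<Phi> \<^bold>\<and> L \<omega>"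
  by (simp add: lie2_def lie_def d_add d_diff algebra_simps)

text \<open>The relation \<open>[L\<^sub>P, i\<^sub>P] = 2 i\<^sub>P i\<^sub>V\<close>, applied to \<open>\<Phi> \<and> \<omega>\<close>, identifies \<open>L\<^sub>P i\<^sub>V + i\<^sub>V L\<^sub>P\<close> with
  \<open>[L\<^sub>V, i\<^sub>P]\<close>, whereas by definition it is the negative of it.\<close>

lemma L_v: "\<omega> \<in> Om \<Longrightarrow> L (v \<omega>) = - v (L \<omega>)"
proof -
  assume [simp]: "\<omega> \<in> Om"
  let ?a = "L (v \<omega>) + v (L \<omega>)" and ?k = "lie V (p \<omega>) - p (lie V \<omega>)"
  have 1: "L (p (\<Phi> \<^bold>\<and> \<omega>)) = L (v \<omega>) - lie V (p \<omega>) - \<Phi> \<^bold>\<and> p (L \<omega>) - cscale 2 (\<Phi> \<^bold>\<and> p (v \<omega>))"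
    by (simp add: lie2_add L_Phi L_p algebra_simps)
  have 2: "p (L (\<Phi> \<^bold>\<and> \<omega>)) + cscale 2 (p (v (\<Phi> \<^bold>\<and> \<omega>))) =
      - p (lie V \<omega>) - v (L \<omega>) - \<Phi> \<^bold>\<and> p (L \<omega>) - cscale 2 (\<Phi> \<^bold>\<and> p (v \<omega>))"
    by (simp add: L_Phi vv cscale_distribs cscale_cancel algebra_simps)
  have "?a - ?k = L (p (\<Phi> \<^bold>\<and> \<omega>)) - (p (L (\<Phi> \<^bold>\<and> \<omega>)) + cscale 2 (p (v (\<Phi> \<^bold>\<and> \<omega>))))"
    unfolding 1 2 by (intro ext) (simp add: algebra_simps)
  also have "\<dots> = 0" by (simp add: L_p del: Phi_rules)
  finally have "?a = ?k" by (rule eq_iff_diff_eq_0[THEN iffD2])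
  moreover have "?k = - ?a"
    by (simp add: lie2_def lie_def pv d_diff algebra_simps)
  ultimately have "?a = - ?a" by (simp only:)
  then have "?a = 0" by (rule self_neg)
  then show "L (v \<omega>) = - v (L \<omega>)" by (rule eq_neg_iff_add_eq_0[THEN iffD2])
qed

text \<open>The relation \<open>L_p\<close> expresses 2 p d p through d p p, p p d and p v. Since d
  d = 0, substituting it twice into 2 L L makes the terms d p p d cancel.\<close>

lemma L_L: "\<omega> \<in> Om \<Longrightarrow> L (L \<omega>) = p (v (d \<omega>)) + d (p (v \<omega>))"
proof -
  assume [simp]: "\<omega> \<in> Om"
  have pdp: "cscale 2 (p (d (p \<eta>))) = d (p (p \<eta>)) + p (p (d \<eta>)) + cscale 2 (p (v \<eta>))" if "\<eta> \<in> Om" for \<eta>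
  proof -
    have "cscale 2 (p (d (p \<eta>))) - d (p (p \<eta>)) - p (p (d \<eta>)) = L (p \<eta>) - p (L \<eta>)"
      by (intro ext) (simp add: lie2_def cscale_apply smv_apply)
    also have "\<dots> = cscale 2 (p (v \<eta>))" by (simp add: L_p that)
    finally show ?thesis by (simp only: diff_eq_eq ac_simps)
  qed
  have "cscale 2 (L (L \<omega>)) = cscale 2 (p (d (p (d \<omega>)))) - cscale 2 (d (p (p (d \<omega>)))) + d (cscale 2 (p (d (p \<omega>))))"
    by (simp add: lie2_def d_diff d_d d_cscale cscale_distribs algebra_simps)
  also have "\<dots> = cscale 2 (p (v (d \<omega>)) + d (p (v \<omega>)))"
    unfolding pdp[OF d_Om[OF \<open>\<omega> \<in> Om\<close>]] pdp[OF \<open>\<omega> \<in> Om\<close>]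
    by (intro ext) (simp add: d_d d_add d_cscale cscale_apply smv_apply algebra_simps)
  finally have "cscale (1/2) (cscale 2 (L (L \<omega>))) = cscale (1/2) (cscale 2 (p (v (d \<omega>)) + d (p (v \<omega>))))"
    by (simp only:)
  then show ?thesis by (simp only: cscale_simps) simp
qed

section \<open>The degree operator and the square of the homology operator\<close>

lemma N_shift:
  assumes "\<omega> \<in> Om" and T: "\<And>k \<omega>. \<omega> \<in> Omd k \<Longrightarrow> T \<omega> \<in> Omd (k + j)"
    and add: "\<And>\<omega> \<eta>. \<omega> \<in> Om \<Longrightarrow> \<eta> \<in> Om \<Longrightarrow> T (\<omega> + \<eta>) = T \<omega> + T \<eta>"
    and scale: "\<And>c \<omega>. \<omega> \<in> Om \<Longrightarrow> T (cscale c \<omega>) = cscale c (T \<omega>)"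
  shows "N (T \<omega>) = T (N \<omega>) + cscale (real_of_int j) (T \<omega>)"
  using assms(1)
proof (induction \<omega> rule: Om_deg_induct)
  case (deg k \<omega>)
  then show ?case
    using fweight_real_deg[OF T[OF deg]] fweight_real_deg[OF deg] scale[OF sections_deg_sections[OF deg]]
    by (simp add: cscale_distribs)
next
  case (add \<omega> \<eta>)
  have IH: "N (T \<omega>) = T (N \<omega>) + cscale (real_of_int j) (T \<omega>)" "N (T \<eta>) = T (N \<eta>) + cscale (real_of_int j) (T \<eta>)"
    by (rule add)+
  have "N (T (\<omega> + \<eta>)) = T (N (\<omega> + \<eta>)) + cscale (real_of_int j) (T (\<omega> + \<eta>))"
    using add(1,2) by (simp add: assms(3) IH cscale_distribs)
  then show ?case .
qed

lemma L_deg: "\<omega> \<in> Omd k \<Longrightarrow> L \<omega> \<in> Omd (k - 1)"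
  using ins2_sections_deg[OF P d_sections_deg[of \<omega> k]] d_sections_deg[OF ins2_sections_deg[OF P, of \<omega> k]]
  unfolding lie2_def by (intro sections_deg_linear(2)) (simp_all add: algebra_simps)

lemma v_deg: "\<omega> \<in> Omd k \<Longrightarrow> v \<omega> \<in> Omd (k - 1)"
  by (rule ins_sections_deg[OF vb V_S1])

lemma Phi_p_deg: "\<omega> \<in> Omd k \<Longrightarrow> \<Phi> \<^bold>\<and> p \<omega> \<in> Omd (k - 1)"
  using fwedge_sections_deg[OF Phi ins2_sections_deg[OF P, of \<omega> k]] by simp

lemma N_rules:
  assumes "\<omega> \<in> Om"
  shows "N (L \<omega>) = L (N \<omega>) - L \<omega>" "N (v \<omega>) = v (N \<omega>) - v \<omega>" "N (\<Phi> \<^bold>\<and> p \<omega>) = \<Phi> \<^bold>\<and> p (N \<omega>) - \<Phi> \<^bold>\<and> p \<omega>"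
  using N_shift[OF assms, of L "-1"] N_shift[OF assms, of v "-1"] N_shift[OF assms, of "\<lambda>\<omega>. \<Phi> \<^bold>\<and> p \<omega>" "-1"]
    L_deg v_deg Phi_p_deg lie2_add[OF P] by simp_all

text \<open>The operator of the theorem with |\<mu>| replaced by the operator \<open>N\<close>,
  which stands to the right of \<open>v\<close> because it refers to the degree before the
  contraction. \<open>hom_op_eq\<close> identifies the two.\<close>

definition D :: "real \<Rightarrow> 'p mvfield \<Rightarrow> 'p mvfield" where
  "D a \<omega> = L \<omega> + v (N \<omega> + cscale a \<omega>) + \<Phi> \<^bold>\<and> p \<omega>"

lemma D_Om [simp, intro]: "\<omega> \<in> Om \<Longrightarrow> D a \<omega> \<in> Om"
  by (auto simp: D_def)

lemma D_add: "\<omega> \<in> Om \<Longrightarrow> \<eta> \<in> Om \<Longrightarrow> D a (\<omega> + \<eta>) = D a \<omega> + D a \<eta>"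
  by (simp add: D_def lie2_add cscale_distribs algebra_simps)

lemma D_cscale: "\<omega> \<in> Om \<Longrightarrow> D a (cscale c \<omega>) = cscale c (D a \<omega>)"
  by (simp add: D_def lie2_add cscale_distribs algebra_simps)

lemma D_deg: "\<omega> \<in> Omd k \<Longrightarrow> D a \<omega> \<in> Omd (k - 1)"
  unfolding D_def using fweight_real_deg[of \<omega> "dual_bundle E" k]
  by (intro sections_deg_linear(1) L_deg Phi_p_deg v_deg) (auto intro: sections_deg_linear)

theorem D_D:
  assumes [simp]: "\<omega> \<in> Om"
  shows "D a (D a \<omega>) = 0"
proof -
  have 1: "L (D a \<omega>) = L (L \<omega>) - v (L (N \<omega>)) - cscale a (v (L \<omega>)) - lie V (p \<omega>) - \<Phi> \<^bold>\<and> p (L \<omega>)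
      - cscale 2 (\<Phi> \<^bold>\<and> p (v \<omega>))"
    by (simp add: D_def lie2_add L_v L_Phi L_p cscale_distribs cscale_cancel algebra_simps)
  have 2: "v (N (D a \<omega>) + cscale a (D a \<omega>)) = v (L (N \<omega>)) - v (L \<omega>) - \<Phi> \<^bold>\<and> p (v (N \<omega>)) + \<Phi> \<^bold>\<and> p (v \<omega>)
      + cscale a (v (L \<omega>)) - cscale a (\<Phi> \<^bold>\<and> p (v \<omega>))"
  proof -
    \<comment> \<open>N (v \<eta>) is again v of some form, so another v kills it; hence nothing
      quadratic in N + a survives.\<close>
    have nv: "v (N (v \<eta>)) = 0" if "\<eta> \<in> Om" for \<eta> using that by (simp add: N_rules vv)
    have "v (N (D a \<omega>) + cscale a (D a \<omega>)) = v (N (L \<omega>)) + v (N (v (N \<omega> + cscale a \<omega>))) + v (N (\<Phi> \<^bold>\<and> p \<omega>))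
        + cscale a (v (L \<omega>)) + cscale a (v (v (N \<omega> + cscale a \<omega>))) + cscale a (v (\<Phi> \<^bold>\<and> p \<omega>))"
      unfolding D_def by (simp only: fweight_linear ins_linear cscale_distribs ac_simps)
    also have "\<dots> = v (N (L \<omega>)) + v (N (\<Phi> \<^bold>\<and> p \<omega>)) + cscale a (v (L \<omega>)) + cscale a (v (\<Phi> \<^bold>\<and> p \<omega>))"
      by (simp only: nv vv Om_closed V_S1 assms cscale_simps add_0_right)
    finally show ?thesis by (simp add: N_rules pv)
  qed
  have 3: "\<Phi> \<^bold>\<and> p (D a \<omega>) = \<Phi> \<^bold>\<and> p (L \<omega>) + \<Phi> \<^bold>\<and> p (v (N \<omega>)) + cscale a (\<Phi> \<^bold>\<and> p (v \<omega>)) + \<Phi> \<^bold>\<and> p (v \<omega>)"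
    by (simp add: D_def pv cscale_distribs algebra_simps)
  \<comment> \<open>The terms with \<open>a\<close>, with \<open>N\<close> and with \<Phi> cancel
    between the three expansions; - v (L \<omega>) is left over from the commutator of
    \<open>N\<close> and \<open>L\<close>.\<close>
  have "D a (D a \<omega>) = L (L \<omega>) - lie V (p \<omega>) - v (L \<omega>)"
    unfolding D_def[of a "D a \<omega>"] 1 2 3 by (intro ext) (simp add: cscale_apply smv_apply algebra_simps)
  \<comment> \<open>By \<open>L_L\<close> this is p v d + d p v - (v d p + d v p) - v (p d - d p),
    and \<open>p\<close> commutes with \<open>v\<close>.\<close>
  also have "\<dots> = 0"
    unfolding L_L[OF assms] by (simp add: lie_def lie2_def pv algebra_simps)
  finally show ?thesis .
qed

end

section \<open>The generated bracket\<close>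

context jacobi_algebroid
begin

lemma hom_op_eq:
  assumes "\<mu> \<in> Om"
  shows "hom_op E br \<rho> \<Phi> a P \<mu> = D a \<mu>"
proof -
  let ?r = "fibre_dim E"
  have dp: "deg_part k \<mu> \<in> Om" for k using deg_part_sections[OF assms] by (rule sections_deg_sections)
  have s1: "(\<Sum>k\<le>?r. deg_part k \<mu>) = \<mu>"
    using sum_deg_part[OF vbd, of \<mu> "\<lambda>_. 1"] assms by (simp add: fweight_def)
  have s2: "(\<Sum>k\<le>?r. cscale (real k + a) (deg_part k \<mu>)) = N \<mu> + cscale a \<mu>"
    using sum_deg_part[OF vbd, of \<mu> "\<lambda>k. real k + a"] assms
    by (simp add: fweight_def fun_eq_iff cscale_def algebra_simps)
  have "hom_op E br \<rho> \<Phi> a P \<mu> = (\<Sum>k\<le>?r. p (d (deg_part k \<mu>)) - d (p (deg_part k \<mu>))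
      + v (cscale (real k + a) (deg_part k \<mu>)) + \<Phi> \<^bold>\<and> p (deg_part k \<mu>))"
    by (simp add: hom_op_def hom_op_deg_def lie_deriv_def)
  also have "\<dots> = p (d (\<Sum>k\<le>?r. deg_part k \<mu>)) - d (p (\<Sum>k\<le>?r. deg_part k \<mu>))
      + v (\<Sum>k\<le>?r. cscale (real k + a) (deg_part k \<mu>)) + \<Phi> \<^bold>\<and> p (\<Sum>k\<le>?r. deg_part k \<mu>)"
    using dp by (simp only: d_sum ins_sum ins2_Om P sum.distrib sum_subtractf fwedge_sum)
  finally show ?thesis unfolding s1 s2 by (simp add: D_def lie2_def)
qed

text \<open>The sign (-1)^|\<mu>| is moved into the first argument as \<open>fsg\<close>; in the
  last term it cancels the sign already there.\<close>

definition bracket :: "real \<Rightarrow> 'p mvfield \<Rightarrow> 'p mvfield \<Rightarrow> 'p mvfield" where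
  "bracket a \<mu> \<nu> = D a (fsg \<mu> \<^bold>\<and> \<nu>) - D a (fsg \<mu>) \<^bold>\<and> \<nu> - \<mu> \<^bold>\<and> D a \<nu>"

lemma D_sum: "(\<And>i. i \<in> A \<Longrightarrow> F i \<in> Om) \<Longrightarrow> D a (sum F A) = (\<Sum>i\<in>A. D a (F i))"
proof (induction A rule: infinite_finite_induct)
  case (insert x A)
  then have "F x \<in> Om" "sum F A \<in> Om" by (auto intro: sections_sum)
  moreover have "D a (sum F A) = (\<Sum>i\<in>A. D a (F i))" using insert by auto
  ultimately show ?case by (simp only: sum.insert[OF insert(1,2)] D_add)
qed (use D_cscale[of 0 a 0] in simp_all)

lemma generated_bracket_eq:
  assumes \<mu>: "\<mu> \<in> Om" and \<nu>: "\<nu> \<in> Om"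
  shows "generated_bracket E (hom_op E br \<rho> \<Phi> a P) \<mu> \<nu> = bracket a \<mu> \<nu>"
proof -
  let ?r = "fibre_dim E"
  let ?m = "\<lambda>k. cscale ((-1) ^ k) (deg_part k \<mu>)"
  have dp: "deg_part k \<mu> \<in> Om" for k using deg_part_sections[OF \<mu>] by (rule sections_deg_sections)
  have s1: "(\<Sum>k\<le>?r. deg_part k \<mu>) = \<mu>"
    using sum_deg_part[OF vbd, of \<mu> "\<lambda>_. 1"] \<mu> by (simp add: fweight_def)
  have s2: "(\<Sum>k\<le>?r. ?m k) = fsg \<mu>"
    using sum_deg_part[OF vbd, of \<mu> "\<lambda>k. (-1) ^ k"] \<mu> by (simp add: fsg_fweight)
  have "generated_bracket E (hom_op E br \<rho> \<Phi> a P) \<mu> \<nu> =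
      (\<Sum>k\<le>?r. D a (?m k \<^bold>\<and> \<nu>) - D a (?m k) \<^bold>\<and> \<nu> - deg_part k \<mu> \<^bold>\<and> D a \<nu>)"
    unfolding generated_bracket_def generated_bracket_deg_def
  proof (rule sum.cong[OF refl])
    fix k
    have "((-1) ^ k * (-1) ^ k) = (1::real)" by (simp flip: power_mult_distrib)
    then show "cscale ((-1) ^ k) (hom_op E br \<rho> \<Phi> a P (deg_part k \<mu> \<^bold>\<and> \<nu>) - hom_op E br \<rho> \<Phi> a P (deg_part k \<mu>) \<^bold>\<and> \<nu> -
        cscale ((-1) ^ k) (deg_part k \<mu> \<^bold>\<and> hom_op E br \<rho> \<Phi> a P \<nu>)) =
        D a (?m k \<^bold>\<and> \<nu>) - D a (?m k) \<^bold>\<and> \<nu> - deg_part k \<mu> \<^bold>\<and> D a \<nu>"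
      using dp[of k] \<nu> by (simp add: hom_op_eq D_cscale cscale_distribs)
  qed
  also have "\<dots> = D a ((\<Sum>k\<le>?r. ?m k) \<^bold>\<and> \<nu>) - D a (\<Sum>k\<le>?r. ?m k) \<^bold>\<and> \<nu> - (\<Sum>k\<le>?r. deg_part k \<mu>) \<^bold>\<and> D a \<nu>"
    using dp \<nu> by (simp only: D_sum sum_subtractf fwedge_sum Om_closed)
  finally show ?thesis unfolding s1 s2 bracket_def .
qed

lemma N_wedge: "N (\<mu> \<^bold>\<and> \<nu>) = N \<mu> \<^bold>\<and> \<nu> + \<mu> \<^bold>\<and> N \<nu>"
proof (intro ext)
  fix x K
  show "N (\<mu> \<^bold>\<and> \<nu>) x K = (N \<mu> \<^bold>\<and> \<nu> + \<mu> \<^bold>\<and> N \<nu>) x K"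
  proof (cases "finite K")
    case True
    show ?thesis
      by (simp add: fweight_def fwedge_def wedge_def sum_distrib_left flip: sum.distrib)
        (rule sum.cong, use True in \<open>auto simp: card_split[of K] algebra_simps\<close>)
  qed (simp add: fweight_def fwedge_def wedge_infinite)
qed

lemma N_fsg: "N (fsg \<omega>) = fsg (N \<omega>)"
  by (simp add: fweight_def fsg_def sg_def fun_eq_iff)

lemma ins2_fsg: "Q \<in> S2 \<Longrightarrow> \<omega> \<in> Om \<Longrightarrow> ii Q (fsg \<omega>) = fsg (ii Q \<omega>)"
proof -
  assume Q: "Q \<in> S2" and \<omega>: "\<omega> \<in> Om"
  have "ii Q (fsg \<omega>) - fsg (ii Q \<omega>) = 0"
    by (rule bivector_zero[OF Q, where T = "\<lambda>Q. ii Q (fsg \<omega>) - fsg (ii Q \<omega>)"])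
      (use \<omega> in \<open>simp_all add: ins_wedge2 ins_fsg fscale_distribs algebra_simps\<close>)
  then show ?thesis by simp
qed

lemma Phi_swap: "\<mu> \<in> Om \<Longrightarrow> \<mu> \<^bold>\<and> (\<Phi> \<^bold>\<and> \<eta>) = \<Phi> \<^bold>\<and> (fsg \<mu> \<^bold>\<and> \<eta>)"
proof -
  assume "\<mu> \<in> Om"
  then have "\<mu> \<^bold>\<and> \<Phi> = \<Phi> \<^bold>\<and> fsg \<mu>"
  proof (induction \<mu> rule: Om_deg_induct)
    case (deg k \<omega>)
    then show ?case using fwedge_swap[of \<omega> "dual_bundle E" k \<Phi> 1] by (simp add: Omd_fsg)
  next
    case (add \<omega> \<eta>)
    have IH: "\<omega> \<^bold>\<and> \<Phi> = \<Phi> \<^bold>\<and> fsg \<omega>" "\<eta> \<^bold>\<and> \<Phi> = \<Phi> \<^bold>\<and> fsg \<eta>" by (rule add)+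
    have "(\<omega> + \<eta>) \<^bold>\<and> \<Phi> = \<Phi> \<^bold>\<and> fsg (\<omega> + \<eta>)" by (simp add: IH)
    then show ?case .
  qed
  then show ?thesis by (simp flip: fwedge_assoc)
qed

abbreviation "B \<equiv> biv P"

lemma B_Om [simp, intro]: "\<mu> \<in> Om \<Longrightarrow> \<nu> \<in> Om \<Longrightarrow> B \<mu> \<nu> \<in> Om"
  by (auto simp: biv_def)

lemma p_wedge: "p (\<mu> \<^bold>\<and> \<nu>) = B \<mu> \<nu> + p \<mu> \<^bold>\<and> \<nu> + \<mu> \<^bold>\<and> p \<nu>"
  by (simp add: biv_def)

lemma B_linear:
  "B (\<mu> + \<mu>') \<nu> = B \<mu> \<nu> + B \<mu>' \<nu>" "B \<mu> (\<nu> + \<nu>') = B \<mu> \<nu> + B \<mu> \<nu>'"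
  "B (cscale c \<mu>) \<nu> = cscale c (B \<mu> \<nu>)" "B \<mu> (cscale c \<nu>) = cscale c (B \<mu> \<nu>)"
  "B (- \<mu>) \<nu> = - B \<mu> \<nu>" "B \<mu> (- \<nu>) = - B \<mu> \<nu>"
  by (simp_all add: biv_def cscale_distribs algebra_simps)

text \<open>The defect of i_P is \<open>B\<close>, which accounts for the terms with d and \<Phi>.
  As \<open>N\<close> is a derivation and i_V a graded one, their composite leaves the two mixed
  terms. No \<open>a\<close> is left on the right-hand side, which gives the independence of
  \<open>a\<close>.\<close>

theorem bracket_eq:
  assumes [simp]: "\<mu> \<in> Om" "\<nu> \<in> Om"
  shows "bracket a \<mu> \<nu> = B (d (fsg \<mu>)) \<nu> + B \<mu> (d \<nu>) - d (B (fsg \<mu>) \<nu>) + \<Phi> \<^bold>\<and> B (fsg \<mu>) \<nu>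
    + v (fsg \<mu>) \<^bold>\<and> N \<nu> + N \<mu> \<^bold>\<and> v \<nu>"
proof -
  let ?m = "fsg \<mu>"
  have 1: "p (d (?m \<^bold>\<and> \<nu>)) = B (d ?m) \<nu> + p (d ?m) \<^bold>\<and> \<nu> + d ?m \<^bold>\<and> p \<nu> + B \<mu> (d \<nu>) + p \<mu> \<^bold>\<and> d \<nu> + \<mu> \<^bold>\<and> p (d \<nu>)"
    by (simp only: d_wedge Om_closed assms fsg_linear ins_linear p_wedge ac_simps)
  have 2: "d (p (?m \<^bold>\<and> \<nu>)) = d (B ?m \<nu>) + d (p ?m) \<^bold>\<and> \<nu> + p \<mu> \<^bold>\<and> d \<nu> + d ?m \<^bold>\<and> p \<nu> + \<mu> \<^bold>\<and> d (p \<nu>)"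
    by (simp add: p_wedge d_add d_wedge ins2_fsg)
  have 3: "v (N (?m \<^bold>\<and> \<nu>) + cscale a (?m \<^bold>\<and> \<nu>)) = v (N ?m) \<^bold>\<and> \<nu> + N \<mu> \<^bold>\<and> v \<nu> + v ?m \<^bold>\<and> N \<nu> + \<mu> \<^bold>\<and> v (N \<nu>)
      + cscale a (v ?m \<^bold>\<and> \<nu>) + cscale a (\<mu> \<^bold>\<and> v \<nu>)"
    by (simp add: N_wedge ins_wedge_form N_fsg cscale_distribs)
  have 4: "\<Phi> \<^bold>\<and> p (?m \<^bold>\<and> \<nu>) = \<Phi> \<^bold>\<and> B ?m \<nu> + (\<Phi> \<^bold>\<and> p ?m) \<^bold>\<and> \<nu> + \<mu> \<^bold>\<and> (\<Phi> \<^bold>\<and> p \<nu>)"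
    by (simp add: p_wedge Phi_swap fwedge_assoc)
  show ?thesis
    unfolding bracket_def D_def lie2_def 1 2 3 4
    by (intro ext) (simp add: cscale_apply smv_apply algebra_simps)
qed


section \<open>Leibniz rule, skew-symmetry and degree of the bracket\<close>

lemma Omd_Om: "\<mu> \<in> Omd k \<Longrightarrow> \<mu> \<in> Om"
  by (rule sections_deg_sections)

lemma fsg_B: "\<mu> \<in> Om \<Longrightarrow> \<nu> \<in> Om \<Longrightarrow> fsg (B \<mu> \<nu>) = B (fsg \<mu>) (fsg \<nu>)"
  by (simp add: biv_def ins2_fsg flip: fsg_linear(8))

text \<open>Term by term in \<open>bracket_eq\<close>. The summands B \<mu> (d \<nu>) and d (B \<mu>
  \<nu>) do not obey the rule separately, but their extra terms, d \<nu> \<and> B \<mu> \<kappa> and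
  B \<mu> \<nu> \<and> d \<kappa>, cancel; the other summands obey it on their own.\<close>

lemma bracket_leibniz:
  assumes \<mu>: "\<mu> \<in> Omd (int k)" and \<nu>: "\<nu> \<in> Omd (int l)" and \<kappa>: "\<kappa> \<in> Om"
  shows "bracket a \<mu> (\<nu> \<^bold>\<and> \<kappa>) = bracket a \<mu> \<nu> \<^bold>\<and> \<kappa> + cscale ((-1) ^ ((k + 1) * l)) (\<nu> \<^bold>\<and> bracket a \<mu> \<kappa>)"
proof -
  have [simp]: "\<mu> \<in> Om" "\<nu> \<in> Om" "\<kappa> \<in> Om" using assms Omd_Om by blast+
  let ?x = "(-1::real) ^ k" and ?y = "(-1::real) ^ l" and ?z = "(-1::real) ^ (k * l)"
  have s\<mu>: "fsg \<mu> = cscale ?x \<mu>" and s\<nu>: "fsg \<nu> = cscale ?y \<nu>" using Omd_fsg \<mu> \<nu> by blast+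
  have N\<mu>: "N \<mu> = cscale (real k) \<mu>" using fweight_real_deg[OF \<mu>] by simp
  have d\<mu>: "d \<mu> \<in> Omd (int (k + 1))" and d\<nu>: "d \<nu> \<in> Omd (int (l + 1))"
    using d_sections_deg[OF \<mu>] d_sections_deg[OF \<nu>] by (simp_all add: add.commute)
  have e1: "B (d \<mu>) (\<nu> \<^bold>\<and> \<kappa>) = B (d \<mu>) \<nu> \<^bold>\<and> \<kappa> + cscale ((-1) ^ ((k + 1) * l)) (\<nu> \<^bold>\<and> B (d \<mu>) \<kappa>)"
    by (rule biv_leibniz[OF P d\<mu> \<nu> \<kappa>])
  have e0: "B \<mu> (\<nu> \<^bold>\<and> \<eta>) = B \<mu> \<nu> \<^bold>\<and> \<eta> + cscale ?z (\<nu> \<^bold>\<and> B \<mu> \<eta>)" if "\<eta> \<in> Om" for \<eta>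
    by (rule biv_leibniz[OF P \<mu> \<nu> that])
  have e2: "B \<mu> (d (\<nu> \<^bold>\<and> \<kappa>)) = B \<mu> (d \<nu>) \<^bold>\<and> \<kappa> + cscale ((-1) ^ (k * (l + 1))) (d \<nu> \<^bold>\<and> B \<mu> \<kappa>)
      + cscale ?y (B \<mu> \<nu> \<^bold>\<and> d \<kappa>) + cscale (?y * ?z) (\<nu> \<^bold>\<and> B \<mu> (d \<kappa>))"
    by (simp add: d_wedge B_linear biv_leibniz[OF P \<mu> d\<nu> \<kappa>] s\<nu> e0 cscale_distribs add.assoc)
  have "fsg (B \<mu> \<nu>) = cscale (?x * ?y) (B \<mu> \<nu>)"
    by (simp add: fsg_B s\<mu> s\<nu> B_linear mult.commute)
  then have e3: "d (B \<mu> (\<nu> \<^bold>\<and> \<kappa>)) = d (B \<mu> \<nu>) \<^bold>\<and> \<kappa> + cscale (?x * ?y) (B \<mu> \<nu> \<^bold>\<and> d \<kappa>)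
      + cscale ?z (d \<nu> \<^bold>\<and> B \<mu> \<kappa>) + cscale (?z * ?y) (\<nu> \<^bold>\<and> d (B \<mu> \<kappa>))"
    by (simp add: e0 d_add d_wedge d_cscale cscale_distribs s\<nu> add.assoc)
  have Phi_nu: "\<Phi> \<^bold>\<and> (\<nu> \<^bold>\<and> \<eta>) = cscale ?y (\<nu> \<^bold>\<and> (\<Phi> \<^bold>\<and> \<eta>))" for \<eta>
  proof -
    have "?y * ?y = 1" by (simp flip: power_mult_distrib)
    then show ?thesis by (simp add: Phi_swap s\<nu>)
  qed
  have e4: "\<Phi> \<^bold>\<and> B \<mu> (\<nu> \<^bold>\<and> \<kappa>) = (\<Phi> \<^bold>\<and> B \<mu> \<nu>) \<^bold>\<and> \<kappa> + cscale (?z * ?y) (\<nu> \<^bold>\<and> (\<Phi> \<^bold>\<and> B \<mu> \<kappa>))"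
    by (simp add: e0 Phi_nu fwedge_assoc)
  have v\<mu>\<nu>: "v \<mu> \<^bold>\<and> (\<nu> \<^bold>\<and> \<eta>) = cscale (?z * ?y) (\<nu> \<^bold>\<and> (v \<mu> \<^bold>\<and> \<eta>))" for \<eta>
  proof -
    have "v \<mu> \<^bold>\<and> \<nu> = cscale (?z * ?y) (\<nu> \<^bold>\<and> v \<mu>)"
      using ins_wedge_swap[OF V_S1 \<mu> \<nu>] by (simp add: s\<nu>)
    then show ?thesis by (simp flip: fwedge_assoc)
  qed
  have e5: "v \<mu> \<^bold>\<and> N (\<nu> \<^bold>\<and> \<kappa>) = (v \<mu> \<^bold>\<and> N \<nu>) \<^bold>\<and> \<kappa> + cscale (?z * ?y) (\<nu> \<^bold>\<and> (v \<mu> \<^bold>\<and> N \<kappa>))"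
    by (simp add: N_wedge fwedge_assoc v\<mu>\<nu>)
  have \<mu>\<nu>: "\<mu> \<^bold>\<and> (\<nu> \<^bold>\<and> \<eta>) = cscale ?z (\<nu> \<^bold>\<and> (\<mu> \<^bold>\<and> \<eta>))" for \<eta>
    using fwedge_swap[OF \<mu> \<nu>] by (simp flip: fwedge_assoc)
  have e6: "\<mu> \<^bold>\<and> v (\<nu> \<^bold>\<and> \<kappa>) = (\<mu> \<^bold>\<and> v \<nu>) \<^bold>\<and> \<kappa> + cscale (?z * ?y) (\<nu> \<^bold>\<and> (\<mu> \<^bold>\<and> v \<kappa>))"
    by (simp add: ins_wedge_form s\<nu> fwedge_assoc \<mu>\<nu> mult.commute)
  have be: "bracket a \<mu> \<eta> = cscale ?x (B (d \<mu>) \<eta>) + B \<mu> (d \<eta>) - cscale ?x (d (B \<mu> \<eta>)) + cscale ?x (\<Phi> \<^bold>\<and> B \<mu> \<eta>)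
      + cscale ?x (v \<mu> \<^bold>\<and> N \<eta>) + cscale (real k) (\<mu> \<^bold>\<and> v \<eta>)" if "\<eta> \<in> Om" for \<eta>
    using that by (simp add: bracket_eq s\<mu> N\<mu> d_cscale B_linear)
  have z: "(-1::real) ^ ((k + 1) * l) = ?z * ?y" "(-1::real) ^ (k * (l + 1)) = ?z * ?x"
    by (simp_all add: power_add algebra_simps)
  \<comment> \<open>Once these signs are numbers, the identity is linear in the fields involved and
    can be compared componentwise.\<close>
  consider "?x = 1" "?y = 1" | "?x = 1" "?y = -1" | "?x = -1" "?y = 1" | "?x = -1" "?y = -1"
    by (cases "even k"; cases "even l") auto
  then show ?thesis
    unfolding be[OF \<open>\<nu> \<in> Om\<close>] be[OF \<open>\<kappa> \<in> Om\<close>] be[OF Om_closed(7)[OF \<open>\<nu> \<in> Om\<close> \<open>\<kappa> \<in> Om\<close>]] e1 e2 e3 e4 e5 e6 z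
    by cases (intro ext, simp add: cscale_apply smv_apply algebra_simps)+
qed

text \<open>Only graded commutativity of the product enters: both brackets are built from the same
  three terms up to sign.\<close>

lemma bracket_skew:
  assumes \<mu>: "\<mu> \<in> Omd (int k)" and \<nu>: "\<nu> \<in> Omd (int l)"
  shows "bracket a \<mu> \<nu> = - cscale ((-1) ^ ((k + 1) * (l + 1))) (bracket a \<nu> \<mu>)"
proof -
  have [simp]: "\<mu> \<in> Om" "\<nu> \<in> Om" using assms Omd_Om by blast+
  let ?x = "(-1::real) ^ k" and ?y = "(-1::real) ^ l" and ?z = "(-1::real) ^ (k * l)"
  have s\<mu>: "fsg \<mu> = cscale ?x \<mu>" and s\<nu>: "fsg \<nu> = cscale ?y \<nu>" using Omd_fsg \<mu> \<nu> by blast+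
  have e1: "D a (\<nu> \<^bold>\<and> \<mu>) = cscale ?z (D a (\<mu> \<^bold>\<and> \<nu>))"
    using fwedge_swap[OF \<nu> \<mu>] by (simp add: D_cscale mult.commute)
  have e2: "D a \<nu> \<^bold>\<and> \<mu> = cscale (?z * ?x) (\<mu> \<^bold>\<and> D a \<nu>)"
    using wedge_swap_pred[OF D_deg[OF \<nu>] \<mu>] by (simp add: s\<mu> mult.commute)
  have e3: "D a \<mu> \<^bold>\<and> \<nu> = cscale (?z * ?y) (\<nu> \<^bold>\<and> D a \<mu>)"
    using wedge_swap_pred[OF D_deg[OF \<mu>] \<nu>] by (simp add: s\<nu>)
  have z: "(-1::real) ^ ((k + 1) * (l + 1)) = - (?z * ?x * ?y)"
    by (simp add: power_add algebra_simps)
  have b1: "bracket a \<mu> \<nu> = cscale ?x (D a (\<mu> \<^bold>\<and> \<nu>)) - cscale ?x (D a \<mu> \<^bold>\<and> \<nu>) - \<mu> \<^bold>\<and> D a \<nu>"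
    by (simp add: bracket_def s\<mu> D_cscale)
  have b2: "bracket a \<nu> \<mu> = cscale ?y (D a (\<nu> \<^bold>\<and> \<mu>)) - cscale ?y (D a \<nu> \<^bold>\<and> \<mu>) - \<nu> \<^bold>\<and> D a \<mu>"
    by (simp add: bracket_def s\<nu> D_cscale)
  have "?z = 1 \<or> ?z = -1" by (cases "even (k * l)") auto
  moreover have "?x = 1 \<or> ?x = -1" "?y = 1 \<or> ?y = -1" by (cases "even k"; simp) (cases "even l"; simp)
  ultimately show ?thesis
    unfolding b1 b2 e1 e2 e3 z
    by (elim disjE) (intro ext, simp add: cscale_apply smv_apply algebra_simps)+
qed

lemma bracket_deg:
  assumes \<mu>: "\<mu> \<in> Omd k" and \<nu>: "\<nu> \<in> Omd l"
  shows "bracket a \<mu> \<nu> \<in> Omd (k + l - 1)"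
proof (cases "k < 0")
  case True
  then have "\<mu> = 0" using \<mu> sections_deg_neg by blast
  moreover have "D a 0 = 0" using D_cscale[of 0 a 0] by simp
  ultimately show ?thesis by (simp add: bracket_def sections_deg_linear)
next
  case False
  then obtain n where k: "k = int n" by (metis nonneg_int_cases not_less)
  then have s: "fsg \<mu> \<in> Omd k" using Omd_fsg[of \<mu> n] \<mu> by (simp add: sections_deg_linear)
  have "D a (fsg \<mu> \<^bold>\<and> \<nu>) \<in> Omd (k + l - 1)" by (rule D_deg[OF fwedge_sections_deg[OF s \<nu>]])
  moreover have "D a (fsg \<mu>) \<^bold>\<and> \<nu> \<in> Omd (k - 1 + l)" by (rule fwedge_sections_deg[OF D_deg[OF s] \<nu>])
  moreover have "\<mu> \<^bold>\<and> D a \<nu> \<in> Omd (k + (l - 1))" by (rule fwedge_sections_deg[OF \<mu> D_deg[OF \<nu>]])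
  ultimately show ?thesis unfolding bracket_def by (intro sections_deg_linear(2)) (simp_all add: algebra_simps)
qed

lemma bracket_linear:
  assumes "\<mu> \<in> Om" "\<mu>' \<in> Om" "\<nu> \<in> Om"
  shows "bracket a (\<mu> + \<mu>') \<nu> = bracket a \<mu> \<nu> + bracket a \<mu>' \<nu>"
    "bracket a \<nu> (\<mu> + \<mu>') = bracket a \<nu> \<mu> + bracket a \<nu> \<mu>'"
    "bracket a (cscale c \<mu>) \<nu> = cscale c (bracket a \<mu> \<nu>)"
    "bracket a \<nu> (cscale c \<mu>) = cscale c (bracket a \<nu> \<mu>)"
  using assms by (simp_all add: bracket_def D_add D_cscale cscale_distribs algebra_simps)

subsection \<open>The bracket of 1-forms\<close>

lemma Omd_zero_at: "\<mu> \<in> Omd k \<Longrightarrow> k < 0 \<Longrightarrow> \<mu> = 0"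
  using sections_deg_neg by blast

lemma p_1: "\<alpha> \<in> Omd 1 \<Longrightarrow> p \<alpha> = 0"
  using ins2_sections_deg[OF P, of \<alpha> 1] Omd_zero_at by simp

lemma B_1: "\<alpha> \<in> Omd 1 \<Longrightarrow> \<omega> \<in> Om \<Longrightarrow> B \<alpha> \<omega> = ii (ii \<alpha> P) \<omega>"
  by (simp add: biv_def ins2_form_wedge p_1)

lemma wedge_1_1: "\<alpha> \<in> Omd 1 \<Longrightarrow> \<beta> \<in> Omd 1 \<Longrightarrow> \<beta> \<^bold>\<and> \<alpha> = - (\<alpha> \<^bold>\<and> \<beta>)"
  using fwedge_swap[of \<beta> "dual_bundle E" 1 \<alpha> 1] by simp

lemma pairing_P:
  assumes "\<alpha> \<in> Omd 1" "\<beta> \<in> Omd 1"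
  shows "p (\<alpha> \<^bold>\<and> \<beta>) = ii (ii \<alpha> P) \<beta>" "ii (ii \<beta> P) \<alpha> = - ii (ii \<alpha> P) \<beta>"
proof -
  have *: "p (\<alpha> \<^bold>\<and> \<beta>) = ii (ii \<alpha> P) \<beta>" if "\<alpha> \<in> Omd 1" "\<beta> \<in> Omd 1" for \<alpha> \<beta>
    using that by (simp add: ins2_form_wedge p_1 Omd_Om)
  show "ii (ii \<beta> P) \<alpha> = - ii (ii \<alpha> P) \<beta>"
    using *[OF assms] *[OF assms(2,1)] wedge_1_1[OF assms] by simp
  show "p (\<alpha> \<^bold>\<and> \<beta>) = ii (ii \<alpha> P) \<beta>" by (rule *[OF assms])
qed

lemma wedge_0_swap: "c \<in> Omd 0 \<Longrightarrow> \<beta> \<in> Omd (int k) \<Longrightarrow> c \<^bold>\<and> \<beta> = \<beta> \<^bold>\<and> c"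
  using fwedge_swap[of c "dual_bundle E" 0 \<beta> k] by simp

text \<open>On 1-forms \<open>N\<close> is the identity, and its two terms with v match those
  produced by \<Phi> in the twisted derivatives. The product of \<Phi> with the pairing of P and
  \<alpha> \<and> \<beta> occurs three times in \<open>form_bracket\<close>, twice negatively and
  once positively, which leaves the one negative term of \<open>bracket_eq\<close>.\<close>

lemma bracket_1:
  assumes \<alpha>: "\<alpha> \<in> Omd 1" and \<beta>: "\<beta> \<in> Omd 1"
  shows "bracket a \<alpha> \<beta> = form_bracket E br \<rho> \<Phi> P \<alpha> \<beta>"
proof -
  have [simp]: "\<alpha> \<in> Om" "\<beta> \<in> Om" using assms Omd_Om by blast+
  have [simp]: "ii \<alpha> P \<in> S1" "ii \<beta> P \<in> S1" using assms by auto
  have N1: "N \<alpha> = \<alpha>" "N \<beta> = \<beta>" using fweight_real_deg[OF \<alpha>] fweight_real_deg[OF \<beta>] by simp_all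
  have "d \<alpha> \<in> Omd 2" using d_sections_deg[OF \<alpha>] by simp
  then have "p (d \<alpha>) \<in> Omd 0" "d \<alpha> \<^bold>\<and> \<beta> = \<beta> \<^bold>\<and> d \<alpha>"
    using ins2_sections_deg[OF P, of "d \<alpha>" 2] fwedge_swap[of "d \<alpha>" "dual_bundle E" 2 \<beta> 1] \<beta> by simp_all
  then have "B (d \<alpha>) \<beta> = B \<beta> (d \<alpha>)"
    using wedge_0_swap[of "p (d \<alpha>)" \<beta> 1] \<beta> p_1[OF \<beta>] by (simp add: biv_def)
  then have 1: "B (d \<alpha>) \<beta> = ii (ii \<beta> P) (d \<alpha>)" by (simp add: B_1 \<beta>)
  have 2: "ii (ii \<alpha> P) (\<Phi> \<^bold>\<and> \<beta>) = - (v \<alpha> \<^bold>\<and> \<beta>) - \<Phi> \<^bold>\<and> ii (ii \<alpha> P) \<beta>"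
    using pairing_P(2)[OF Phi \<alpha>] by (simp add: ins_wedge_form Omd1_fsg)
  have "v \<beta> \<in> Omd 0" using v_deg[OF \<beta>] by simp
  then have 3: "ii (ii \<beta> P) (\<Phi> \<^bold>\<and> \<alpha>) = - (\<alpha> \<^bold>\<and> v \<beta>) + \<Phi> \<^bold>\<and> ii (ii \<alpha> P) \<beta>"
    using pairing_P(2)[OF Phi \<beta>] pairing_P(2)[OF \<alpha> \<beta>] wedge_0_swap[of "v \<beta>" \<alpha> 1] \<alpha>
    by (simp add: ins_wedge_form Omd1_fsg)
  have "bracket a \<alpha> \<beta> = - ii (ii \<beta> P) (d \<alpha>) + ii (ii \<alpha> P) (d \<beta>) + d (ii (ii \<alpha> P) \<beta>) - \<Phi> \<^bold>\<and> ii (ii \<alpha> P) \<beta>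
      - v \<alpha> \<^bold>\<and> \<beta> + \<alpha> \<^bold>\<and> v \<beta>"
    by (simp add: bracket_eq Omd1_fsg \<alpha> d_uminus B_linear 1 B_1 N1)
  also have "\<dots> = form_bracket E br \<rho> \<Phi> P \<alpha> \<beta>"
    unfolding form_bracket_def ext_deriv_tw_def pairing_P(1)[OF assms] ins_linear 2 3 by simp
  finally show ?thesis .
qed

text \<open>By skew-symmetry of P each of the two Lie derivatives contributes the twisted
  differential of the pairing with a positive sign, so subtracting it once leaves it once.\<close>

lemma form_bracket_lie:
  assumes \<alpha>: "\<alpha> \<in> Omd 1" and \<beta>: "\<beta> \<in> Omd 1"
  shows "form_bracket E br \<rho> \<Phi> P \<alpha> \<beta> =
    lie_deriv_tw E br \<rho> \<Phi> 1 (ii \<alpha> P) \<beta> - lie_deriv_tw E br \<rho> \<Phi> 1 (ii \<beta> P) \<alpha> - ext_deriv_tw E br \<rho> \<Phi> (p (\<alpha> \<^bold>\<and> \<beta>))"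
proof -
  have "\<beta> \<in> Om" "ii \<alpha> P \<in> S1" using assms Omd_Om by auto
  then have "ext_deriv_tw E br \<rho> \<Phi> (ii (ii \<beta> P) \<alpha>) = - ext_deriv_tw E br \<rho> \<Phi> (ii (ii \<alpha> P) \<beta>)"
    unfolding pairing_P(2)[OF assms] by (simp add: ext_deriv_tw_def d_uminus)
  then show ?thesis
    unfolding form_bracket_def lie_deriv_tw_def pairing_P(1)[OF assms] by simp
qed

lemma wedge_fun_right:
  assumes "\<omega> \<in> Om" and f: "f \<in> Cinf"
  shows "\<omega> \<^bold>\<and> fun_field f = fscale f \<omega>"
  using assms(1)
proof (induction \<omega> rule: Om_deg_induct)
  case (deg k \<omega>)
  have "fun_field f \<in> Omd 0" using f by (simp add: fun_field_sections_deg)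
  then show ?case using wedge_0_swap[OF _ deg] fun_field_wedge[OF vbd Omd_Om[OF deg], of f] by simp
next
  case (add \<omega> \<eta>)
  have IH: "\<omega> \<^bold>\<and> fun_field f = fscale f \<omega>" "\<eta> \<^bold>\<and> fun_field f = fscale f \<eta>" by (rule add)+
  have "(\<omega> + \<eta>) \<^bold>\<and> fun_field f = fscale f (\<omega> + \<eta>)" by (simp add: IH fscale_distribs)
  then show ?case .
qed

text \<open>\<open>B\<close> with a function vanishes, as i_P is linear over functions. Only the
  contraction of df with the vector field \<open>ii \<alpha> P\<close> survives, and this identifies
  the anchor.\<close>

lemma bracket_fun:
  assumes \<alpha>: "\<alpha> \<in> Omd 1" and f: "f \<in> Cinf"
  shows "bracket a \<alpha> (fun_field f) = fun_field (act (ii \<alpha> P) f)"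
proof -
  have [simp]: "\<alpha> \<in> Om" using \<alpha> Omd_Om by blast
  have F: "fun_field f \<in> Omd 0" using f by (simp add: fun_field_sections_deg)
  have B0: "B \<omega> (fun_field f) = 0" if "\<omega> \<in> Omd (int k)" for \<omega> k
  proof -
    have [simp]: "\<omega> \<in> Om" using that Omd_Om by blast
    have "\<omega> \<^bold>\<and> fun_field f = fscale f \<omega>" "p \<omega> \<^bold>\<and> fun_field f = fscale f (p \<omega>)"
      using f by (simp_all add: wedge_fun_right)
    moreover have "p (fun_field f) = 0"
      using ins2_sections_deg[OF P F] Omd_zero_at by simp
    ultimately show ?thesis by (simp add: biv_def)
  qed
  have "B (d \<alpha>) (fun_field f) = 0" "B \<alpha> (fun_field f) = 0"
    using B0[of "d \<alpha>" 2] B0[of \<alpha> 1] d_sections_deg[OF \<alpha>] \<alpha> by simp_all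
  moreover have "N (fun_field f) = 0" using fweight_real_deg[OF F] by simp
  moreover have "v (fun_field f) = 0" by simp
  ultimately show ?thesis using f \<alpha>
    by (simp add: bracket_eq Omd1_fsg d_uminus B_linear B_1 d_fun_field differential)
qed


section \<open>Jacobi identity for 1-forms\<close>

lemma D_0: "c \<in> Omd 0 \<Longrightarrow> D a c = 0"
  using Omd_zero_at[of "D a c" "-1"] D_deg[of c 0 a] by simp

lemma D_wedge_1: "\<alpha> \<in> Omd 1 \<Longrightarrow> \<omega> \<in> Om \<Longrightarrow> D a (\<alpha> \<^bold>\<and> \<omega>) = D a \<alpha> \<^bold>\<and> \<omega> - \<alpha> \<^bold>\<and> D a \<omega> - bracket a \<alpha> \<omega>"
  using D_cscale[of "\<alpha> \<^bold>\<and> \<omega>" a "-1"] D_cscale[of \<alpha> a "-1"]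
  by (simp add: bracket_def Omd1_fsg Omd_Om)

lemma D_wedge_0: "c \<in> Omd 0 \<Longrightarrow> \<omega> \<in> Om \<Longrightarrow> D a (c \<^bold>\<and> \<omega>) = bracket a c \<omega> + c \<^bold>\<and> D a \<omega>"
  using Omd_fsg[of c 0] by (simp add: bracket_def D_0)

lemma D_diff: "\<omega> \<in> Om \<Longrightarrow> \<eta> \<in> Om \<Longrightarrow> D a (\<omega> - \<eta>) = D a \<omega> - D a \<eta>"
  using D_add[of \<omega> "- \<eta>" a] D_cscale[of \<eta> a "-1"] by simp

text \<open>\<open>D\<close> is a derivation of the bracket and squares to zero; expanding \<open>D (D (\<alpha> \<and> \<beta> \<and> \<gamma>)) = 0\<close> by the
  Leibniz rule leaves the Jacobi identity.\<close>

lemma bracket_jacobi: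
  assumes \<alpha>: "\<alpha> \<in> Omd 1" and \<beta>: "\<beta> \<in> Omd 1" and \<gamma>: "\<gamma> \<in> Omd 1"
  shows "bracket a \<alpha> (bracket a \<beta> \<gamma>) = bracket a (bracket a \<alpha> \<beta>) \<gamma> + bracket a \<beta> (bracket a \<alpha> \<gamma>)"
proof -
  let ?b = "bracket a" and ?D = "D a"
  let ?f = "?D \<alpha>" and ?g = "?D \<beta>" and ?h = "?D \<gamma>"
  have om [simp]: "\<alpha> \<in> Om" "\<beta> \<in> Om" "\<gamma> \<in> Om" using assms Omd_Om by blast+
  have f: "?f \<in> Omd 0" and g: "?g \<in> Omd 0" and h: "?h \<in> Omd 0"
    using D_deg[OF \<alpha>] D_deg[OF \<beta>] D_deg[OF \<gamma>] by simp_all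
  have bb: "?b \<mu> \<nu> \<in> Omd 1" if "\<mu> \<in> Omd 1" "\<nu> \<in> Omd 1" for \<mu> \<nu>
    using bracket_deg[OF that] by simp
  have l1: "?b \<mu> (\<nu> \<^bold>\<and> \<kappa>) = ?b \<mu> \<nu> \<^bold>\<and> \<kappa> + \<nu> \<^bold>\<and> ?b \<mu> \<kappa>" if "\<mu> \<in> Omd 1" "\<nu> \<in> Omd (int l)" "\<kappa> \<in> Om" for \<mu> \<nu> \<kappa> l
    using bracket_leibniz[of \<mu> 1 \<nu> l \<kappa>] that by simp
  have l0: "?b c (\<nu> \<^bold>\<and> \<kappa>) = ?b c \<nu> \<^bold>\<and> \<kappa> - \<nu> \<^bold>\<and> ?b c \<kappa>" if "c \<in> Omd 0" "\<nu> \<in> Omd 1" "\<kappa> \<in> Om" for c \<nu> \<kappa>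
    using bracket_leibniz[of c 0 \<nu> 1 \<kappa>] that by simp
  have D_D0: "?D (?D \<omega>) = 0" if "\<omega> \<in> Om" for \<omega> using D_D[OF that] .
  have 2: "?D (\<mu> \<^bold>\<and> \<nu>) = ?D \<mu> \<^bold>\<and> \<nu> - \<mu> \<^bold>\<and> ?D \<nu> - ?b \<mu> \<nu>" if "\<mu> \<in> Omd 1" "\<nu> \<in> Omd 1" for \<mu> \<nu>
    using D_wedge_1 that Omd_Om by blast
  have D1c: "?D (\<mu> \<^bold>\<and> c) = ?D \<mu> \<^bold>\<and> c - ?b \<mu> c" if "\<mu> \<in> Omd 1" "c \<in> Omd 0" for \<mu> c
    using D_wedge_1[of \<mu> c a] that Omd_Om by (simp add: D_0)
  have Dc1: "?D (c \<^bold>\<and> \<mu>) = ?b c \<mu> + c \<^bold>\<and> ?D \<mu>" if "\<mu> \<in> Omd 1" "c \<in> Omd 0" for \<mu> c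
    using D_wedge_0[of c \<mu> a] that Omd_Om by simp
  have Db: "?D (?b \<mu> \<nu>) = ?b (?D \<mu>) \<nu> + ?b \<mu> (?D \<nu>)" if \<mu>: "\<mu> \<in> Omd 1" and \<nu>: "\<nu> \<in> Omd 1" for \<mu> \<nu>
  proof -
    have [simp]: "\<mu> \<in> Om" "\<nu> \<in> Om" using that Omd_Om by blast+
    have D\<mu>: "?D \<mu> \<in> Omd 0" "?D \<nu> \<in> Omd 0" using D_deg[OF \<mu>] D_deg[OF \<nu>] by simp_all
    have "0 = ?D (?D (\<mu> \<^bold>\<and> \<nu>))" by (simp add: D_D0)
    also have "\<dots> = ?D (?D \<mu> \<^bold>\<and> \<nu>) - ?D (\<mu> \<^bold>\<and> ?D \<nu>) - ?D (?b \<mu> \<nu>)"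
      using bb[OF that] Omd_Om by (simp add: 2 that D_diff)
    also have "\<dots> = ?b (?D \<mu>) \<nu> + ?b \<mu> (?D \<nu>) - ?D (?b \<mu> \<nu>)"
      by (simp add: Dc1 D1c that D\<mu>)
    finally show ?thesis by (simp only: eq_commute[of 0] right_minus_eq)
  qed
  have bOm [simp]: "?b \<mu> \<nu> \<in> Om" if "\<mu> \<in> Om" "\<nu> \<in> Om" for \<mu> \<nu>
    using that by (auto simp: bracket_def)
  have e: "?D (\<alpha> \<^bold>\<and> \<beta> \<^bold>\<and> \<gamma>) = ?f \<^bold>\<and> \<beta> \<^bold>\<and> \<gamma> - \<alpha> \<^bold>\<and> (?g \<^bold>\<and> \<gamma>) + \<alpha> \<^bold>\<and> (\<beta> \<^bold>\<and> ?h) + \<alpha> \<^bold>\<and> ?b \<beta> \<gamma>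
      - ?b \<alpha> \<beta> \<^bold>\<and> \<gamma> - \<beta> \<^bold>\<and> ?b \<alpha> \<gamma>"
    using D_wedge_1[OF \<alpha>, of "\<beta> \<^bold>\<and> \<gamma>" a] l1[of \<alpha> \<beta> 1 \<gamma>] assms by (simp add: 2 algebra_simps)
  have t1: "?D (?f \<^bold>\<and> \<beta> \<^bold>\<and> \<gamma>) = ?b ?f \<beta> \<^bold>\<and> \<gamma> - \<beta> \<^bold>\<and> ?b ?f \<gamma> + ?f \<^bold>\<and> (?g \<^bold>\<and> \<gamma>) - ?f \<^bold>\<and> (\<beta> \<^bold>\<and> ?h) - ?f \<^bold>\<and> ?b \<beta> \<gamma>"
    using D_wedge_0[OF f, of "\<beta> \<^bold>\<and> \<gamma>" a] l0[OF f \<beta>, of \<gamma>] by (simp add: 2 assms algebra_simps)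
  have t2: "?D (\<alpha> \<^bold>\<and> (?g \<^bold>\<and> \<gamma>)) = ?f \<^bold>\<and> (?g \<^bold>\<and> \<gamma>) - \<alpha> \<^bold>\<and> ?b ?g \<gamma> - \<alpha> \<^bold>\<and> (?g \<^bold>\<and> ?h) - ?b \<alpha> ?g \<^bold>\<and> \<gamma> - ?g \<^bold>\<and> ?b \<alpha> \<gamma>"
    using D_wedge_1[OF \<alpha>, of "?g \<^bold>\<and> \<gamma>" a] l1[OF \<alpha>, of ?g 0 \<gamma>] g by (simp add: Dc1 assms algebra_simps)
  have t3: "?D (\<alpha> \<^bold>\<and> (\<beta> \<^bold>\<and> ?h)) = ?f \<^bold>\<and> (\<beta> \<^bold>\<and> ?h) - \<alpha> \<^bold>\<and> (?g \<^bold>\<and> ?h) + \<alpha> \<^bold>\<and> ?b \<beta> ?h - ?b \<alpha> \<beta> \<^bold>\<and> ?h - \<beta> \<^bold>\<and> ?b \<alpha> ?h"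
    using D_wedge_1[OF \<alpha>, of "\<beta> \<^bold>\<and> ?h" a] l1[OF \<alpha>, of \<beta> 1 ?h] \<beta> by (simp add: D1c[OF \<beta> h] algebra_simps)
  have t4: "?D (\<alpha> \<^bold>\<and> ?b \<beta> \<gamma>) = ?f \<^bold>\<and> ?b \<beta> \<gamma> - \<alpha> \<^bold>\<and> ?b ?g \<gamma> - \<alpha> \<^bold>\<and> ?b \<beta> ?h - ?b \<alpha> (?b \<beta> \<gamma>)"
    by (simp add: 2 bb assms Db algebra_simps)
  have t5: "?D (?b \<alpha> \<beta> \<^bold>\<and> \<gamma>) = ?b ?f \<beta> \<^bold>\<and> \<gamma> + ?b \<alpha> ?g \<^bold>\<and> \<gamma> - ?b \<alpha> \<beta> \<^bold>\<and> ?h - ?b (?b \<alpha> \<beta>) \<gamma>"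
    by (simp add: 2 bb assms Db)
  have t6: "?D (\<beta> \<^bold>\<and> ?b \<alpha> \<gamma>) = ?g \<^bold>\<and> ?b \<alpha> \<gamma> - \<beta> \<^bold>\<and> ?b ?f \<gamma> - \<beta> \<^bold>\<and> ?b \<alpha> ?h - ?b \<beta> (?b \<alpha> \<gamma>)"
    by (simp add: 2 bb assms Db algebra_simps)
  have "0 = ?D (?D (\<alpha> \<^bold>\<and> \<beta> \<^bold>\<and> \<gamma>))" by (simp add: D_D0)
  also have "\<dots> = ?D (?f \<^bold>\<and> \<beta> \<^bold>\<and> \<gamma>) - ?D (\<alpha> \<^bold>\<and> (?g \<^bold>\<and> \<gamma>)) + ?D (\<alpha> \<^bold>\<and> (\<beta> \<^bold>\<and> ?h)) + ?D (\<alpha> \<^bold>\<and> ?b \<beta> \<gamma>)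
      - ?D (?b \<alpha> \<beta> \<^bold>\<and> \<gamma>) - ?D (\<beta> \<^bold>\<and> ?b \<alpha> \<gamma>)"
    unfolding e by (simp add: D_diff D_add)
  also have "\<dots> = ?b (?b \<alpha> \<beta>) \<gamma> + ?b \<beta> (?b \<alpha> \<gamma>) - ?b \<alpha> (?b \<beta> \<gamma>)"
    unfolding t1 t2 t3 t4 t5 t6 by (simp add: algebra_simps)
  finally show ?thesis by (simp only: eq_commute[of 0] right_minus_eq)
qed

section \<open>The Lie algebroid and the Schouten bracket on the dual bundle\<close>

definition dual_anchor :: "'p anchor" where
  "dual_anchor x u f = \<rho> x (contract (fibre_dim E) u (P x)) f"

lemma dual_anchor_act: "(\<lambda>x. dual_anchor x (\<alpha> x) f) = act (ii \<alpha> P) f"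
  by (simp add: dual_anchor_def act_def ins_def)

text \<open>\<open>anchor_map\<close> quantifies over single vectors of the fibre, not over
  sections. Contracting P x with a covector gives such a vector of E, so linearity and the tangent
  condition are inherited from \<rho>.\<close>

lemma dual_anchor_map: "anchor_map (dual_bundle E) dual_anchor"
proof -
  let ?r = "fibre_dim E"
  have Px: "P x \<in> mv_space ?r" "mv_deg 2 (P x)" for x
    using sections_mv_space[OF vb S2_sections[OF P]] sections_deg_mv_deg[of P E 2] P by simp_all
  have range: "contract ?r u (P x) \<in> range (vector_mv ?r)" if "u \<in> range (vector_mv ?r)" for u x
  proof -
    have "mv_deg 1 u" using that vector_mv_deg by auto
    then have "mv_deg 1 (contract ?r u (P x))"
      unfolding mv_deg_def[of 1 "contract ?r u (P x)"]
      using contract_mv_deg[OF Px(1) \<open>mv_deg 1 u\<close> Px(2)] by (metis add_diff_cancel_left' one_add_one)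
    then show ?thesis using vector_mv_surj[OF contract_mv_space[OF Px(1)]] by blast
  qed
  have "dual_anchor x u \<in> tangent_space (charts E) x \<and>
      (\<forall>f\<in>Cinf. dual_anchor x (\<lambda>I. u I + w I) f = dual_anchor x u f + dual_anchor x w f \<and>
        dual_anchor x (\<lambda>I. c * u I) f = c * dual_anchor x u f)"
    if u: "u \<in> range (vector_mv ?r)" and w: "w \<in> range (vector_mv ?r)" for x u w c
  proof -
    have "contract ?r (\<lambda>I. u I + w I) (P x) = (\<lambda>I. contract ?r u (P x) I + contract ?r w (P x) I)"
      using contract_linear(1)[of ?r u w "P x"] by (simp only: plus_fun_def)
    moreover have "contract ?r (\<lambda>I. c * u I) (P x) = (\<lambda>I. c * contract ?r u (P x) I)"
      using contract_linear(7)[of ?r c u "P x"] by (simp only: smv_def)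
    moreover have "\<rho> x (contract ?r u (P x)) \<in> tangent_space (charts E) x \<and>
      (\<forall>f\<in>Cinf. \<rho> x (\<lambda>I. contract ?r u (P x) I + contract ?r w (P x) I) f =
          \<rho> x (contract ?r u (P x)) f + \<rho> x (contract ?r w (P x)) f \<and>
        \<rho> x (\<lambda>I. c * contract ?r u (P x) I) f = c * \<rho> x (contract ?r u (P x)) f)"
      using anchor range[OF u, of x] range[OF w, of x] unfolding anchor_map_def by blast
    moreover have "dual_anchor x u = \<rho> x (contract ?r u (P x))" by (simp add: dual_anchor_def fun_eq_iff)
    ultimately show ?thesis by (simp only: dual_anchor_def) blast
  qed
  moreover have "(\<lambda>x. dual_anchor x (\<alpha> x) f) \<in> Cinf" if "\<alpha> \<in> Omd 1" "f \<in> Cinf" for \<alpha> f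
    unfolding dual_anchor_act using that by simp
  ultimately show ?thesis unfolding anchor_map_def dual_bundle_simps by blast
qed

lemma dual_lie_algebroid: "lie_algebroid (dual_bundle E) (form_bracket E br \<rho> \<Phi> P) dual_anchor"
proof -
  \<comment> \<open>Any value in place of 0 would do. The generated bracket agrees with
    \<open>form_bracket\<close> on 1-forms; in nested brackets the inner one has to be recognised as
    a 1-form first.\<close>
  let ?b = "bracket 0"
  have fb: "form_bracket E br \<rho> \<Phi> P \<alpha> \<beta> = ?b \<alpha> \<beta>" if "\<alpha> \<in> Omd 1" "\<beta> \<in> Omd 1" for \<alpha> \<beta>
    using bracket_1[OF that] by simp
  have bb: "?b \<alpha> \<beta> \<in> Omd 1" if "\<alpha> \<in> Omd 1" "\<beta> \<in> Omd 1" for \<alpha> \<beta>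
    using bracket_deg[OF that] by simp
  show ?thesis
    unfolding lie_algebroid_def dual_bundle_simps
  proof (intro conjI ballI allI dual_anchor_map)
    fix \<alpha> \<beta> assume \<alpha>: "\<alpha> \<in> Omd 1" and \<beta>: "\<beta> \<in> Omd 1"
    have [simp]: "\<alpha> \<in> Om" "\<beta> \<in> Om" using \<alpha> \<beta> Omd_Om by blast+
    show "form_bracket E br \<rho> \<Phi> P \<alpha> \<beta> \<in> Omd 1" using \<alpha> \<beta> by (simp add: fb bb)
    show "form_bracket E br \<rho> \<Phi> P \<alpha> \<beta> = - form_bracket E br \<rho> \<Phi> P \<beta> \<alpha>"
      using bracket_skew[of \<alpha> 1 \<beta> 1 0] \<alpha> \<beta> by (simp add: fb)
    show "form_bracket E br \<rho> \<Phi> P \<alpha> (cscale c \<beta>) = cscale c (form_bracket E br \<rho> \<Phi> P \<alpha> \<beta>)" for c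
      using \<alpha> \<beta> by (simp add: fb bracket_linear(4)[of \<beta> \<beta> \<alpha>] sections_deg_linear)
    show "form_bracket E br \<rho> \<Phi> P \<alpha> (fscale f \<beta>) =
        fscale f (form_bracket E br \<rho> \<Phi> P \<alpha> \<beta>) + fscale (\<lambda>x. dual_anchor x (\<alpha> x) f) \<beta>" if f: "f \<in> Cinf" for f
    proof -
      have "?b \<alpha> (fun_field f \<^bold>\<and> \<beta>) = ?b \<alpha> (fun_field f) \<^bold>\<and> \<beta> + fun_field f \<^bold>\<and> ?b \<alpha> \<beta>"
        using bracket_leibniz[of \<alpha> 1 "fun_field f" 0 \<beta> 0] \<alpha> f by (simp add: fun_field_sections_deg)
      then show ?thesis
        unfolding dual_anchor_act bracket_fun[OF \<alpha> f]
        using \<alpha> \<beta> f Omd_Om[OF bb[OF \<alpha> \<beta>]]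
        by (simp add: fb sections_deg_linear fun_field_wedge[OF vbd] add.commute)
    qed
    fix \<gamma> assume \<gamma>: "\<gamma> \<in> Omd 1"
    have [simp]: "\<gamma> \<in> Om" using \<gamma> Omd_Om by blast
    show "form_bracket E br \<rho> \<Phi> P \<alpha> (\<beta> + \<gamma>) = form_bracket E br \<rho> \<Phi> P \<alpha> \<beta> + form_bracket E br \<rho> \<Phi> P \<alpha> \<gamma>"
      using \<alpha> \<beta> \<gamma> by (simp add: fb bracket_linear sections_deg_linear)
    show "form_bracket E br \<rho> \<Phi> P \<alpha> (form_bracket E br \<rho> \<Phi> P \<beta> \<gamma>) =
        form_bracket E br \<rho> \<Phi> P (form_bracket E br \<rho> \<Phi> P \<alpha> \<beta>) \<gamma> +
        form_bracket E br \<rho> \<Phi> P \<beta> (form_bracket E br \<rho> \<Phi> P \<alpha> \<gamma>)"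
      unfolding fb[OF \<alpha> \<beta>] fb[OF \<alpha> \<gamma>] fb[OF \<beta> \<gamma>] fb[OF \<alpha> bb[OF \<beta> \<gamma>]] fb[OF bb[OF \<alpha> \<beta>] \<gamma>] fb[OF \<beta> bb[OF \<alpha> \<gamma>]]
      by (rule bracket_jacobi[OF \<alpha> \<beta> \<gamma>])
  qed
qed

lemma powi_parity: "(-1::real) powi z = (if even z then 1 else -1)"
  by (cases z rule: int_cases2) (auto simp: power_int_minus)

lemma dual_schouten_bracket:
  "schouten_bracket (dual_bundle E) (form_bracket E br \<rho> \<Phi> P) dual_anchor
    (generated_bracket E (hom_op E br \<rho> \<Phi> a P))"
proof -
  let ?b = "bracket a"
  let ?gb = "generated_bracket E (hom_op E br \<rho> \<Phi> a P)"
  have gb: "?gb \<mu> \<nu> = ?b \<mu> \<nu>" if "\<mu> \<in> Om" "\<nu> \<in> Om" for \<mu> \<nu>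
    by (rule generated_bracket_eq[OF that])
  have zero: "?b 0 \<nu> = 0" "?b \<nu> 0 = 0" if "\<nu> \<in> Om" for \<nu>
    using bracket_linear(3)[OF that that that, of a 0] bracket_linear(4)[OF that that that, of a 0] by simp_all
  have skew: "?b \<mu> \<nu> = - cscale ((-1) powi ((k - 1) * (l - 1))) (?b \<nu> \<mu>)" if \<mu>: "\<mu> \<in> Omd k" and \<nu>: "\<nu> \<in> Omd l" for \<mu> \<nu> k l
  \<comment> \<open>The axioms quantify over integer degrees. Forms of negative degree are 0, which
    leaves the natural degrees of \<open>bracket_skew\<close>.\<close>
  proof (cases "k < 0 \<or> l < 0")
    case True
    then have "\<mu> = 0 \<or> \<nu> = 0" using \<mu> \<nu> Omd_zero_at by blast
    then show ?thesis using zero Omd_Om[OF \<mu>] Omd_Om[OF \<nu>] by auto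
  next
    case False
    then obtain m n where mn: "k = int m" "l = int n" by (metis nonneg_int_cases not_less)
    then have "(-1::real) powi ((k - 1) * (l - 1)) = (-1) ^ ((m + 1) * (n + 1))"
      by (cases "even m"; cases "even n"; simp add: powi_parity minus_one_power_iff)
    then show ?thesis using bracket_skew[OF \<mu>[unfolded mn] \<nu>[unfolded mn]] by (simp only:)
  qed
  have leib: "?b \<mu> (\<nu> \<^bold>\<and> \<kappa>) = ?b \<mu> \<nu> \<^bold>\<and> \<kappa> + cscale ((-1) powi ((k - 1) * l)) (\<nu> \<^bold>\<and> ?b \<mu> \<kappa>)"
    if \<mu>: "\<mu> \<in> Omd k" and \<nu>: "\<nu> \<in> Omd l" and \<kappa>: "\<kappa> \<in> Om" for \<mu> \<nu> \<kappa> k l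
  proof (cases "k < 0 \<or> l < 0")
    case True
    then have "\<mu> = 0 \<or> \<nu> = 0" using \<mu> \<nu> Omd_zero_at by blast
    then show ?thesis using zero Omd_Om[OF \<mu>] Omd_Om[OF \<nu>] \<kappa> by auto
  next
    case False
    then obtain m n where mn: "k = int m" "l = int n" by (metis nonneg_int_cases not_less)
    then have "(-1::real) powi ((k - 1) * l) = (-1) ^ ((m + 1) * n)"
      by (cases "even m"; cases "even n"; simp add: powi_parity minus_one_power_iff)
    then show ?thesis using bracket_leibniz[OF \<mu>[unfolded mn] \<nu>[unfolded mn] \<kappa>] by (simp only:)
  qed
  show ?thesis
    unfolding schouten_bracket_def dual_bundle_simps
  proof (intro conjI ballI allI)
    fix \<mu> \<nu> \<kappa> :: "'p mvfield" and c :: real assume "\<mu> \<in> Om" "\<nu> \<in> Om" "\<kappa> \<in> Om"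
    then show "?gb (\<mu> + \<nu>) \<kappa> = ?gb \<mu> \<kappa> + ?gb \<nu> \<kappa>" "?gb \<mu> (\<nu> + \<kappa>) = ?gb \<mu> \<nu> + ?gb \<mu> \<kappa>"
      "?gb (cscale c \<mu>) \<nu> = cscale c (?gb \<mu> \<nu>)" "?gb \<mu> (cscale c \<nu>) = cscale c (?gb \<mu> \<nu>)"
      by (simp_all add: gb bracket_linear)
  next
    fix k l \<mu> \<nu> assume \<mu>: "\<mu> \<in> Omd k" and \<nu>: "\<nu> \<in> Omd l"
    have [simp]: "\<mu> \<in> Om" "\<nu> \<in> Om" using \<mu> \<nu> Omd_Om by blast+
    show "?gb \<mu> \<nu> \<in> Omd (k + l - 1)" by (simp add: gb bracket_deg[OF \<mu> \<nu>])
    show "?gb \<mu> \<nu> = - cscale ((-1) powi ((k - 1) * (l - 1))) (?gb \<nu> \<mu>)"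
      unfolding gb[OF \<open>\<mu> \<in> Om\<close> \<open>\<nu> \<in> Om\<close>] gb[OF \<open>\<nu> \<in> Om\<close> \<open>\<mu> \<in> Om\<close>] by (rule skew[OF \<mu> \<nu>])
    fix \<kappa> assume \<kappa>: "\<kappa> \<in> Om"
    show "?gb \<mu> (\<nu> \<^bold>\<and> \<kappa>) = ?gb \<mu> \<nu> \<^bold>\<and> \<kappa> + cscale ((-1) powi ((k - 1) * l)) (\<nu> \<^bold>\<and> ?gb \<mu> \<kappa>)"
      unfolding gb[OF \<open>\<mu> \<in> Om\<close> \<open>\<nu> \<in> Om\<close>] gb[OF \<open>\<mu> \<in> Om\<close> \<kappa>] gb[OF \<open>\<mu> \<in> Om\<close> Om_closed(7)[OF \<open>\<nu> \<in> Om\<close> \<kappa>]]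
      by (rule leib[OF \<mu> \<nu> \<kappa>])
  next
    fix \<mu> \<nu> assume "\<mu> \<in> Omd 1" "\<nu> \<in> Omd 1"
    then show "?gb \<mu> \<nu> = form_bracket E br \<rho> \<Phi> P \<mu> \<nu>" by (simp add: gb Omd_Om bracket_1)
  next
    fix \<mu> f assume "\<mu> \<in> Omd 1" "f \<in> Cinf"
    then show "?gb \<mu> (fun_field f) = fun_field (\<lambda>x. dual_anchor x (\<mu> x) f)"
      unfolding dual_anchor_act by (simp add: gb Omd_Om bracket_fun)
  qed
qed

end

theorem corollary4:
  fixes E :: "('p::{t2_space,second_countable_topology}, 'b::real_inner) vbundle"
    and br S :: "'p mvfield \<Rightarrow> 'p mvfield \<Rightarrow> 'p mvfield"
    and \<rho> :: "'p anchor"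
    and \<Phi> P :: "'p mvfield"
    and a :: real
  assumes "vector_bundle E"
    and "lie_algebroid E br \<rho>"
    and "schouten_bracket E br \<rho> S"
    and "\<Phi> \<in> sections_deg (dual_bundle E) 1"
    and "ext_deriv E br \<rho> \<Phi> = 0"
    and "P \<in> sections_deg E 2"
    and "schouten_jacobi E S \<Phi> 2 2 P P = 0"
  shows "(\<forall>k. \<forall>\<mu>\<in>sections_deg (dual_bundle E) k.
            hom_op E br \<rho> \<Phi> a P \<mu> \<in> sections_deg (dual_bundle E) (k - 1)) \<and>
         (\<forall>\<mu>\<in>sections (dual_bundle E). hom_op E br \<rho> \<Phi> a P (hom_op E br \<rho> \<Phi> a P \<mu>) = 0) \<and>
         (\<forall>b. \<forall>\<mu>\<in>sections (dual_bundle E). \<forall>\<nu>\<in>sections (dual_bundle E).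
            generated_bracket E (hom_op E br \<rho> \<Phi> a P) \<mu> \<nu> =
            generated_bracket E (hom_op E br \<rho> \<Phi> b P) \<mu> \<nu>) \<and>
         (\<forall>\<mu>\<in>sections_deg (dual_bundle E) 1. \<forall>\<nu>\<in>sections_deg (dual_bundle E) 1.
            form_bracket E br \<rho> \<Phi> P \<mu> \<nu> =
              lie_deriv_tw E br \<rho> \<Phi> 1 (ins E \<mu> P) \<nu> - lie_deriv_tw E br \<rho> \<Phi> 1 (ins E \<nu> P) \<mu>
                - ext_deriv_tw E br \<rho> \<Phi> (ins E P (\<mu> \<^bold>\<and> \<nu>))) \<and>
         (\<exists>\<rho>'. lie_algebroid (dual_bundle E) (form_bracket E br \<rho> \<Phi> P) \<rho>' \<and>
            schouten_bracket (dual_bundle E) (form_bracket E br \<rho> \<Phi> P) \<rho>'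
              (generated_bracket E (hom_op E br \<rho> \<Phi> a P)))"
proof -
  interpret jacobi_algebroid E br S \<rho> \<Phi> P
    using assms by unfold_locales
  show ?thesis
  proof (intro conjI allI ballI)
    show "hom_op E br \<rho> \<Phi> a P \<mu> \<in> sections_deg (dual_bundle E) (k - 1)"
      if "\<mu> \<in> sections_deg (dual_bundle E) k" for k \<mu>
      using that by (simp add: hom_op_eq Omd_Om D_deg)
    show "hom_op E br \<rho> \<Phi> a P (hom_op E br \<rho> \<Phi> a P \<mu>) = 0" if "\<mu> \<in> sections (dual_bundle E)" for \<mu>
      using that by (simp add: hom_op_eq D_D)
    show "generated_bracket E (hom_op E br \<rho> \<Phi> a P) \<mu> \<nu> = generated_bracket E (hom_op E br \<rho> \<Phi> b P) \<mu> \<nu>"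
      if "\<mu> \<in> sections (dual_bundle E)" "\<nu> \<in> sections (dual_bundle E)" for b \<mu> \<nu>
      using that by (simp add: generated_bracket_eq bracket_eq)
    show "form_bracket E br \<rho> \<Phi> P \<mu> \<nu> =
        lie_deriv_tw E br \<rho> \<Phi> 1 (ins E \<mu> P) \<nu> - lie_deriv_tw E br \<rho> \<Phi> 1 (ins E \<nu> P) \<mu>
          - ext_deriv_tw E br \<rho> \<Phi> (ins E P (\<mu> \<^bold>\<and> \<nu>))"
      if "\<mu> \<in> sections_deg (dual_bundle E) 1" "\<nu> \<in> sections_deg (dual_bundle E) 1" for \<mu> \<nu>
      by (rule form_bracket_lie[OF that])
    show "\<exists>\<rho>'. lie_algebroid (dual_bundle E) (form_bracket E br \<rho> \<Phi> P) \<rho>' \<and>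
        schouten_bracket (dual_bundle E) (form_bracket E br \<rho> \<Phi> P) \<rho>'
          (generated_bracket E (hom_op E br \<rho> \<Phi> a P))"
      using dual_lie_algebroid dual_schouten_bracket by blast
  qed
qed

end
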